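(* For every L-tiling $T$ of the plane there is a colored tiling $T'$ with $\sigma T'=T$ (a composition of $T$) which is again an L-tiling.
   Context: Tiles. Let $\phi=\sqrt{(\sqrt5-1)/2}$, so $\phi^2+\phi^4=1$. The large proto-tile $L$ is the right triangle with hypotenuse $1$, large leg $\phi$, small leg $\phi^2$; the small proto-tile $S$ is the right triangle with hypotenuse $\phi$, large leg $\phi^2$, small leg $\phi^3$. Large (small) tiles are isometric images (reflections allowed) of $L$ (of $S$). A tiling is a family of tiles with pairwise disjoint interiors; $[T]$ is the union of the tiles of $T$; $T$ is a tiling of the plane if $[T]$ is the plane. A colored (decorated) tile is a tile each of whose three sides carries an orientation and a label in $\{0,1,2,3\}=\mathbb Z/4$, such that the hypotenuse and the small leg of a large tile and the large leg of a small tile have even labels and all the other sides have odd labels. A colored tiling consists of colored tiles. Decomposition and composition. Fix a homothety $H$ with coefficient $1/\phi$. To decompose a colored tiling: increase all labels by 1 mod 4, keeping all orientations; cut each large tile by its altitude to the hypotenuse into a copy of $\phi L$ and a copy of $\phi S$, where the two parts of the hypotenuse keep its (increased) label and its orientation, and the altitude (as a side of both parts) gets label $0$ and is oriented from its foot to the vertex of the right angle; each small tile is left uncut (it is a copy of $\phi L$); finally apply $H$. The result is denoted $\sigma T$. A colored tiling $T'$ is a composition of $T$ if $\sigma T'=T$. Stars. Let $A$ be a vertex of a tile of a colored tiling $T$. The star within $T$ centered at $A$ consists of all tiles of $T$ that contain the point $A$ (not necessarily as a vertex), considered without colors, together with the labels and orientations of precisely those sides of these tiles that contain $A$. The star is complete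 if the union of its tiles contains a neighborhood of $A$. Stars are considered up to isometry. Legal stars. A complete star is legal if, up to an isometry (reflections allowed), it is one of the stars $C_1,\dots,C_7$ described now. Place the center $A$ at the origin; the axis is a horizontal line through $A$. Write $h,b,a$ for the hypotenuse, large leg and small leg. $X^{xy}$ (with $X\in\{L,S\}$) is a tile of type $X$ with vertex at $A$, the two sides meeting at $A$ being $x$ and $y$. In the upper half-plane the tiles are listed clockwise from the left ray of the axis to the right ray; in the lower half-plane counterclockwise from the left ray to the right ray; in each $X^{xy}$ side $x$ comes first in this order, and consecutive tiles have adjacent sides along a common ray from $A$. $C_1$: upper $L^{ba},S^{ba}$; lower: one large tile whose large leg lies on the axis and contains $A$ in its interior, the right-angle vertex being at distance $\phi^5$ to the left of $A$ and the other end at distance $\phi^3$ to the right of $A$. $C_2$: upper $L^{ha},S^{bh},L^{ba}$; lower: one large tile whose hypotenuse lies on the axis, $A$ being the foot of its altitude, with the endpoint of the hypotenuse at the larger acute angle at distance $\phi^4$ to the left of $A$ and the other endpoint at distance $\phi^2$ to the right of $A$. $C_3$: upper $S^{ah},L^{bh},L^{ha},S^{bh}$; lower $S^{ab},L^{ab}$. $C_4$: upper $L^{ah},L^{hb},S^{ah},L^{bh}$; lower $L^{ab},S^{hb},L^{ah}$. $C_5$: upper $S^{ha},L^{bh},L^{ah},L^{hb}$; lower $S^{hb},L^{ah},L^{hb},S^{ha}$. $C_6$: upper $L^{ha},L^{hb},S^{ha},L^{bh}$; lower $L^{hb},S^{ha},L^{bh},L^{ha}$. $C_7$: upper $S^{ah},L^{bh},L^{ha},L^{hb}$;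 lower $L^{bh},L^{ha},L^{hb},S^{ah}$. Decoration of $C_n$: all sides containing $A$ and lying on the axis have one and the same orientation (either of the two) and one and the same label (either of the two labels congruent to $n$ mod 2). Every other side containing $A$ is either perpendicular to the axis, and then it is oriented away from $A$, or it forms with the axis the smaller acute angle $\arcsin((\sqrt5-1)/2)$ or the larger acute angle $\arccos((\sqrt5-1)/2)$, and then it is oriented towards $A$. In the upper half-plane the labels (mod 4) are: $n+1$ for sides at the smaller acute angle, $n+2$ for sides at the larger acute angle, $n+3$ for perpendicular sides. In the lower half-plane they are $n-1$, $n$, $n+1$, respectively. L-tilings. A colored tiling of the plane is an L-tiling if (i) any two sides of its tiles that share a common interval have matching (equal) orientations and labels, and (ii) every star within it is legal. *)

theory Defs
  imports "HOL-Analysis.Analysis" "HOL-Library.Numeral_Type"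
begin

definition phi :: real where
  "phi = sqrt ((sqrt 5 - 1) / 2)"

datatype kind = Large | Small

datatype side = Hyp | Long | Short

fun side_length :: "kind \<Rightarrow> side \<Rightarrow> real" where
  "side_length Large Hyp = 1"
| "side_length Large Long = phi"
| "side_length Large Short = phi ^ 2"
| "side_length Small Hyp = phi"
| "side_length Small Long = phi ^ 2"
| "side_length Small Short = phi ^ 3"

text \<open>The plane is the type of complex numbers. A tile is given by its kind and its three
  vertices: the vertex of the right angle, the vertex of the larger acute angle (common to
  hypotenuse and small leg), and the vertex of the smaller acute angle (common to hypotenuse
  and large leg). As the triangles are scalene and the two kinds are not congruent, a tile in
  the sense of \<open>is_tile\<close> is determined by its set of points.\<close>

datatype tile = Tile (kind: kind) (vright: complex) (vlarger: complex) (vsmaller: complex)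

definition map_tile :: "(complex \<Rightarrow> complex) \<Rightarrow> tile \<Rightarrow> tile" where
  "map_tile f t = Tile (kind t) (f (vright t)) (f (vlarger t)) (f (vsmaller t))"

definition proto_tile :: "kind \<Rightarrow> tile" where
  "proto_tile X = Tile X 0 (Complex 0 (side_length X Short)) (Complex (side_length X Long) 0)"

definition plane_isometry :: "(complex \<Rightarrow> complex) \<Rightarrow> bool" where
  "plane_isometry f \<longleftrightarrow> (\<forall>x y. dist (f x) (f y) = dist x y)"

definition is_tile :: "tile \<Rightarrow> bool" where
  "is_tile t \<longleftrightarrow> (\<exists>f. plane_isometry f \<and> t = map_tile f (proto_tile (kind t)))"

definition vertices :: "tile \<Rightarrow> complex set" where
  "vertices t = {vright t, vlarger t, vsmaller t}"

definition region :: "tile \<Rightarrow> complex set" where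
  "region t = convex hull (vertices t)"

fun side_ends :: "tile \<Rightarrow> side \<Rightarrow> complex \<times> complex" where
  "side_ends t Hyp = (vlarger t, vsmaller t)"
| "side_ends t Long = (vright t, vsmaller t)"
| "side_ends t Short = (vright t, vlarger t)"

definition side_segment :: "tile \<Rightarrow> side \<Rightarrow> complex set" where
  "side_segment t s = closed_segment (fst (side_ends t s)) (snd (side_ends t s))"

text \<open>Labels live in the ring \<open>4\<close> of integers modulo 4. The orientation of a side is the unit
  vector pointing along the side in the chosen direction, so that orientations of sides of
  different tiles can be compared directly.\<close>

type_synonym decoration = "complex \<times> 4"

type_synonym colored_tile = "tile \<times> (side \<Rightarrow> decoration)"

definition even_label :: "4 \<Rightarrow> bool" where
  "even_label l \<longleftrightarrow> l \<in> {0, 2}"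

definition is_colored_tile :: "colored_tile \<Rightarrow> bool" where
  "is_colored_tile = (\<lambda>(t, d). is_tile t \<and>
     (\<forall>s. case side_ends t s of (p, q) \<Rightarrow> fst (d s) = sgn (q - p) \<or> fst (d s) = sgn (p - q)) \<and>
     (\<forall>s. even_label (snd (d s)) \<longleftrightarrow>
        (kind t, s) \<in> {(Large, Hyp), (Large, Short), (Small, Long)}))"

definition colored_tiling :: "colored_tile set \<Rightarrow> bool" where
  "colored_tiling T \<longleftrightarrow> (\<forall>x\<in>T. is_colored_tile x) \<and>
     disjoint_family_on (\<lambda>x. interior (region (fst x))) T"

definition support :: "colored_tile set \<Rightarrow> complex set" where
  "support T = (\<Union>x\<in>T. region (fst x))"

definition homothety :: "complex \<Rightarrow> real \<Rightarrow> complex \<Rightarrow> complex" where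
  "homothety c k z = c + k *\<^sub>R (z - c)"

definition line_foot :: "complex \<Rightarrow> complex \<Rightarrow> complex \<Rightarrow> complex" where
  "line_foot p q r = p + (((r - p) \<bullet> (q - p)) / ((q - p) \<bullet> (q - p))) *\<^sub>R (q - p)"

definition increase :: "decoration \<Rightarrow> decoration" where
  "increase = (\<lambda>(u, l). (u, l + 1))"

text \<open>The pieces of a tile before the final homothety. They are tagged with the kind they have
  after it: a copy of \<open>phi L\<close> is tagged \<open>Large\<close>, a copy of \<open>phi S\<close> is tagged \<open>Small\<close>.\<close>

fun cut :: "colored_tile \<Rightarrow> colored_tile set" where
  "cut (Tile Small r p q, d) = {(Tile Large r p q, \<lambda>s. increase (d s))}"
| "cut (Tile Large r p q, d) =
     (let f = line_foot p q r; alt = (sgn (r - f), 0) in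
       {(Tile Large f r q,
          (\<lambda>s. case s of Hyp \<Rightarrow> increase (d Long) | Long \<Rightarrow> increase (d Hyp) | Short \<Rightarrow> alt)),
        (Tile Small f p r,
          (\<lambda>s. case s of Hyp \<Rightarrow> increase (d Short) | Long \<Rightarrow> alt | Short \<Rightarrow> increase (d Hyp)))})"

text \<open>The homothety has a positive coefficient, so it preserves the unit vectors that encode
  orientations; its center \<open>c\<close> is a parameter.\<close>

definition decomposition :: "complex \<Rightarrow> colored_tile set \<Rightarrow> colored_tile set" where
  "decomposition c T =
     (\<Union>x\<in>T. (\<lambda>(t, d). (map_tile (homothety c (1 / phi)) t, d)) ` cut x)"

definition is_composition :: "complex \<Rightarrow> colored_tile set \<Rightarrow> colored_tile set \<Rightarrow> bool" where
  "is_composition c T' T \<longleftrightarrow> colored_tiling T' \<and> decomposition c T' = T"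

text \<open>A star is its center together with its tiles, where a side of a tile carries a decoration
  iff it contains the center.\<close>

type_synonym star = "complex \<times> (tile \<times> (side \<Rightarrow> decoration option)) set"

definition star_within :: "colored_tile set \<Rightarrow> complex \<Rightarrow> star" where
  "star_within T A =
     (A, {(t, \<lambda>s. if A \<in> side_segment t s then Some (d s) else None) | t d.
            (t, d) \<in> T \<and> A \<in> region t})"

definition complete_star :: "star \<Rightarrow> bool" where
  "complete_star = (\<lambda>(A, W). A \<in> interior (\<Union>x\<in>W. region (fst x)))"

text \<open>An isometry acts on orientations by its linear part.\<close>

definition map_star :: "(complex \<Rightarrow> complex) \<Rightarrow> star \<Rightarrow> star" where
  "map_star f = (\<lambda>(A, W). (f A,
     (\<lambda>(t, c). (map_tile f t, \<lambda>s. map_option (\<lambda>(u, l). (f u - f 0, l)) (c s))) ` W))"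

text \<open>\<open>(X, x, y)\<close> stands for a tile of kind \<open>X\<close> with a vertex at the center, where the sides
  \<open>x\<close> and \<open>y\<close> meet.\<close>

type_synonym wedge = "kind \<times> side \<times> side"

fun wedge_angle :: "side \<Rightarrow> side \<Rightarrow> real" where
  "wedge_angle Hyp Long = arcsin ((sqrt 5 - 1) / 2)"
| "wedge_angle Long Hyp = arcsin ((sqrt 5 - 1) / 2)"
| "wedge_angle Hyp Short = arccos ((sqrt 5 - 1) / 2)"
| "wedge_angle Short Hyp = arccos ((sqrt 5 - 1) / 2)"
| "wedge_angle Long Short = pi / 2"
| "wedge_angle Short Long = pi / 2"

text \<open>The tile at the center 0 whose side \<open>x\<close> ends at \<open>p\<close> and whose side \<open>y\<close> ends at \<open>q\<close>.
  The two sides are meant to be different.\<close>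

fun wedge_tile :: "wedge \<Rightarrow> complex \<Rightarrow> complex \<Rightarrow> tile" where
  "wedge_tile (X, Hyp, Long) p q = Tile X q p 0"
| "wedge_tile (X, Long, Hyp) p q = Tile X p q 0"
| "wedge_tile (X, Hyp, Short) p q = Tile X q 0 p"
| "wedge_tile (X, Short, Hyp) p q = Tile X p 0 q"
| "wedge_tile (X, Long, Short) p q = Tile X 0 q p"
| "wedge_tile (X, Short, Long) p q = Tile X 0 p q"

text \<open>The fan of tiles around 0 that starts with the ray in direction \<open>u\<close> and proceeds
  counterclockwise (\<open>\<tau> = 1\<close>) or clockwise (\<open>\<tau> = -1\<close>). The decoration of a side depends only
  on the direction of its ray from 0 and is given by \<open>dec\<close>.\<close>

fun fan :: "real \<Rightarrow> (complex \<Rightarrow> decoration) \<Rightarrow> complex \<Rightarrow> wedge list \<Rightarrow>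
    (tile \<times> (side \<Rightarrow> decoration option)) set" where
  "fan \<tau> dec u [] = {}"
| "fan \<tau> dec u ((X, x, y) # ws) =
     (let v = u * cis (\<tau> * wedge_angle x y) in
       insert (wedge_tile (X, x, y) (side_length X x *\<^sub>R u) (side_length X y *\<^sub>R v),
               [x \<mapsto> dec u, y \<mapsto> dec v])
         (fan \<tau> dec v ws))"

text \<open>The decoration in \<open>C\<^sub>n\<close> of a side containing the center 0 and lying on the ray from 0 in
  direction \<open>u\<close> (a unit vector); the axis is the real line, with orientation \<open>e\<close> and
  label \<open>k\<close>. A ray in direction \<open>u\<close> forms the smaller acute angle with the axis iff the sine of
  that angle, \<open>\<bar>Im u\<bar>\<close>, is \<open>(sqrt 5 - 1) / 2\<close>; the last case is that of the larger acute
  angle.\<close>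

definition star_decoration :: "nat \<Rightarrow> complex \<Rightarrow> 4 \<Rightarrow> complex \<Rightarrow> decoration" where
  "star_decoration n e k u =
     (if Im u = 0 then (e, k)
      else if Re u = 0 then (u, if Im u > 0 then of_nat n + 3 else of_nat n + 1)
      else if \<bar>Im u\<bar> = (sqrt 5 - 1) / 2 then
        (- u, if Im u > 0 then of_nat n + 1 else of_nat n - 1)
      else (- u, if Im u > 0 then of_nat n + 2 else of_nat n))"

definition upper_wedges :: "nat \<Rightarrow> wedge list" where
  "upper_wedges n =
     (if n = 1 then [(Large, Long, Short), (Small, Long, Short)]
      else if n = 2 then [(Large, Hyp, Short), (Small, Long, Hyp), (Large, Long, Short)]
      else if n = 3 then
        [(Small, Short, Hyp), (Large, Long, Hyp), (Large, Hyp, Short), (Small, Long, Hyp)]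
      else if n = 4 then
        [(Large, Short, Hyp), (Large, Hyp, Long), (Small, Short, Hyp), (Large, Long, Hyp)]
      else if n = 5 then
        [(Small, Hyp, Short), (Large, Long, Hyp), (Large, Short, Hyp), (Large, Hyp, Long)]
      else if n = 6 then
        [(Large, Hyp, Short), (Large, Hyp, Long), (Small, Hyp, Short), (Large, Long, Hyp)]
      else if n = 7 then
        [(Small, Short, Hyp), (Large, Long, Hyp), (Large, Hyp, Short), (Large, Hyp, Long)]
      else [])"

definition lower_wedges :: "nat \<Rightarrow> wedge list" where
  "lower_wedges n =
     (if n = 3 then [(Small, Short, Long), (Large, Short, Long)]
      else if n = 4 then [(Large, Short, Long), (Small, Hyp, Long), (Large, Short, Hyp)]
      else if n = 5 then
        [(Small, Hyp, Long), (Large, Short, Hyp), (Large, Hyp, Long), (Small, Hyp, Short)]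
      else if n = 6 then
        [(Large, Hyp, Long), (Small, Hyp, Short), (Large, Long, Hyp), (Large, Hyp, Short)]
      else if n = 7 then
        [(Large, Long, Hyp), (Large, Hyp, Short), (Large, Hyp, Long), (Small, Short, Hyp)]
      else [])"

text \<open>In \<open>C\<^sub>1\<close> and \<open>C\<^sub>2\<close> the lower half-plane contains a single large tile, with the center inside
  its large leg or its hypotenuse. Its third vertex is determined by the leg lengths \<open>phi\<close>,
  \<open>phi\<^sup>2\<close> and by the altitude \<open>phi\<^sup>3\<close>, respectively.\<close>

definition lower_part :: "nat \<Rightarrow> complex \<Rightarrow> 4 \<Rightarrow> (tile \<times> (side \<Rightarrow> decoration option)) set" where
  "lower_part n e k =
     (if n = 1 then
        {(Tile Large (Complex (- (phi ^ 5)) 0) (Complex (- (phi ^ 5)) (- (phi ^ 2)))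
            (Complex (phi ^ 3) 0), [Long \<mapsto> (e, k)])}
      else if n = 2 then
        {(Tile Large (Complex 0 (- (phi ^ 3))) (Complex (- (phi ^ 4)) 0)
            (Complex (phi ^ 2) 0), [Hyp \<mapsto> (e, k)])}
      else fan 1 (star_decoration n e k) (- 1) (lower_wedges n))"

definition C_star :: "nat \<Rightarrow> complex \<Rightarrow> 4 \<Rightarrow> star" where
  "C_star n e k =
     (0, fan (- 1) (star_decoration n e k) (- 1) (upper_wedges n) \<union> lower_part n e k)"

definition legal_star :: "star \<Rightarrow> bool" where
  "legal_star S \<longleftrightarrow> complete_star S \<and>
     (\<exists>f n e k. plane_isometry f \<and> n \<in> {1..7} \<and> e \<in> {1, - 1} \<and>
        (even_label k \<longleftrightarrow> even n) \<and> map_star f S = C_star n e k)"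

definition sides_match :: "colored_tile set \<Rightarrow> bool" where
  "sides_match T \<longleftrightarrow> (\<forall>(t, d)\<in>T. \<forall>(t', d')\<in>T. \<forall>s s'.
     (\<exists>p q. p \<noteq> q \<and> closed_segment p q \<subseteq> side_segment t s \<inter> side_segment t' s') \<longrightarrow>
     d s = d' s')"

definition L_tiling :: "colored_tile set \<Rightarrow> bool" where
  "L_tiling T \<longleftrightarrow> colored_tiling T \<and> support T = UNIV \<and> sides_match T \<and>
     (\<forall>x\<in>T. \<forall>A\<in>vertices (fst x). legal_star (star_within T A))"

end

theory Submission
  imports Defs
begin

text \<open>Only one tiling can be the composition. In a legal star a small tile has its right angle at the
center only in \<open>C\<^sub>1\<close> and \<open>C\<^sub>3\<close>, and there it stands next to a large tile with its right angle at the same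
point, along a common leg which is labelled 0 and oriented away from the right angle. This is just
how the two parts of a decomposed large tile meet along their altitude. So every small tile is the
mate of a large tile (\<open>small_tile_is_mate\<close>), the composition must merge these pairs, and it
must turn the remaining large tiles into small ones. That the result is a tiling whose
decomposition is \<open>T\<close>, and that its sides match, is elementary geometry
(\<open>composition_tiling\<close>, \<open>decomposition_composition\<close>, \<open>composition_matches\<close>).

What has to be explained is why the stars of the result are legal. The composed star at a point is
determined by the star of \<open>T\<close> there and by the knowledge which of its large tiles are paired with a
small one. A large tile is paired iff the star at its right angle is \<open>C\<^sub>1\<close> or \<open>C\<^sub>3\<close>, and unpaired iff
that star is \<open>C\<^sub>2\<close> or \<open>C\<^sub>4\<close> (\<open>paired_iff\<close>), so this knowledge is about other stars. The key fact is
that a star other than \<open>C\<^sub>1\<close> nevertheless forces the pairing of its large tiles, except for one tile of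
\<open>C\<^sub>6\<close> that may or may not be paired (\<open>forced_pairing\<close>). With the forced pairing the stars compose to legal ones:
\<open>C\<^sub>2\<close> to \<open>C\<^sub>1\<close>, \<open>C\<^sub>3\<close> to \<open>C\<^sub>2\<close>, \<open>C\<^sub>4\<close> to \<open>C\<^sub>3\<close>, \<open>C\<^sub>5\<close> to \<open>C\<^sub>4\<close>, \<open>C\<^sub>7\<close> to \<open>C\<^sub>6\<close>, and \<open>C\<^sub>6\<close> to \<open>C\<^sub>5\<close> or \<open>C\<^sub>7\<close> according
to the undetermined tile (\<open>composes\<close>, \<open>composed_star\<close>). The center of \<open>C\<^sub>1\<close> is no vertex of the result,
because the two tiles that have a vertex there are merged along their altitude.

The forced pairing is proved by exhausting finitely many cases. Suppose the pairing of a tile is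
the wrong one. The known tiles at some vertex leave few legal stars for it; each of them brings
further tiles, and one continues with another vertex, until no legal star contains all the tiles
already known at its center. Mostly this happens at once, but for the fourth upper tile of \<open>C\<^sub>4\<close> and
the second upper tile of \<open>C\<^sub>7\<close> the contradiction arises only after many steps, at some distance.
The search trees are therefore written down as certificates, and a function checks them.

The check is a computation with integers. If \<open>\<alpha>\<close> is the smaller acute angle of the tiles, then
\<open>cis \<alpha> = phi + \<i> phi\<^sup>2\<close>. Hence in suitable coordinates all vertices that are met have coordinates
in the ring generated by \<open>phi\<close>, and all sides have directions \<open>\<i>\<^sup>a (cis \<alpha>)\<^sup>b\<close> with integers
\<open>a\<close>, \<open>b\<close>. Points are equal iff their integer coordinates are (\<open>val_inj\<close>), and directions are equal iff
their exponents are (\<open>direction_inj\<close>), so comparing codes compares tiles.\<close>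

section \<open>Integer combinations of the powers of phi\<close>

lemma phi_sq: "phi\<^sup>2 = (sqrt 5 - 1) / 2"
  by (simp add: phi_def)

lemma phi_pos: "phi > 0"
  by (simp add: phi_def)

lemma phi_4: "phi ^ 4 = 1 - phi\<^sup>2"
proof -
  have "phi ^ 4 = (phi\<^sup>2)\<^sup>2" by simp
  also have "\<dots> = 1 - phi\<^sup>2" unfolding phi_sq by (simp add: power2_eq_square field_simps)
  finally show ?thesis .
qed

lemma phi_less_1: "phi < 1"
proof (rule ccontr)
  assume "\<not> phi < 1"
  then have "phi\<^sup>2 \<ge> 1" "phi ^ 4 \<ge> 1" by simp_all
  with phi_4 show False by simp
qed

lemma phi_reduce: "phi * (phi * (phi * phi)) = 1 - phi * phi"
  "phi * (phi * (phi * (phi * x))) = x - phi * (phi * x)"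
proof -
  show *: "phi * (phi * (phi * phi)) = 1 - phi * phi"
    using phi_4 by (simp add: power4_eq_xxxx power2_eq_square mult.assoc)
  have "phi * (phi * (phi * (phi * x))) = (phi * (phi * (phi * phi))) * x" by simp
  then show "phi * (phi * (phi * (phi * x))) = x - phi * (phi * x)"
    unfolding * by (simp add: left_diff_distrib)
qed

lemma of_real_phi_reduce:
  "complex_of_real phi * (of_real phi * (of_real phi * of_real phi)) = 1 - of_real phi * of_real phi"
  "complex_of_real phi * (of_real phi * (of_real phi * (of_real phi * z))) = z - of_real phi * (of_real phi * z)"
proof -
  show *: "complex_of_real phi * (of_real phi * (of_real phi * of_real phi)) = 1 - of_real phi * of_real phi"
    using arg_cong[OF phi_reduce(1), of complex_of_real] by simp
  have "complex_of_real phi * (of_real phi * (of_real phi * (of_real phi * z)))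
    = (of_real phi * (of_real phi * (of_real phi * of_real phi))) * z" by simp
  then show "complex_of_real phi * (of_real phi * (of_real phi * (of_real phi * z))) = z - of_real phi * (of_real phi * z)"
    unfolding * by (simp add: left_diff_distrib)
qed

text \<open>The exponent of 5 is even in a square and odd in five times a nonzero square.\<close>

lemma int_sq_eq_5_sq:
  fixes x y :: int
  assumes "x\<^sup>2 = 5 * y\<^sup>2"
  shows "y = 0"
proof (rule ccontr)
  assume y: "y \<noteq> 0"
  have p: "prime (5::int)" by simp
  have x: "x \<noteq> 0" using assms y by auto
  have "multiplicity 5 (x\<^sup>2) = 2 * multiplicity 5 x"
    using p x by (simp add: prime_elem_multiplicity_power_distrib)
  moreover have "multiplicity 5 (5 * y\<^sup>2) = Suc (2 * multiplicity 5 y)"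
    using p y by (simp add: prime_elem_multiplicity_mult_distrib prime_elem_multiplicity_power_distrib)
  ultimately have "2 * multiplicity 5 x = Suc (2 * multiplicity 5 y)" using assms by simp
  then show False by presburger
qed

lemma sqrt5_indep:
  fixes m n :: int
  assumes "of_int m + of_int n * sqrt 5 = (0::real)"
  shows "m = 0 \<and> n = 0"
proof -
  have "real_of_int m = - (of_int n * sqrt 5)" using assms by simp
  then have "(real_of_int m)\<^sup>2 = 5 * (of_int n)\<^sup>2" by (simp add: power_mult_distrib)
  then have "m\<^sup>2 = 5 * n\<^sup>2" by (metis of_int_eq_iff of_int_mult of_int_numeral of_int_power)
  then have "n = 0" by (rule int_sq_eq_5_sq)
  with assms show ?thesis by simp
qed

text \<open>As \<open>phi ^ 4 = 1 - phi\<^sup>2\<close>, the numbers \<open>a + b phi + c phi\<^sup>2 + d phi\<^sup>3\<close> with integer coefficients are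
closed under multiplication. They are evaluated at an arbitrary point because
\<open>small_cis_power_eq_i_power\<close> uses another root of the same equation.\<close>

datatype zphi = Zphi int int int int

fun zphi_eval :: "'a::comm_ring_1 \<Rightarrow> zphi \<Rightarrow> 'a" where
  "zphi_eval x (Zphi a b c d) = of_int a + of_int b * x + of_int c * x ^ 2 + of_int d * x ^ 3"

text \<open>The four powers of \<open>phi\<close> are independent over the rationals. In a relation, \<open>phi\<close> times a number of the
field generated by \<open>sqrt 5\<close> equals another such number. Squaring and conjugating turns \<open>phi\<^sup>2\<close> into a
negative number, so that a square equals a nonpositive number and both vanish.\<close>

lemma zphi_eval_eq_0:
  assumes "zphi_eval phi (Zphi a b c d) = 0"
  shows "a = 0 \<and> b = 0 \<and> c = 0 \<and> d = 0"
proof -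
  define g where "g = phi\<^sup>2"
  have gg: "g * g = 1 - g" using phi_4 by (simp add: g_def power4_eq_xxxx power2_eq_square)
  have indep: "m = 0 \<and> n = 0" if "of_int m + of_int n * g = (0::real)" for m n :: int
  proof -
    have "of_int (2 * m - n) + of_int n * sqrt 5 = (0::real)"
      using that by (simp add: g_def phi_sq field_simps)
    from sqrt5_indep[OF this] show ?thesis by simp
  qed
  have e: "of_int a + of_int c * g = - phi * (of_int b + of_int d * g)"
    using assms by (simp add: g_def power3_eq_cube power2_eq_square algebra_simps)
  have coeff: "(of_int a + of_int c * x)\<^sup>2 - x * (of_int b + of_int d * x)\<^sup>2
     = of_int (a*a + c*c - 2*b*d + d*d) + of_int (2*a*c - c*c - (b-d)*(b-d) - d*d) * x"
    if "x * x = 1 - x" for x :: real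
  proof -
    have x2: "x ^ 2 = 1 - x" using that by (simp add: power2_eq_square)
    have "x ^ 3 = x * x ^ 2" by (simp add: power3_eq_cube power2_eq_square)
    also have "\<dots> = x - x ^ 2" unfolding x2 using that by (simp add: right_diff_distrib x2)
    finally have x3: "x ^ 2 = 1 - x" "x ^ 3 = 2 * x - 1" using x2 by simp_all
    have "(A + C * x)\<^sup>2 - x * (B + D * x)\<^sup>2
      = A * A + 2 * A * C * x + C * C * x ^ 2 - B * B * x - 2 * B * D * x ^ 2 - D * D * x ^ 3"
      for A B C D :: real
      by (simp add: power2_eq_square power3_eq_cube algebra_simps)
    from this[of "of_int a" "of_int c" "of_int b" "of_int d"] show ?thesis
      unfolding x3 by (simp add: algebra_simps)
  qed
  have "(of_int a + of_int c * g)\<^sup>2 - g * (of_int b + of_int d * g)\<^sup>2 = 0"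
    unfolding e by (simp add: power_mult_distrib flip: g_def)
  then have co: "a*a + c*c - 2*b*d + d*d = 0" "2*a*c - c*c - (b-d)*(b-d) - d*d = 0"
    using coeff[OF gg] indep by metis+
  \<comment> \<open>the conjugate of \<open>g\<close> satisfies the same equation but is negative\<close>
  define x where "x = - 1 - g"
  have "g > 0" using phi_pos by (simp add: g_def)
  then have x: "x * x = 1 - x" "x < 0" using gg by (simp_all add: x_def algebra_simps)
  have "(of_int a + of_int c * x)\<^sup>2 = x * (of_int b + of_int d * x)\<^sup>2"
    using coeff[OF x(1)] unfolding co by simp
  moreover have "x * (of_int b + of_int d * x)\<^sup>2 \<le> 0" using x(2) by (simp add: mult_nonpos_nonneg)
  moreover have "(of_int a + of_int c * x)\<^sup>2 \<ge> 0" by simp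
  ultimately have "(of_int a + of_int c * x)\<^sup>2 = 0" "x * (of_int b + of_int d * x)\<^sup>2 = 0"
    by linarith+
  then have "of_int a + of_int c * x = 0" "of_int b + of_int d * x = 0"
    using x(2) by simp_all
  then have "of_int (c - a) + of_int c * g = 0" "of_int (d - b) + of_int d * g = 0"
    by (simp_all add: x_def algebra_simps)
  then show ?thesis using indep by fastforce
qed

fun zadd :: "zphi \<Rightarrow> zphi \<Rightarrow> zphi" where
  "zadd (Zphi a b c d) (Zphi a' b' c' d') = Zphi (a + a') (b + b') (c + c') (d + d')"
fun zneg :: "zphi \<Rightarrow> zphi" where
  "zneg (Zphi a b c d) = Zphi (- a) (- b) (- c) (- d)"
fun ztimes_phi :: "zphi \<Rightarrow> zphi" where
  "ztimes_phi (Zphi a b c d) = Zphi d a (b - d) c"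

lemma zphi_eval_simps:
  "zphi_eval x (zadd y z) = zphi_eval x y + zphi_eval x z"
  "zphi_eval x (zneg y) = - zphi_eval x y"
  "x ^ 4 = 1 - x\<^sup>2 \<Longrightarrow> zphi_eval x (ztimes_phi y) = x * zphi_eval x y"
proof -
  assume "x ^ 4 = 1 - x\<^sup>2"
  then have *: "x * (x * (x * x)) = 1 - x * x" by (simp add: power4_eq_xxxx power2_eq_square mult.assoc)
  obtain a b c d where y: "y = Zphi a b c d" by (cases y)
  have "x * (x * (x * (x * of_int d))) = (1 - x * x) * of_int d" unfolding *[symmetric] by (simp add: algebra_simps)
  then show "zphi_eval x (ztimes_phi y) = x * zphi_eval x y"
    by (simp add: y power2_eq_square power3_eq_cube algebra_simps)
qed (cases y; cases z; simp add: algebra_simps; fail | cases y; simp add: algebra_simps)+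

lemma zphi_eval_inj: "zphi_eval phi y = zphi_eval phi z \<longleftrightarrow> y = z"
proof
  assume "zphi_eval phi y = zphi_eval phi z"
  then have *: "zphi_eval phi (zadd y (zneg z)) = 0" by (simp add: zphi_eval_simps)
  obtain a b c d a' b' c' d' where "y = Zphi a b c d" "z = Zphi a' b' c' d'" by (cases y; cases z)
  moreover from calculation * have "zphi_eval phi (Zphi (a - a') (b - b') (c - c') (d - d')) = 0"
    by (simp add: algebra_simps)
  ultimately show "y = z" using zphi_eval_eq_0[of "a - a'" "b - b'" "c - c'" "d - d'"] by simp
qed simp

section \<open>Points and directions with integer codes\<close>

datatype pt = Pt zphi zphi

fun val :: "pt \<Rightarrow> complex" where
  "val (Pt y z) = Complex (zphi_eval phi y) (zphi_eval phi z)"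

fun padd :: "pt \<Rightarrow> pt \<Rightarrow> pt" where
  "padd (Pt x y) (Pt x' y') = Pt (zadd x x') (zadd y y')"
fun pneg :: "pt \<Rightarrow> pt" where
  "pneg (Pt x y) = Pt (zneg x) (zneg y)"
fun ptimes_phi :: "pt \<Rightarrow> pt" where
  "ptimes_phi (Pt x y) = Pt (ztimes_phi x) (ztimes_phi y)"
fun ptimes_i :: "pt \<Rightarrow> pt" where
  "ptimes_i (Pt x y) = Pt (zneg y) x"
fun pcnj :: "pt \<Rightarrow> pt" where
  "pcnj (Pt x y) = Pt x (zneg y)"
definition pone :: pt where
  "pone = Pt (Zphi 1 0 0 0) (Zphi 0 0 0 0)"
definition pzero :: pt where
  "pzero = Pt (Zphi 0 0 0 0) (Zphi 0 0 0 0)"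

lemma val_simps [simp]:
  "val (padd p q) = val p + val q" "val (pneg p) = - val p"
  "val (ptimes_phi p) = complex_of_real phi * val p" "val (ptimes_i p) = \<i> * val p" "val (pcnj p) = cnj (val p)"
  "val pone = 1" "val pzero = 0"
  by (cases p; cases q; simp add: complex_eq_iff zphi_eval_simps phi_4 pone_def pzero_def)+

lemma val_inj: "val p = val q \<longleftrightarrow> p = q"
  by (cases p; cases q; simp add: zphi_eval_inj)

text \<open>Exponents of the imaginary unit, and also the labels of sides.\<close>

datatype z4 = Q0 | Q1 | Q2 | Q3

fun z4_succ :: "z4 \<Rightarrow> z4" where
  "z4_succ Q0 = Q1" | "z4_succ Q1 = Q2" | "z4_succ Q2 = Q3" | "z4_succ Q3 = Q0"
fun z4_add :: "z4 \<Rightarrow> z4 \<Rightarrow> z4" where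
  "z4_add Q0 y = y" | "z4_add Q1 y = z4_succ y" | "z4_add Q2 y = z4_succ (z4_succ y)"
| "z4_add Q3 y = z4_succ (z4_succ (z4_succ y))"
fun z4_neg :: "z4 \<Rightarrow> z4" where
  "z4_neg Q0 = Q0" | "z4_neg Q1 = Q3" | "z4_neg Q2 = Q2" | "z4_neg Q3 = Q1"

fun i_power :: "z4 \<Rightarrow> complex" where
  "i_power Q0 = 1" | "i_power Q1 = \<i>" | "i_power Q2 = - 1" | "i_power Q3 = - \<i>"

lemma i_power_simps:
  "i_power (z4_succ x) = \<i> * i_power x"
  "i_power (z4_add x y) = i_power x * i_power y" "i_power (z4_neg x) = cnj (i_power x)"
  "i_power x * cnj (i_power x) = 1"
proof -
  have s: "i_power (z4_succ x) = \<i> * i_power x" for x by (cases x) simp_all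
  show "i_power (z4_succ x) = \<i> * i_power x" by (rule s)
  show "i_power (z4_add x y) = i_power x * i_power y" by (cases x) (simp_all add: s)
  show "i_power (z4_neg x) = cnj (i_power x)" "i_power x * cnj (i_power x) = 1" by (cases x; simp)+
qed

lemma norm_i_power [simp]: "norm (i_power x) = 1"
  by (cases x) simp_all

type_synonym dir = "z4 \<times> int"

text \<open>The unit vector at the smaller acute angle; the one at the larger acute angle is \<open>\<i> * cnj small_cis\<close>.
So all directions of sides next to each other differ by powers of \<open>\<i>\<close> and of this number.\<close>

definition small_cis :: complex where
  "small_cis = Complex phi (phi\<^sup>2)"

lemma norm_small_cis [simp]: "norm small_cis = 1"
  using phi_4 by (simp add: small_cis_def cmod_def flip: power_mult)

lemma small_cis_ne_0 [simp]: "small_cis \<noteq> 0"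
  using norm_small_cis by (metis norm_zero zero_neq_one)

lemma small_cis_cnj: "cnj small_cis = inverse small_cis"
  using norm_small_cis by (simp add: inverse_complex_def complex_eq_iff cmod_def real_sqrt_eq_1_iff)

lemma cnj_small_cis_power_int: "cnj small_cis powi n = small_cis powi (- n)"
  by (simp add: power_int_def small_cis_cnj)

fun direction :: "dir \<Rightarrow> complex" where
  "direction (a, b) = i_power a * small_cis powi b"

fun dadd :: "dir \<Rightarrow> dir \<Rightarrow> dir" where
  "dadd (a, b) (a', b') = (z4_add a a', b + b')"
fun dneg :: "dir \<Rightarrow> dir" where
  "dneg (a, b) = (z4_neg a, - b)"

lemma norm_direction [simp]: "norm (direction d) = 1"
  by (cases d) (simp add: norm_mult norm_power_int)

lemma direction_simps:
  "direction (dadd d e) = direction d * direction e"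
  "direction (dneg d) = cnj (direction d)"
  by (cases d; cases e; simp add: i_power_simps power_int_add power_int_minus)
     (cases d; simp add: i_power_simps cnj_small_cis_power_int)

definition pcis :: "pt \<Rightarrow> pt" where
  "pcis p = (let q = ptimes_phi p in padd q (ptimes_i (ptimes_phi q)))"

fun pcis_power :: "nat \<Rightarrow> pt" where
  "pcis_power 0 = pone" | "pcis_power (Suc n) = pcis (pcis_power n)"

lemma val_pcis: "val (pcis p) = small_cis * val p"
proof -
  have "small_cis = of_real phi + \<i> * (of_real phi * of_real phi)"
    by (simp add: small_cis_def complex_eq_iff power2_eq_square)
  then have "small_cis * val p = (of_real phi + \<i> * (of_real phi * of_real phi)) * val p"
    by (rule arg_cong)
  then show ?thesis by (simp add: pcis_def Let_def algebra_simps)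
qed

lemma val_pcis_power: "val (pcis_power n) = small_cis ^ n"
  by (induction n) (simp_all add: val_pcis)

fun pdirection :: "dir \<Rightarrow> pt" where
  "pdirection (a, b) = (let z = (if b \<ge> 0 then pcis_power (nat b) else pcnj (pcis_power (nat (- b)))) in
     case a of Q0 \<Rightarrow> z | Q1 \<Rightarrow> ptimes_i z | Q2 \<Rightarrow> pneg z | Q3 \<Rightarrow> pneg (ptimes_i z))"

lemma val_pdirection [simp]: "val (pdirection d) = direction d"
proof (cases d)
  case (Pair a b)
  have "val (if b \<ge> 0 then pcis_power (nat b) else pcnj (pcis_power (nat (- b)))) = small_cis powi b"
    by (simp add: val_pcis_power power_int_def small_cis_cnj)
  then show ?thesis by (cases a) (simp_all add: Pair Let_def)
qed

text \<open>The conjugation that sends \<open>phi\<close> to another root \<open>x\<close> of its equation and fixes \<open>\<i>\<close>.\<close>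

fun conj_val :: "complex \<Rightarrow> pt \<Rightarrow> complex" where
  "conj_val x (Pt y z) = zphi_eval x y + \<i> * zphi_eval x z"

lemma conj_val_simps:
  assumes "x ^ 4 = 1 - x\<^sup>2"
  shows "conj_val x (padd p q) = conj_val x p + conj_val x q" "conj_val x (pneg p) = - conj_val x p"
    "conj_val x (ptimes_phi p) = x * conj_val x p" "conj_val x (ptimes_i p) = \<i> * conj_val x p"
    "conj_val x pone = 1"
  by (cases p; cases q; simp add: zphi_eval_simps assms pone_def algebra_simps)+

text \<open>The acute angles of the tiles are no rational multiples of \<open>pi\<close>: the conjugation that sends \<open>phi\<close> to \<open>\<i> y\<close>
with \<open>y\<^sup>2 = (sqrt 5 + 1) / 2\<close> sends \<open>small_cis\<close> to a number of modulus \<open>y\<^sup>2 - y < 1\<close>, but it preserves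
the modulus of the powers of \<open>\<i>\<close>.\<close>

lemma small_cis_power_eq_i_power:
  assumes "i_power a * small_cis ^ n = 1"
  shows "n = 0"
proof (rule ccontr)
  assume n: "n \<noteq> 0"
  define y where "y = sqrt ((sqrt 5 + 1) / 2)"
  have y2: "y\<^sup>2 = (sqrt 5 + 1) / 2" by (simp add: y_def)
  have y4: "y ^ 4 = 1 + y\<^sup>2"
  proof -
    have "y ^ 4 = (y\<^sup>2)\<^sup>2" by simp
    also have "\<dots> = 1 + y\<^sup>2" unfolding y2 by (simp add: power2_eq_square field_simps)
    finally show ?thesis .
  qed
  define x where "x = \<i> * complex_of_real y"
  have x4: "x ^ 4 = 1 - x\<^sup>2"
    by (simp add: x_def power_mult_distrib y4 flip: of_real_power)
  define k where "k = x + \<i> * x\<^sup>2"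
  have pc: "conj_val x (pcis_power m) = k ^ m" for m
    by (induction m) (simp_all add: conj_val_simps[OF x4] pcis_def Let_def k_def power2_eq_square algebra_simps)
  have "k = \<i> * complex_of_real (y - y\<^sup>2)"
    by (simp add: k_def x_def power_mult_distrib algebra_simps)
  then have nk: "norm k = \<bar>y - y\<^sup>2\<bar>" by (simp only: norm_mult norm_of_real) simp
  have "2 < sqrt (5::real)" "sqrt (5::real) < 3" by (auto intro: real_less_rsqrt real_less_lsqrt)
  then have "1 < y" "y\<^sup>2 < 2" using y2 by (auto simp: y_def intro!: real_less_rsqrt)
  then have "y - y\<^sup>2 < 0" "y - y\<^sup>2 > - 1" by (auto simp: power2_eq_square)
  with nk have "norm k < 1" by simp
  then have "norm (k ^ n) < 1" using n by (simp add: norm_power power_less_one_iff)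
  \<comment> \<open>the code of the left-hand side of the assumption; it must be that of 1, so its conjugate is 1, too\<close>
  define p where "p = (case a of Q0 \<Rightarrow> pcis_power n | Q1 \<Rightarrow> ptimes_i (pcis_power n)
    | Q2 \<Rightarrow> pneg (pcis_power n) | Q3 \<Rightarrow> pneg (ptimes_i (pcis_power n)))"
  have "val p = i_power a * small_cis ^ n" by (cases a) (simp_all add: p_def val_pcis_power)
  with assms have "val p = val pone" by simp
  then have "p = pone" by (simp only: val_inj)
  then have "conj_val x p = 1" by (simp add: conj_val_simps[OF x4])
  moreover have "conj_val x p = i_power a * k ^ n"
    by (cases a) (simp_all add: p_def conj_val_simps[OF x4] pc)
  ultimately have "norm (i_power a * k ^ n) = 1" by simp
  then show False using \<open>norm (k ^ n) < 1\<close> by (simp add: norm_mult)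
qed

lemma direction_inj: "direction d = direction e \<longleftrightarrow> d = e"
proof
  assume *: "direction d = direction e"
  obtain a b a' b' where d: "d = (a, b)" "e = (a', b')" by (cases d; cases e)
  have main: "y = y'" if "direction (x, y) = direction (x', y')" "y' \<le> y" for x y x' y'
  proof -
    have "1 = direction (x, y) * cnj (direction (x', y'))"
      unfolding that by (metis complex_norm_square norm_direction of_real_1 power_one)
    also have "\<dots> = direction (dadd (x, y) (dneg (x', y')))" by (simp only: direction_simps)
    also have "\<dots> = i_power (z4_add x (z4_neg x')) * small_cis ^ nat (y - y')"
      using that(2) by (simp add: power_int_def)
    finally have "nat (y - y') = 0" by (metis small_cis_power_eq_i_power)
    with that(2) show ?thesis by simp
  qed
  have "b = b'" using main[of a b a' b'] main[of a' b' a b] * d by (cases "b' \<le> b") auto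
  then have "i_power a = i_power a'" using * d by simp
  then have "a = a'" by (cases a; cases a') (auto simp: complex_eq_iff)
  then show "d = e" using d \<open>b = b'\<close> by simp
qed simp

section \<open>Motions, tiles, and tiles seen from a point\<close>

lemma sgn_unit_mult: "norm w = 1 \<Longrightarrow> sgn (w * z) = w * sgn (z::complex)"
  by (simp add: sgn_eq norm_mult)

text \<open>Motions that reverse the orientation of the plane involve a conjugation, marked by \<open>False\<close>.\<close>

definition cj :: "bool \<Rightarrow> complex \<Rightarrow> complex" where
  "cj c z = (if c then z else cnj z)"

lemma cj_simps [simp]:
  "cj c 0 = 0" "cj c (x + y) = cj c x + cj c y" "cj c (x - y) = cj c x - cj c y"
  "cj c (- x) = - cj c x" "cj c (x * y) = cj c x * cj c y" "cj c (of_real r) = of_real r" "cj c 1 = 1"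
  "cj c (r *\<^sub>R x) = r *\<^sub>R cj c x" "cj c (cj c' x) = cj (c = c') x" "norm (cj c x) = norm x"
  "cj True x = x" "cj c (x ^ n) = cj c x ^ n" "cj c x = cj c y \<longleftrightarrow> x = y" "cj c x = 0 \<longleftrightarrow> x = 0"
  by (auto simp: cj_def)

lemma cj_sgn: "cj c (sgn z) = sgn (cj c z)"
  by (simp add: cj_def sgn_eq)

definition motion :: "complex \<Rightarrow> complex \<Rightarrow> bool \<Rightarrow> complex \<Rightarrow> complex" where
  "motion A w c z = A + w * cj c z"

lemma motion_0 [simp]: "motion A w c 0 = A"
  by (simp add: motion_def)

lemma motion_motion:
  "motion A w c (motion A' w' c' z) = motion (motion A w c A') (w * cj c w') (c = c') z"
  by (simp add: motion_def algebra_simps)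

lemma plane_isometry_motion: "norm w = 1 \<Longrightarrow> plane_isometry (motion A w c)"
  by (simp add: plane_isometry_def motion_def dist_norm norm_mult flip: right_diff_distrib cj_simps(3))

lemma unit_times_cnj: "norm w = 1 \<Longrightarrow> w * (cnj w * z) = z" "norm w = 1 \<Longrightarrow> cnj w * (w * z) = z"
  by (metis complex_norm_square mult.assoc mult.commute mult_1 of_real_1 power_one)+

lemma plane_isometryE:
  assumes "plane_isometry f"
  obtains A w c where "norm w = 1" "f = motion A w c"
proof -
  define h where "h = (\<lambda>z. f z - f 0)"
  have "orthogonal_transformation h"
    using assms by (simp add: orthogonal_transformation_isometry h_def plane_isometry_def dist_norm)
  then have lin: "linear h" and inn: "\<And>x y. h x \<bullet> h y = x \<bullet> y"
    by (simp_all add: orthogonal_transformation_def)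
  define w where "w = h 1"
  define y where "y = cnj w * h \<i>"
  have nw: "norm w = 1" and ni: "norm (h \<i>) = 1"
    using inn[of 1 1] inn[of \<i> \<i>] by (simp_all add: w_def norm_eq_sqrt_inner)
  have hi: "h \<i> = w * y" using unit_times_cnj[OF nw] by (simp add: y_def)
  have "Re y = w \<bullet> h \<i>" by (simp add: y_def inner_complex_def)
  also have "\<dots> = 0" using inn[of 1 \<i>] by (simp add: w_def inner_complex_def)
  finally have "Re y = 0" .
  moreover have "norm y = 1" using nw ni by (simp add: y_def norm_mult)
  ultimately have "\<bar>Im y\<bar> = 1" by (simp add: cmod_def)
  with \<open>Re y = 0\<close> have y: "y = \<i> \<or> y = - \<i>" by (auto simp: complex_eq_iff abs_if split: if_splits)
  have hz: "h z = of_real (Re z) * w + of_real (Im z) * h \<i>" for z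
  proof -
    have "z = Re z *\<^sub>R 1 + Im z *\<^sub>R \<i>" by (simp add: complex_eq_iff)
    then have "h z = Re z *\<^sub>R h 1 + Im z *\<^sub>R h \<i>" by (metis lin linear_add linear_scale)
    then show ?thesis by (simp add: w_def scaleR_conv_of_real)
  qed
  have "f z = motion (f 0) w (y = \<i>) z" for z
  proof -
    have "f z = f 0 + h z" by (simp add: h_def)
    have "cj (y = \<i>) z = of_real (Re z) + of_real (Im z) * y"
      using y by (auto simp: cj_def complex_eq_iff)
    then have "h z = w * cj (y = \<i>) z"
      by (simp add: hz[of z] hi algebra_simps)
    with \<open>f z = f 0 + h z\<close> show ?thesis by (simp add: motion_def)
  qed
  then have "f = motion (f 0) w (y = \<i>)" by (rule ext)
  with nw show thesis by (rule that)
qed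

definition motion_inv :: "complex \<Rightarrow> complex \<Rightarrow> bool \<Rightarrow> complex \<Rightarrow> complex" where
  "motion_inv A w c = motion (- cj c (cnj w * A)) (cj c (cnj w)) c"

lemma motion_inv:
  assumes "norm w = 1"
  shows "motion A w c (motion_inv A w c z) = z" "motion_inv A w c (motion A w c z) = z"
    "plane_isometry (motion_inv A w c)"
proof -
  have 1: "w * cnj w = 1" "cnj w * w = 1"
    using unit_times_cnj[OF assms, of 1] by simp_all
  have "motion A w c (motion_inv A w c z) = A + (w * cnj w) * (z - A)"
    by (simp add: motion_def motion_inv_def algebra_simps)
  then show "motion A w c (motion_inv A w c z) = z" by (simp add: 1)
  have "motion_inv A w c (motion A w c z) = cj c (cnj w * w) * z"
    by (simp add: motion_def motion_inv_def algebra_simps)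
  then show "motion_inv A w c (motion A w c z) = z" by (simp add: 1 del: cj_simps(5))
  show "plane_isometry (motion_inv A w c)"
    unfolding motion_inv_def by (rule plane_isometry_motion) (use assms in simp)
qed

lemma map_tile_simps [simp]:
  "kind (map_tile f t) = kind t" "vright (map_tile f t) = f (vright t)"
  "vlarger (map_tile f t) = f (vlarger t)" "vsmaller (map_tile f t) = f (vsmaller t)"
  by (simp_all add: map_tile_def)

lemma map_tile_map_tile: "map_tile f (map_tile g t) = map_tile (\<lambda>z. f (g z)) t"
  by (simp add: map_tile_def)

definition hyp_length :: "kind \<Rightarrow> real" where
  "hyp_length k = side_length k Hyp"

lemma hyp_length_simps: "hyp_length Large = 1" "hyp_length Small = phi"
  by (simp_all add: hyp_length_def)

lemma hyp_length_pos: "hyp_length k > 0"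
  using phi_pos by (cases k) (simp_all add: hyp_length_simps)

lemma legs: "side_length k Long = phi * hyp_length k" "side_length k Short = phi\<^sup>2 * hyp_length k"
  by (cases k; simp add: hyp_length_simps power2_eq_square power3_eq_cube)+

lemma proto_tile_simps [simp]:
  "kind (proto_tile k) = k" "vright (proto_tile k) = 0"
  "vlarger (proto_tile k) = \<i> * of_real (phi\<^sup>2 * hyp_length k)"
  "vsmaller (proto_tile k) = of_real (phi * hyp_length k)"
  by (simp_all add: proto_tile_def legs complex_eq_iff)

lemma motion_proto_tile_inj:
  assumes "map_tile (motion A w c) (proto_tile k) = map_tile (motion A' w' c') (proto_tile k)" "w \<noteq> 0"
  shows "A = A' \<and> w = w' \<and> c = c'"
proof -
  have "A = A'" using arg_cong[OF assms(1), of vright] by simp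
  moreover have "w = w'" using arg_cong[OF assms(1), of vsmaller] \<open>A = A'\<close> phi_pos hyp_length_pos[of k]
    by (simp add: motion_def)
  moreover have "cj c \<i> = cj c' \<i>"
    using arg_cong[OF assms(1), of vlarger] \<open>A = A'\<close> \<open>w = w'\<close> assms(2) phi_pos hyp_length_pos[of k]
    by (simp add: motion_def)
  then have "c = c'" by (auto simp: cj_def complex_eq_iff split: if_splits)
  ultimately show ?thesis by simp
qed

lemma is_tile_iff_motion:
  "is_tile t \<longleftrightarrow> (\<exists>A w c. norm w = 1 \<and> t = map_tile (motion A w c) (proto_tile (kind t)))"
  unfolding is_tile_def by (metis plane_isometryE plane_isometry_motion)

text \<open>The points of a tile that can be the center of a legal star: the vertices at the right, the larger and
the smaller angle, and two points inside a side. The foot of the altitude on the hypotenuse is the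
center in the lower tile of \<open>C\<^sub>2\<close>; the last point lies on the large leg and is the center in the lower
tile of \<open>C\<^sub>1\<close>. Both divide their side in the ratio \<open>phi ^ 4\<close> to \<open>phi\<^sup>2\<close>.\<close>

datatype slot = SR | SP | SQ | SF | SM

fun spot :: "tile \<Rightarrow> slot \<Rightarrow> complex" where
  "spot t SR = vright t"
| "spot t SP = vlarger t"
| "spot t SQ = vsmaller t"
| "spot t SF = vlarger t + of_real (phi ^ 4) * (vsmaller t - vlarger t)"
| "spot t SM = vright t + of_real (phi ^ 4) * (vsmaller t - vright t)"

lemma spot_motion: "spot (map_tile (motion A w c) t) s = motion A w c (spot t s)"
  by (cases s) (simp_all add: motion_def algebra_simps)

definition spot_offset :: "kind \<Rightarrow> slot \<Rightarrow> complex" where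
  "spot_offset k s = spot (proto_tile k) s"

lemma spot_offset_simps:
  "spot_offset k SR = 0" "spot_offset k SP = \<i> * of_real (phi\<^sup>2 * hyp_length k)"
  "spot_offset k SQ = of_real (phi * hyp_length k)"
  "spot_offset k SM = of_real (phi ^ 5 * hyp_length k)"
  "spot_offset k SF = of_real (phi ^ 5 * hyp_length k) + \<i> * of_real (phi ^ 4 * hyp_length k)"
proof -
  have 5: "phi ^ 5 = phi ^ 4 * phi" by (simp add: eval_nat_numeral)
  have "phi ^ 4 + phi ^ 4 * phi\<^sup>2 = phi\<^sup>2 * (phi\<^sup>2 + phi ^ 4)"
    by (simp add: algebra_simps flip: power_add)
  then have "phi\<^sup>2 = phi ^ 4 + phi ^ 4 * phi\<^sup>2"
    unfolding phi_4 by simp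
  then have *: "phi\<^sup>2 * hyp_length k = phi ^ 4 * hyp_length k + phi ^ 4 * (phi\<^sup>2 * hyp_length k)"
    by (metis distrib_right mult.assoc)
  define P where "P = phi\<^sup>2 * hyp_length k"
  have P: "P - phi ^ 4 * P = phi ^ 4 * hyp_length k" using * unfolding P_def[symmetric] by simp
  show "spot_offset k SF = of_real (phi ^ 5 * hyp_length k) + \<i> * of_real (phi ^ 4 * hyp_length k)"
    unfolding spot_offset_def by (simp add: complex_eq_iff 5 P del: of_real_mult of_real_power flip: P_def)
  show "spot_offset k SM = of_real (phi ^ 5 * hyp_length k)"
    by (simp add: spot_offset_def 5 mult.assoc)
qed (simp_all add: spot_offset_def)

lemma spot_offset_inj: "spot_offset k s = spot_offset k s' \<longleftrightarrow> s = s'"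
proof -
  have "phi ^ 4 * phi < phi" using phi_pos phi_less_1 by (simp add: power_less_one_iff)
  moreover have "phi ^ 4 < phi\<^sup>2" using phi_pos phi_less_1 by (simp add: power_strict_decreasing)
  moreover have "phi ^ 5 = phi ^ 4 * phi" by (simp add: eval_nat_numeral)
  ultimately have "phi ^ 5 \<noteq> phi" "phi ^ 4 \<noteq> phi\<^sup>2" by linarith+
  then show ?thesis using phi_pos hyp_length_pos[of k]
    by (cases s; cases s') (auto simp: spot_offset_simps complex_eq_iff)
qed

lemma spot_in_region: "spot t s \<in> region t"
proof -
  have *: "p + of_real phi ^ 4 * (q - p) \<in> convex hull V" if "p \<in> V" "q \<in> V" for p q V
  proof -
    have "p + of_real phi ^ 4 * (q - p) = (1 - phi ^ 4) *\<^sub>R p + phi ^ 4 *\<^sub>R q"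
      by (simp add: scaleR_conv_of_real algebra_simps)
    moreover have "0 \<le> phi ^ 4" "phi ^ 4 \<le> 1" using phi_pos phi_less_1 by (simp_all add: power_le_one)
    ultimately show ?thesis using that
      by (metis convex_convex_hull convex_def add.commute diff_add_cancel diff_ge_0_iff_ge hull_inc)
  qed
  show ?thesis by (cases s) (simp_all add: region_def vertices_def hull_inc *)
qed

definition side_dir :: "tile \<Rightarrow> side \<Rightarrow> complex" where
  "side_dir t s = (case side_ends t s of (p, q) \<Rightarrow> sgn (q - p))"

lemma side_ends_map: "side_ends (map_tile f t) s = map_prod f f (side_ends t s)"
  by (cases s) simp_all

lemma side_dir_motion:
  "norm w = 1 \<Longrightarrow> side_dir (map_tile (motion A w c) t) s = w * cj c (side_dir t s)"
  by (simp add: side_dir_def side_ends_map motion_def sgn_unit_mult cj_sgn split: prod.split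
     flip: right_diff_distrib cj_simps(3))

lemma side_dir_proto:
  "side_dir (proto_tile k) Long = 1" "side_dir (proto_tile k) Short = \<i>"
  "side_dir (proto_tile k) Hyp = cnj small_cis"
proof -
  show "side_dir (proto_tile k) Long = 1"
    using hyp_length_pos[of k] phi_pos by (simp add: side_dir_def sgn_of_real flip: of_real_mult)
  have "side_dir (proto_tile k) Short = \<i> * sgn (complex_of_real (phi\<^sup>2 * hyp_length k))"
    by (simp add: side_dir_def sgn_unit_mult del: of_real_mult)
  also have "\<dots> = \<i>" using hyp_length_pos[of k] phi_pos by (simp add: sgn_of_real del: of_real_mult)
  finally show "side_dir (proto_tile k) Short = \<i>" .
  have "complex_of_real (phi * hyp_length k) - \<i> * complex_of_real (phi\<^sup>2 * hyp_length k) = cnj small_cis * of_real (hyp_length k)"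
    by (simp add: small_cis_def complex_eq_iff)
  then have "side_dir (proto_tile k) Hyp = sgn (cnj small_cis * of_real (hyp_length k))"
    by (simp add: side_dir_def del: of_real_mult)
  also have "\<dots> = cnj small_cis" using hyp_length_pos[of k] by (simp add: sgn_unit_mult sgn_of_real)
  finally show "side_dir (proto_tile k) Hyp = cnj small_cis" .
qed

lemma side_dir_nonzero: "is_tile t \<Longrightarrow> side_dir t s \<noteq> 0"
  by (cases s) (auto simp: is_tile_iff_motion side_dir_motion side_dir_proto dest: arg_cong[of t _ "\<lambda>t. side_dir t s"])

fun z4_val :: "z4 \<Rightarrow> 4" where
  "z4_val Q0 = 0" | "z4_val Q1 = 1" | "z4_val Q2 = 2" | "z4_val Q3 = 3"

lemma z4_val_simps:
  "z4_val (z4_succ x) = z4_val x + 1" "z4_val x = z4_val y \<longleftrightarrow> x = y"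
  "even_label (z4_val x) \<longleftrightarrow> x \<in> {Q0, Q2}"
proof -
  show "z4_val (z4_succ x) = z4_val x + 1" by (cases x) simp_all
  show "z4_val x = z4_val y \<longleftrightarrow> x = y" by (cases x; cases y) simp_all
  show "even_label (z4_val x) \<longleftrightarrow> x \<in> {Q0, Q2}" by (cases x) (simp_all add: even_label_def)
qed

lemma z4_val_surj: "\<exists>x. l = z4_val x"
proof (cases l)
  case (of_int z)
  then have "z = 0 \<or> z = 1 \<or> z = 2 \<or> z = 3" by auto
  then have "l = z4_val Q0 \<or> l = z4_val Q1 \<or> l = z4_val Q2 \<or> l = z4_val Q3" using of_int by auto
  then show ?thesis by blast
qed

text \<open>The decorations of those sides of a tile that contain the center of a star. An orientation is recorded
relative to the tile, as being the direction of \<open>side_ends\<close> or not, because then it does not change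
when the tile is moved.\<close>

datatype decs = Decs (dec_hyp: "(bool \<times> z4) option") (dec_long: "(bool \<times> z4) option")
  (dec_short: "(bool \<times> z4) option")

fun dec_at :: "decs \<Rightarrow> side \<Rightarrow> (bool \<times> z4) option" where
  "dec_at ds Hyp = dec_hyp ds" | "dec_at ds Long = dec_long ds" | "dec_at ds Short = dec_short ds"

fun decoration_of :: "tile \<Rightarrow> side \<Rightarrow> bool \<times> z4 \<Rightarrow> decoration" where
  "decoration_of t s (b, l) = ((if b then side_dir t s else - side_dir t s), z4_val l)"

lemma decoration_of_inj:
  assumes "is_tile t"
  shows "decoration_of t s x = decoration_of t s y \<longleftrightarrow> x = y"
  using side_dir_nonzero[OF assms, of s] by (cases x; cases y) (auto simp: z4_val_simps)

text \<open>A tile as it is seen from one of its five special points: which of them this is, the direction of the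
large leg starting at the right angle, and whether the tile is directly congruent to the proto-tile.
Together with the point these data determine the tile.\<close>

datatype germ = Germ (gkind: kind) (gslot: slot) (gdir: dir) (gchir: bool) (gdecs: decs)

definition germ_tile :: "complex \<Rightarrow> germ \<Rightarrow> tile" where
  "germ_tile A g = (let w = direction (gdir g) in
     map_tile (motion (A - w * cj (gchir g) (spot_offset (gkind g) (gslot g))) w (gchir g)) (proto_tile (gkind g)))"

definition entry :: "tile \<Rightarrow> decs \<Rightarrow> tile \<times> (side \<Rightarrow> decoration option)" where
  "entry t ds = (t, \<lambda>s. map_option (decoration_of t s) (dec_at ds s))"

text \<open>The germ after a motion that fixes the point of view.\<close>

fun turn :: "dir \<Rightarrow> bool \<Rightarrow> germ \<Rightarrow> germ" where
  "turn d c (Germ k s d' c' ds) = Germ k s (dadd d (if c then d' else dneg d')) (c = c') ds"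

lemma turn_simps [simp]: "gkind (turn d c g) = gkind g" "gslot (turn d c g) = gslot g"
  "gdecs (turn d c g) = gdecs g" "gchir (turn d c g) = (c = gchir g)"
  "gdir (turn d c g) = dadd d (if c then gdir g else dneg (gdir g))"
  by (cases g; simp)+

lemma kind_germ_tile [simp]: "kind (germ_tile A g) = gkind g"
  by (simp add: germ_tile_def Let_def)

lemma spot_germ_tile: "spot (germ_tile A g) (gslot g) = A"
  by (simp add: germ_tile_def Let_def spot_motion motion_def flip: spot_offset_def)

lemma germ_tile_turn: "germ_tile A (turn d c g) = map_tile (motion A (direction d) c) (germ_tile 0 g)"
proof -
  have "direction (dadd d (if c then gdir g else dneg (gdir g))) = direction d * cj c (direction (gdir g))"
    by (simp add: direction_simps cj_def)
  moreover have "motion (A - (direction d * cj c (direction (gdir g))) * cj (c = gchir g) x)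
      (direction d * cj c (direction (gdir g))) (c = gchir g)
    = (\<lambda>z. motion A (direction d) c (motion (- (direction (gdir g) * cj (gchir g) x)) (direction (gdir g)) (gchir g) z))" for x
    by (rule ext) (simp add: motion_def algebra_simps)
  ultimately show ?thesis by (simp add: germ_tile_def Let_def map_tile_map_tile)
qed

section \<open>The legal stars in integer codes\<close>

lemma z4_val_add: "z4_val (z4_add x y) = z4_val x + z4_val y"
  by (cases x; cases y) simp_all

fun z4_of_nat :: "nat \<Rightarrow> z4" where
  "z4_of_nat 0 = Q0" | "z4_of_nat (Suc n) = z4_succ (z4_of_nat n)"

lemma z4_val_of_nat: "z4_val (z4_of_nat n) = of_nat n"
  by (induction n) (simp_all add: z4_val_simps)

text \<open>The code of \<open>star_decoration\<close> for a side along a ray from the center; \<open>True\<close> means away from the center.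
The decoration \<open>ax\<close> of the axis may be left open; there \<open>True\<close> means oriented to the right. Since the
rays of the legal stars have exponents \<open>b\<close> of absolute value at most 1, the sign of \<open>b\<close> tells whether a
ray at an acute angle to the axis is above or below it.\<close>

fun ray_code :: "nat \<Rightarrow> (bool \<times> z4) option \<Rightarrow> dir \<Rightarrow> (bool \<times> z4) option" where
  "ray_code n ax (a, b) =
     (if b = 0 then
        (case a of Q0 \<Rightarrow> ax
         | Q2 \<Rightarrow> (case ax of None \<Rightarrow> None | Some (e, l) \<Rightarrow> Some (\<not> e, l))
         | Q1 \<Rightarrow> Some (True, z4_add Q3 (z4_of_nat n))
         | Q3 \<Rightarrow> Some (True, z4_add Q1 (z4_of_nat n)))
      else
        (case a of Q0 \<Rightarrow> Some (False, z4_add (if b > 0 then Q1 else Q3) (z4_of_nat n))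
         | Q1 \<Rightarrow> Some (False, z4_add Q2 (z4_of_nat n))
         | Q2 \<Rightarrow> Some (False, z4_add (if b > 0 then Q3 else Q1) (z4_of_nat n))
         | Q3 \<Rightarrow> Some (False, z4_of_nat n)))"

fun sign_vec :: "bool \<Rightarrow> complex" where
  "sign_vec True = 1" | "sign_vec False = - 1"

lemma direction_table:
  "direction (Q0, 0) = 1" "direction (Q1, 0) = \<i>" "direction (Q2, 0) = - 1" "direction (Q3, 0) = - \<i>"
  "direction (Q0, 1) = Complex phi (phi\<^sup>2)" "direction (Q1, 1) = Complex (- (phi\<^sup>2)) phi"
  "direction (Q2, 1) = Complex (- phi) (- (phi\<^sup>2))" "direction (Q3, 1) = Complex (phi\<^sup>2) (- phi)"
  "direction (Q0, - 1) = Complex phi (- (phi\<^sup>2))" "direction (Q1, - 1) = Complex (phi\<^sup>2) phi"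
  "direction (Q2, - 1) = Complex (- phi) (phi\<^sup>2)" "direction (Q3, - 1) = Complex (- (phi\<^sup>2)) (- phi)"
proof -
  have i: "small_cis powi - 1 = Complex phi (- (phi\<^sup>2))"
    using small_cis_cnj by (simp add: power_int_minus small_cis_def complex_eq_iff)
  show "direction (Q0, - 1) = Complex phi (- (phi\<^sup>2))" "direction (Q1, - 1) = Complex (phi\<^sup>2) phi"
    "direction (Q2, - 1) = Complex (- phi) (phi\<^sup>2)" "direction (Q3, - 1) = Complex (- (phi\<^sup>2)) (- phi)"
    unfolding direction.simps i by (simp_all add: complex_eq_iff)
qed (simp_all add: small_cis_def complex_eq_iff)

lemma ray_code:
  assumes "b \<in> {- 1, 0, 1}" "ray_code n (Some (e, l)) (a, b) = Some (away, l')"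
  shows "star_decoration n (sign_vec e) (z4_val l) (direction (a, b)) = (sign_vec away * direction (a, b), z4_val l')"
proof -
  have sd: "star_decoration n e' k u =
     (if Im u = 0 then (e', k)
      else if Re u = 0 then (u, if Im u > 0 then of_nat n + 3 else of_nat n + 1)
      else if \<bar>Im u\<bar> = phi\<^sup>2 then (- u, if Im u > 0 then of_nat n + 1 else of_nat n - 1)
      else (- u, if Im u > 0 then of_nat n + 2 else of_nat n))" for e' k u
    by (simp only: star_decoration_def phi_sq[symmetric])
  have ne: "phi\<^sup>2 \<noteq> 0" "phi \<noteq> 0" "phi \<noteq> phi\<^sup>2" "phi\<^sup>2 > 0" "\<bar>phi\<bar> = phi" "\<not> phi\<^sup>2 < 0" "\<not> phi < 0"
    using phi_pos phi_less_1 by (auto simp: power2_eq_square)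
  have m1: "(of_nat n - 1 :: 4) = 3 + of_nat n"
  proof -
    have "(- 1 :: 4) = 3" by simp
    then show ?thesis by (simp add: diff_conv_add_uminus del: add_uminus_conv_diff)
  qed
  note [simp] = sd ne m1 phi_pos z4_val_add z4_val_of_nat direction_table
  note [simp del] = direction.simps z4_add.simps
  consider "b = - 1" | "b = 0" | "b = 1" using assms(1) by blast
  then show ?thesis
  proof cases
    case 1 then show ?thesis using assms(2) by (cases a) (auto simp: add.commute)
  next
    case 2 then show ?thesis using assms(2) by (cases a; cases e) (auto simp: add.commute)
  next
    case 3 then show ?thesis using assms(2) by (cases a) (auto simp: add.commute)
  qed
qed

fun wedge_turn :: "side \<Rightarrow> side \<Rightarrow> dir" where
  "wedge_turn Hyp Long = (Q0, 1)" | "wedge_turn Long Hyp = (Q0, 1)"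
| "wedge_turn Hyp Short = (Q1, - 1)" | "wedge_turn Short Hyp = (Q1, - 1)"
| "wedge_turn x y = (Q1, 0)"

lemma direction_wedge_turn:
  assumes "x \<noteq> y"
  shows "direction (wedge_turn x y) = cis (wedge_angle x y)"
proof -
  have s: "sqrt (1 - phi ^ 4) = phi"
    using phi_4 phi_pos by simp
  have r: "- 1 \<le> phi\<^sup>2" "phi\<^sup>2 \<le> 1" using phi_pos phi_less_1 by (simp_all add: power_le_one order_trans[of "-1" 0 "phi\<^sup>2"])
  have 1: "cis (arcsin (phi\<^sup>2)) = small_cis"
    using r by (simp add: complex_eq_iff small_cis_def cos_arcsin s)
  have 2: "cis (arccos (phi\<^sup>2)) = \<i> * cnj small_cis"
    using r by (simp add: complex_eq_iff small_cis_def sin_arccos s)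
  have 3: "inverse small_cis = cnj small_cis" by (simp add: small_cis_cnj)
  show ?thesis using assms
    by (cases x; cases y) (simp_all add: 1 2 3 power_int_minus flip: phi_sq)
qed

text \<open>If the center is the vertex at the smaller angle, then the large leg points towards it, which reverses
the direction of the ray. If it is the vertex at the larger angle, then the large leg is perpendicular
to the ray of the small leg. A side is read with \<open>Not\<close> if \<open>side_ends\<close> lets it end at the center.\<close>

fun wedge_germ :: "bool \<Rightarrow> dir \<Rightarrow> dir \<Rightarrow> wedge \<Rightarrow> (bool \<times> z4) option \<Rightarrow> (bool \<times> z4) option \<Rightarrow> germ" where
  "wedge_germ ccw u v (X, Hyp, Long) d e =
     Germ X SQ (dadd (Q2, 0) v) ccw (Decs (map_option (map_prod Not id) d) (map_option (map_prod Not id) e) None)"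
| "wedge_germ ccw u v (X, Long, Hyp) d e =
     Germ X SQ (dadd (Q2, 0) u) (\<not> ccw) (Decs (map_option (map_prod Not id) e) (map_option (map_prod Not id) d) None)"
| "wedge_germ ccw u v (X, Hyp, Short) d e =
     Germ X SP (dadd (if ccw then Q3 else Q1, 0) v) (\<not> ccw) (Decs d None (map_option (map_prod Not id) e))"
| "wedge_germ ccw u v (X, Short, Hyp) d e =
     Germ X SP (dadd (if ccw then Q1 else Q3, 0) u) ccw (Decs e None (map_option (map_prod Not id) d))"
| "wedge_germ ccw u v (X, Long, Short) d e = Germ X SR u ccw (Decs None d e)"
| "wedge_germ ccw u v (X, Short, Long) d e = Germ X SR v (\<not> ccw) (Decs None e d)"
| "wedge_germ ccw u v (X, _, _) d e = Germ X SR u ccw (Decs None None None)"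

definition next_dir :: "bool \<Rightarrow> dir \<Rightarrow> side \<Rightarrow> side \<Rightarrow> dir" where
  "next_dir ccw u x y = dadd u (if ccw then wedge_turn x y else dneg (wedge_turn x y))"

fun fan_code :: "bool \<Rightarrow> (dir \<Rightarrow> (bool \<times> z4) option) \<Rightarrow> dir \<Rightarrow> wedge list \<Rightarrow> germ list" where
  "fan_code ccw dec u [] = []"
| "fan_code ccw dec u ((X, x, y) # ws) = (let v = next_dir ccw u x y in
     wedge_germ ccw u v (X, x, y) (dec u) (dec v) # fan_code ccw dec v ws)"

lemma wedge_germ_tile:
  assumes "x \<noteq> y" "v = next_dir ccw u x y"
  shows "wedge_tile (X, x, y) (side_length X x *\<^sub>R direction u) (side_length X y *\<^sub>R direction v)
    = germ_tile 0 (wedge_germ ccw u v (X, x, y) d e)"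
proof -
  define x' where "x' = complex_of_real phi"
  have cx: "cnj x' = x'" by (simp add: x'_def)
  have dt: "direction (Q0, 1) = x' + \<i> * (x' * x')" "direction (Q1, - 1) = x' * x' + \<i> * x'"
    "direction (Q1, 0) = \<i>" "direction (Q2, 0) = - 1" "direction (Q3, 0) = - \<i>"
    unfolding direction_table x'_def by (simp_all add: complex_eq_iff power2_eq_square)
  note p4 = of_real_phi_reduce[folded x'_def]
  have v: "direction v = direction u * cj ccw (direction (wedge_turn x y))"
    by (simp add: assms(2) next_dir_def direction_simps cj_def)
  have cc: "cj ccw \<i> = (if ccw then \<i> else - \<i>)" "cj (\<not> ccw) \<i> = (if ccw then - \<i> else \<i>)"
    by (simp_all add: cj_def)
  have hl: "side_length X Hyp = hyp_length X" by (simp add: hyp_length_def)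
  show ?thesis using assms(1)
    by (cases x; cases y; cases ccw)
       (simp_all add: germ_tile_def Let_def map_tile_def motion_def spot_offset_simps direction_simps v legs hl dt
          scaleR_conv_of_real cj_def p4 cx power2_eq_square algebra_simps flip: x'_def del: direction.simps)
qed

text \<open>The rays of a fan stay in the range where \<open>ray_code\<close> is correct.\<close>

fun fan_ok :: "bool \<Rightarrow> dir \<Rightarrow> wedge list \<Rightarrow> bool" where
  "fan_ok ccw u [] = (snd u \<in> {- 1, 0, 1})"
| "fan_ok ccw u ((X, x, y) # ws) = (snd u \<in> {- 1, 0, 1} \<and> x \<noteq> y \<and> fan_ok ccw (next_dir ccw u x y) ws)"

lemma fan_code:
  assumes "fan_ok ccw u ws"
  shows "fan (if ccw then 1 else - 1) (star_decoration n (sign_vec e) (z4_val l)) (direction u) ws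
    = (\<lambda>g. entry (germ_tile 0 g) (gdecs g)) ` set (fan_code ccw (ray_code n (Some (e, l))) u ws)"
  using assms
proof (induction ws arbitrary: u)
  case (Cons w ws)
  obtain X x y where w: "w = (X, x, y)" by (cases w)
  define v where "v = next_dir ccw u x y"
  let ?dec = "star_decoration n (sign_vec e) (z4_val l)"
  have xy: "x \<noteq> y" and u: "snd u \<in> {- 1, 0, 1}" and ok: "fan_ok ccw v ws"
    using Cons.prems by (simp_all add: w v_def)
  have v1: "snd v \<in> {- 1, 0, 1}" using ok by (cases ws) auto
  have dv: "direction u * cis ((if ccw then 1 else - 1) * wedge_angle x y) = direction v"
    by (simp add: v_def next_dir_def direction_simps direction_wedge_turn[OF xy] cis_cnj)
  have ray: "\<exists>away l'. ray_code n (Some (e, l)) u' = Some (away, l') \<and> ?dec (direction u') = (sign_vec away * direction u', z4_val l')"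
    if "snd u' \<in> {- 1, 0, 1}" for u'
  proof -
    obtain a b where u': "u' = (a, b)" by (cases u')
    obtain away l' where *: "ray_code n (Some (e, l)) u' = Some (away, l')"
      unfolding u' by (cases a; cases "b = 0") auto
    with ray_code[of b n e l a away l'] that u' show ?thesis by auto
  qed
  obtain away1 l1 where d1: "ray_code n (Some (e, l)) u = Some (away1, l1)"
    "?dec (direction u) = (sign_vec away1 * direction u, z4_val l1)" using ray[OF u] by blast
  obtain away2 l2 where d2: "ray_code n (Some (e, l)) v = Some (away2, l2)"
    "?dec (direction v) = (sign_vec away2 * direction v, z4_val l2)" using ray[OF v1] by blast
  define g where "g = wedge_germ ccw u v w (Some (away1, l1)) (Some (away2, l2))"
  have tile: "wedge_tile (X, x, y) (side_length X x *\<^sub>R direction u) (side_length X y *\<^sub>R direction v) = germ_tile 0 g"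
    unfolding g_def w by (rule wedge_germ_tile[OF xy v_def])
  have sg: "sgn (r *\<^sub>R direction d) = direction d" "sgn (- (r *\<^sub>R direction d)) = - direction d" if "r > 0" for r d
    using that by (simp_all add: sgn_scaleR sgn_minus) (simp_all add: sgn_eq)
  have pos: "side_length X z > 0" for z
    using phi_pos by (cases X; cases z) simp_all
  have "(wedge_tile (X, x, y) (side_length X x *\<^sub>R direction u) (side_length X y *\<^sub>R direction v),
       [x \<mapsto> ?dec (direction u), y \<mapsto> ?dec (direction v)]) = entry (germ_tile 0 g) (gdecs g)"
    unfolding entry_def tile[symmetric]
  proof (rule arg_cong[where f = "Pair _"], rule ext)
    fix s
    show "[x \<mapsto> ?dec (direction u), y \<mapsto> ?dec (direction v)] s =
      map_option (decoration_of (wedge_tile (X, x, y) (side_length X x *\<^sub>R direction u) (side_length X y *\<^sub>R direction v)) s) (dec_at (gdecs g) s)"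
      unfolding d1(2) d2(2) g_def w using xy
      by (cases x; cases y; cases s; cases away1; cases away2)
         (simp_all add: side_dir_def sg[OF pos])
  qed
  then show ?case
    using Cons.IH[OF ok] by (simp add: w Let_def dv d1(1) d2(1) g_def flip: v_def)
qed simp

text \<open>In \<open>C\<^sub>1\<close> and \<open>C\<^sub>2\<close> the side of the lower tile that contains the center runs to the right, like the axis.\<close>

fun lower_code :: "nat \<Rightarrow> (bool \<times> z4) option \<Rightarrow> germ list" where
  "lower_code n ax =
     (if n = 1 then [Germ Large SM (Q0, 0) False (Decs None ax None)]
      else if n = 2 then [Germ Large SF (Q0, 1) True (Decs ax None None)]
      else fan_code True (ray_code n ax) (Q2, 0) (lower_wedges n))"

definition star_code :: "nat \<Rightarrow> (bool \<times> z4) option \<Rightarrow> germ list" where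
  "star_code n ax = fan_code False (ray_code n ax) (Q2, 0) (upper_wedges n) @ lower_code n ax"

definition star_germs :: "germ list \<Rightarrow> (tile \<times> (side \<Rightarrow> decoration option)) set" where
  "star_germs G = (\<lambda>g. entry (germ_tile 0 g) (gdecs g)) ` set G"

lemma C_star_eq_star_code:
  assumes "n \<in> {1..7}"
  shows "C_star n (sign_vec e) (z4_val l) = (0, star_germs (star_code n (Some (e, l))))"
proof -
  have "n = 1 \<or> n = 2 \<or> n = 3 \<or> n = 4 \<or> n = 5 \<or> n = 6 \<or> n = 7" using assms by auto
  then have ok: "fan_ok False (Q2, 0) (upper_wedges n)" "fan_ok True (Q2, 0) (lower_wedges n)"
    by (auto simp: upper_wedges_def lower_wedges_def next_dir_def)
  have m: "- 1 = direction (Q2, 0)" by simp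
  have up: "fan (- 1) (star_decoration n (sign_vec e) (z4_val l)) (- 1) (upper_wedges n)
     = star_germs (fan_code False (ray_code n (Some (e, l))) (Q2, 0) (upper_wedges n))"
    using fan_code[OF ok(1), of n e l] by (simp add: star_germs_def)
  have lo: "fan 1 (star_decoration n (sign_vec e) (z4_val l)) (- 1) (lower_wedges n)
     = star_germs (fan_code True (ray_code n (Some (e, l))) (Q2, 0) (lower_wedges n))"
    using fan_code[OF ok(2), of n e l] by (simp add: star_germs_def)
  have sv: "sign_vec e * x = (if e then x else - x)" for x by (cases e) simp_all
  have "lower_part n (sign_vec e) (z4_val l) = star_germs (lower_code n (Some (e, l)))"
  proof -
    have p: "phi ^ 3 = phi * phi\<^sup>2" "phi ^ 5 = phi - phi * phi\<^sup>2" "phi ^ 4 = 1 - phi\<^sup>2"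
      by (simp_all add: eval_nat_numeral algebra_simps phi_reduce)
    have q: "phi ^ 4 = 1 - phi\<^sup>2" "phi ^ 5 = phi - phi ^ 3" "phi ^ 6 = 2 * phi\<^sup>2 - 1" "phi ^ 7 = 2 * phi ^ 3 - phi"
      by (simp_all add: eval_nat_numeral algebra_simps phi_reduce)
    have t1: "germ_tile 0 (Germ Large SM (Q0, 0) False ds) =
        Tile Large (Complex (- (phi ^ 5)) 0) (Complex (- (phi ^ 5)) (- (phi\<^sup>2))) (Complex (phi ^ 3) 0)" for ds
      by (simp add: germ_tile_def map_tile_def motion_def spot_offset_simps hyp_length_simps cj_def complex_eq_iff)
         (simp add: p)
    have t2: "germ_tile 0 (Germ Large SF (Q0, 1) True ds) =
        Tile Large (Complex 0 (- (phi ^ 3))) (Complex (- (phi ^ 4)) 0) (Complex (phi\<^sup>2) 0)" for ds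
      unfolding germ_tile_def map_tile_def Let_def germ.sel direction_table spot_offset_simps
      by (simp add: motion_def hyp_length_simps complex_eq_iff)
         (simp add: q algebra_simps, simp add: eval_nat_numeral algebra_simps phi_reduce)
    have "phi ^ 5 + phi ^ 3 > 0" "phi ^ 4 + phi\<^sup>2 > 0" using phi_pos by (simp_all add: add_pos_pos)
    then have "sgn (Complex (phi ^ 3 + phi ^ 5) 0) = 1" "sgn (Complex (phi\<^sup>2 + phi ^ 4) 0) = 1"
      by (simp_all add: sgn_eq complex_eq_iff cmod_def)
    then have d: "side_dir (Tile Large (Complex (- (phi ^ 5)) 0) z (Complex (phi ^ 3) 0)) Long = 1"
      "side_dir (Tile Large z (Complex (- (phi ^ 4)) 0) (Complex (phi\<^sup>2) 0)) Hyp = 1" for z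
      by (simp_all add: side_dir_def complex_diff)
    consider "n = 1" | "n = 2" | "n \<noteq> 1" "n \<noteq> 2" by blast
    then show ?thesis
    proof cases
      case 1
      have "[Long \<mapsto> (sign_vec e, z4_val l)] s = map_option (decoration_of
          (Tile Large (Complex (- (phi ^ 5)) 0) (Complex (- (phi ^ 5)) (- (phi\<^sup>2))) (Complex (phi ^ 3) 0)) s)
          (dec_at (Decs None (Some (e, l)) None) s)" for s
        by (cases s; cases e) (simp_all add: d)
      with 1 show ?thesis by (simp add: lower_part_def star_germs_def entry_def t1 fun_eq_iff)
    next
      case 2
      have "[Hyp \<mapsto> (sign_vec e, z4_val l)] s = map_option (decoration_of
          (Tile Large (Complex 0 (- (phi ^ 3))) (Complex (- (phi ^ 4)) 0) (Complex (phi\<^sup>2) 0)) s)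
          (dec_at (Decs (Some (e, l)) None None) s)" for s
        by (cases s; cases e) (simp_all add: d)
      with 2 show ?thesis by (simp add: lower_part_def star_germs_def entry_def t2 fun_eq_iff)
    next
      case 3
      then show ?thesis by (simp add: lower_part_def lo)
    qed
  qed
  then show ?thesis unfolding C_star_def star_code_def up by (simp add: star_germs_def image_Un)
qed

section \<open>Legal stars of a tiling\<close>

definition axes :: "nat \<Rightarrow> (bool \<times> z4) list" where
  "axes n = (if even n then [(True, Q0), (True, Q2), (False, Q0), (False, Q2)]
     else [(True, Q1), (True, Q3), (False, Q1), (False, Q3)])"

definition move_entry :: "(complex \<Rightarrow> complex) \<Rightarrow> tile \<times> (side \<Rightarrow> decoration option) \<Rightarrow> tile \<times> (side \<Rightarrow> decoration option)" where
  "move_entry f = (\<lambda>(t, c). (map_tile f t, \<lambda>s. map_option (\<lambda>(u, l). (f u - f 0, l)) (c s)))"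

lemma map_star_eq: "map_star f (A, W) = (f A, move_entry f ` W)"
  by (simp add: map_star_def move_entry_def)

lemma move_entry_motion_inv:
  assumes "norm w = 1"
  shows "move_entry (motion_inv A w c) (move_entry (motion A w c) x) = x"
    "move_entry (motion A w c) (move_entry (motion_inv A w c) x) = x"
proof -
  have 1: "w * cnj w = 1" "cnj w * w = 1"
    using unit_times_cnj[OF assms, of 1] by simp_all
  have u: "motion_inv A w c (w * cj c u) - motion_inv A w c 0 = u" "w * cj c (motion_inv A w c u - motion_inv A w c 0) = u" for u
  proof -
    have "motion_inv A w c (w * cj c u) - motion_inv A w c 0 = cj c (cnj w * w) * u"
      by (simp add: motion_def motion_inv_def)
    then show "motion_inv A w c (w * cj c u) - motion_inv A w c 0 = u" by (simp add: 1 del: cj_simps(5))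
    have "w * cj c (motion_inv A w c u - motion_inv A w c 0) = (w * cnj w) * u"
      by (simp add: motion_def motion_inv_def)
    then show "w * cj c (motion_inv A w c u - motion_inv A w c 0) = u" by (simp add: 1)
  qed
  have m: "motion A w c u - A = w * cj c u" for u by (simp add: motion_def)
  obtain t d where x: "x = (t, d)" by (cases x)
  have cases_d: "map_option (\<lambda>(u, l). (f u, l)) (map_option (\<lambda>(u, l). (g u, l)) y) = y"
    if "\<And>u. f (g u) = u" for f g :: "complex \<Rightarrow> complex" and y :: "decoration option"
    using that by (cases y) auto
  show "move_entry (motion_inv A w c) (move_entry (motion A w c) x) = x"
    by (cases t) (simp add: x move_entry_def map_tile_def motion_inv[OF assms] m fun_eq_iff cases_d[of "\<lambda>u. motion_inv A w c u - motion_inv A w c 0" "\<lambda>u. w * cj c u", OF u(1)])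
  show "move_entry (motion A w c) (move_entry (motion_inv A w c) x) = x"
    by (cases t) (simp add: x move_entry_def map_tile_def motion_inv[OF assms] m fun_eq_iff cases_d[of "\<lambda>u. w * cj c u" "\<lambda>u. motion_inv A w c u - motion_inv A w c 0", OF u(2)])
qed

lemma move_entry_entry:
  assumes "norm w = 1"
  shows "move_entry (motion A w c) (entry t ds) = entry (map_tile (motion A w c) t) ds"
proof -
  have "(case decoration_of t s x of (u, l) \<Rightarrow> (motion A w c u - motion A w c 0, l))
     = decoration_of (map_tile (motion A w c) t) s x" for s x
    by (cases x) (simp add: side_dir_motion[OF assms] motion_def)
  then show ?thesis
    by (simp add: move_entry_def entry_def option.map_comp comp_def)
qed

definition placed :: "complex \<Rightarrow> complex \<Rightarrow> bool \<Rightarrow> germ \<Rightarrow> tile" where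
  "placed A w c g = map_tile (motion A w c) (germ_tile 0 g)"

text \<open>A legal star of a tiling, with its type, the decoration of its axis, and its position made explicit.\<close>

definition star_is :: "colored_tile set \<Rightarrow> complex \<Rightarrow> complex \<Rightarrow> bool \<Rightarrow> nat \<Rightarrow> bool \<times> z4 \<Rightarrow> bool" where
  "star_is T A w c n ax \<longleftrightarrow> norm w = 1 \<and> n \<in> {1..7} \<and> ax \<in> set (axes n) \<and>
     star_within T A = (A, (\<lambda>g. entry (placed A w c g) (gdecs g)) ` set (star_code n (Some ax)))"

lemma axes_iff: "(e, l) \<in> set (axes n) \<longleftrightarrow> (even_label (z4_val l) \<longleftrightarrow> even n)"
  by (cases l; cases e) (auto simp: axes_def even_label_def)

lemma sign_vec_cases: "e \<in> {1, - 1} \<longleftrightarrow> (\<exists>b. e = sign_vec b)"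
  by (metis insert_iff sign_vec.simps singletonD bool.exhaust)

lemma legal_starE:
  assumes "legal_star (star_within T A)"
  obtains w c n ax where "star_is T A w c n ax"
proof -
  obtain f n e k where f: "plane_isometry f" and n: "n \<in> {1..7}" and e: "e \<in> {1, - 1}"
    and k: "even_label k \<longleftrightarrow> even n" and eq: "map_star f (star_within T A) = C_star n e k"
    using assms unfolding legal_star_def by blast
  obtain B w c where w: "norm w = 1" and fB: "f = motion B w c" using f by (rule plane_isometryE)
  obtain b where b: "e = sign_vec b" using e sign_vec_cases by blast
  obtain l where l: "k = z4_val l" using z4_val_surj by blast
  define W where "W = snd (star_within T A)"
  have W: "star_within T A = (A, W)" by (simp add: W_def star_within_def)
  have fA: "f A = 0" and fW: "move_entry f ` W = star_germs (star_code n (Some (b, l)))"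
    using eq unfolding W map_star_eq b l C_star_eq_star_code[OF n] by auto
  define w' where "w' = cj c (cnj w)"
  have w': "norm w' = 1" using w by (simp add: w'_def)
  have "motion_inv B w c 0 = A" using fA fB motion_inv(2)[OF w] by metis
  then have inv: "motion_inv B w c = motion A w' c"
    by (simp add: motion_inv_def w'_def)
  have "W = move_entry (motion_inv B w c) ` move_entry f ` W"
    unfolding fB image_image move_entry_motion_inv[OF w] by simp
  also have "\<dots> = (\<lambda>g. entry (placed A w' c g) (gdecs g)) ` set (star_code n (Some (b, l)))"
    unfolding fW inv star_germs_def image_image placed_def move_entry_entry[OF w'] by simp
  finally have "star_is T A w' c n (b, l)"
    unfolding star_is_def W using w' n k l by (simp add: axes_iff)
  then show thesis by (rule that)
qed

lemma legal_starI:
  assumes "complete_star (A, W)" "norm w = 1" "n \<in> {1..7}" "ax \<in> set (axes n)"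
    "W = (\<lambda>g. entry (placed A w c g) (gdecs g)) ` set (star_code n (Some ax))"
  shows "legal_star (A, W)"
proof -
  obtain e l where ax: "ax = (e, l)" by (cases ax)
  have W: "W = move_entry (motion A w c) ` star_germs (star_code n (Some (e, l)))"
    unfolding assms(5) ax star_germs_def image_image placed_def move_entry_entry[OF assms(2)] by simp
  have "motion_inv A w c A = 0" using motion_inv(2)[OF assms(2), of A c 0] by simp
  then have "map_star (motion_inv A w c) (A, W) = C_star n (sign_vec e) (z4_val l)"
    unfolding map_star_eq W image_image move_entry_motion_inv[OF assms(2)] C_star_eq_star_code[OF assms(3)] by simp
  moreover have "sign_vec e \<in> {1, - 1}" by (cases e) simp_all
  ultimately show ?thesis
    unfolding legal_star_def using assms(1,3,4) ax motion_inv(3)[OF assms(2)] by (metis axes_iff)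
qed

lemma is_tile_placed: "norm w = 1 \<Longrightarrow> is_tile (placed A w c g)"
  unfolding is_tile_iff_motion placed_def germ_tile_def Let_def map_tile_map_tile motion_motion
  by (intro exI conjI) (auto simp: norm_mult)

lemma kind_placed [simp]: "kind (placed A w c g) = gkind g"
  by (simp add: placed_def)

lemma spot_placed: "spot (placed A w c g) (gslot g) = A"
  by (simp add: placed_def spot_motion spot_germ_tile)

lemma star_is_germ:
  assumes "star_is T A w c n ax" "g \<in> set (star_code n (Some ax))"
  obtains d where "(placed A w c g, d) \<in> T" "A \<in> region (placed A w c g)"
    "\<And>s. A \<in> side_segment (placed A w c g) s \<longleftrightarrow> dec_at (gdecs g) s \<noteq> None"
    "\<And>s x. dec_at (gdecs g) s = Some x \<Longrightarrow> d s = decoration_of (placed A w c g) s x"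
proof -
  have "entry (placed A w c g) (gdecs g) \<in> snd (star_within T A)"
    using assms by (auto simp: star_is_def)
  then obtain d where d: "(placed A w c g, d) \<in> T" "A \<in> region (placed A w c g)"
    and fe: "(\<lambda>s. map_option (decoration_of (placed A w c g) s) (dec_at (gdecs g) s))
       = (\<lambda>s. if A \<in> side_segment (placed A w c g) s then Some (d s) else None)"
    by (auto simp: star_within_def entry_def)
  have e: "map_option (decoration_of (placed A w c g) s) (dec_at (gdecs g) s)
       = (if A \<in> side_segment (placed A w c g) s then Some (d s) else None)" for s using fun_cong[OF fe, of s] by simp
  have 1: "A \<in> side_segment (placed A w c g) s \<longleftrightarrow> dec_at (gdecs g) s \<noteq> None" for s
    using e[of s] by (auto split: if_splits)
  show thesis
  proof (rule that[OF d 1])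
    show "d s = decoration_of (placed A w c g) s x" if "dec_at (gdecs g) s = Some x" for s x
      using e[of s] that by (auto split: if_splits)
  qed
qed

lemma star_is_tile:
  assumes "star_is T A w c n ax" "(t, d) \<in> T" "A \<in> region t"
  obtains g where "g \<in> set (star_code n (Some ax))" "t = placed A w c g"
    "\<And>s x. dec_at (gdecs g) s = Some x \<Longrightarrow> d s = decoration_of t s x"
    "\<And>s. A \<in> side_segment t s \<longleftrightarrow> dec_at (gdecs g) s \<noteq> None"
proof -
  have "(t, \<lambda>s. if A \<in> side_segment t s then Some (d s) else None) \<in> snd (star_within T A)"
    using assms(2,3) by (auto simp: star_within_def)
  then obtain g where g: "g \<in> set (star_code n (Some ax))" and "t = placed A w c g" and
    fe: "(\<lambda>s. if A \<in> side_segment t s then Some (d s) else None) = (\<lambda>s. map_option (decoration_of t s) (dec_at (gdecs g) s))"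
    using assms(1) by (auto simp: star_is_def entry_def)
  have e: "map_option (decoration_of t s) (dec_at (gdecs g) s)
       = (if A \<in> side_segment t s then Some (d s) else None)" for s using fun_cong[OF fe, of s] by simp
  show thesis
  proof (rule that[OF g \<open>t = _\<close>])
    show "A \<in> side_segment t s \<longleftrightarrow> dec_at (gdecs g) s \<noteq> None" for s
      using e[of s] by (auto split: if_splits)
    show "d s = decoration_of t s x" if "dec_at (gdecs g) s = Some x" for s x
      using e[of s] that by (auto split: if_splits)
  qed
qed

section \<open>Refuting configurations of tiles\<close>

datatype ptile = PTile kind dir bool decs "(slot \<times> pt) list"

text \<open>In the frame of a large tile the special points are \<open>0\<close>, \<open>\<i> phi\<^sup>2\<close>, \<open>phi\<close>, \<open>phi ^ 5 + \<i> phi ^ 4\<close> and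
\<open>phi ^ 5\<close>; a small tile is \<open>phi\<close> times as large.\<close>

fun spot_points :: "pt \<Rightarrow> germ \<Rightarrow> (slot \<times> pt) list" where
  "spot_points A (Germ k s d c ds) =
    (let turn = (\<lambda>p. if c then ptimes_i p else pneg (ptimes_i p));
         z1 = ptimes_phi (case k of Large \<Rightarrow> pdirection d | Small \<Rightarrow> ptimes_phi (pdirection d));
         z2 = ptimes_phi z1; z4 = ptimes_phi (ptimes_phi z2); z5 = ptimes_phi z4;
         p = turn z2; f = padd z5 (turn z4);
         r = padd A (pneg (case s of SR \<Rightarrow> pzero | SP \<Rightarrow> p | SQ \<Rightarrow> z1 | SF \<Rightarrow> f | SM \<Rightarrow> z5))
     in [(SR, r), (SP, padd r p), (SQ, padd r z1), (SF, padd r f), (SM, padd r z5)])"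

fun ptile_of :: "pt \<Rightarrow> germ \<Rightarrow> ptile" where
  "ptile_of A (Germ k s d c ds) = PTile k d c ds (spot_points A (Germ k s d c ds))"

definition place :: "pt \<Rightarrow> dir \<Rightarrow> bool \<Rightarrow> germ \<Rightarrow> ptile" where
  "place A d c g = ptile_of A (turn d c g)"

fun germs_of_tile :: "pt \<Rightarrow> ptile \<Rightarrow> germ list" where
  "germs_of_tile A (PTile k d c ds sp) = map (\<lambda>(s, p). Germ k s d c ds) (filter (\<lambda>(s, p). p = A) sp)"

definition germs_at :: "pt \<Rightarrow> ptile list \<Rightarrow> germ list" where
  "germs_at A P = concat (map (germs_of_tile A) P)"

fun compatible :: "(bool \<times> z4) option \<Rightarrow> (bool \<times> z4) option \<Rightarrow> bool" where
  "compatible (Some x) (Some y) = (x = y)"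
| "compatible _ _ = True"

text \<open>The nested conditionals make the evaluation stop at the first difference; the same holds for the
functions below.\<close>

fun fits :: "germ \<Rightarrow> germ \<Rightarrow> bool" where
  "fits (Germ k s d c (Decs h l a)) (Germ k' s' d' c' (Decs h' l' a')) =
    (if s = s' then if k = k' then if c = c' then if d = d' then
       if compatible h h' then if compatible l l' then compatible a a' else False else False
     else False else False else False else False)"

fun fits_some :: "germ list \<Rightarrow> germ \<Rightarrow> bool" where
  "fits_some [] g = False" | "fits_some (h # hs) g = (if fits h g then True else fits_some hs g)"

fun all_fit :: "germ list \<Rightarrow> germ list \<Rightarrow> bool" where
  "all_fit hs [] = True" | "all_fit hs (g # gs) = (if fits_some hs g then all_fit hs gs else False)"

text \<open>The rotation or reflection that puts an entry \<open>g\<close> of a star onto a known tile \<open>g0\<close> at the center.\<close>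

fun rel_turn :: "germ \<Rightarrow> germ \<Rightarrow> dir \<times> bool" where
  "rel_turn g0 g = (if gchir g0 = gchir g then (dadd (gdir g0) (dneg (gdir g)), True) else (dadd (gdir g0) (gdir g), False))"

text \<open>A candidate for the star at a point consists of its type, its position, and the axis decoration.\<close>

type_synonym candidate = "nat \<times> (dir \<times> bool) \<times> (bool \<times> z4) option"

definition candidate_germs :: "candidate \<Rightarrow> germ list" where
  "candidate_germs = (\<lambda>(n, (d, c), ax). map (turn d c) (star_code n ax))"

lemma candidate_germs_simp: "candidate_germs (n, (d, c), ax) = map (turn d c) (star_code n ax)"
  by (simp add: candidate_germs_def)

text \<open>If the known tiles \<open>N\<close> exclude none of the four decorations of the axis, then these are kept together as
one candidate with an open axis. This keeps the search trees small.\<close>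

definition axis_choices :: "germ list \<Rightarrow> nat \<Rightarrow> dir \<times> bool \<Rightarrow> candidate list" where
  "axis_choices N n t =
    (if all_fit (candidate_germs (n, t, None)) N then
      (let L = filter (\<lambda>ax. all_fit (candidate_germs (n, t, Some ax)) N) (axes n) in
        if length L = 4 then [(n, t, None)] else map (\<lambda>ax. (n, t, Some ax)) L)
     else [])"

text \<open>Any entry with the kind and the slot of \<open>g0\<close> may be the known tile; this choice fixes the position.\<close>

definition candidates_of :: "germ list \<Rightarrow> germ \<Rightarrow> nat \<Rightarrow> candidate list" where
  "candidates_of N g0 n = concat (map (\<lambda>g. axis_choices N n (rel_turn g0 g))
     (filter (\<lambda>g. if gkind g = gkind g0 then gslot g = gslot g0 else False) (star_code n None)))"

definition candidates :: "germ list \<Rightarrow> germ \<Rightarrow> candidate list" where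
  "candidates N g0 = concat (map (candidates_of N g0) [1, 2, 3, 4, 5, 6, 7])"

text \<open>A node of a search tree tells where to look next: at the star centered at the given special point of
the tile with the given index in the list of known tiles. It has one subtree for every candidate that
contains all known tiles at this point.\<close>

datatype certificate = Branch nat slot "certificate list"

fun slot_point :: "slot \<Rightarrow> (slot \<times> pt) list \<Rightarrow> pt" where
  "slot_point s [] = pzero" | "slot_point s ((s', p) # sp) = (if s = s' then p else slot_point s sp)"

fun ptile_germ :: "slot \<Rightarrow> ptile \<Rightarrow> pt \<times> germ" where
  "ptile_germ s (PTile k d c ds sp) = (slot_point s sp, Germ k s d c ds)"

text \<open>Only at vertices the star is known to be legal, so the other special points are no possible next centers.\<close>

fun check :: "ptile list \<Rightarrow> certificate \<Rightarrow> bool"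
  and check_all :: "ptile list \<Rightarrow> pt \<Rightarrow> candidate list \<Rightarrow> certificate list \<Rightarrow> bool" where
  "check P (Branch i s cs) =
    (if i < length P then if s = SF then False else if s = SM then False else
       case ptile_germ s (P ! i) of (A, g) \<Rightarrow> check_all P A (candidates (germs_at A P) g) cs
     else False)"
| "check_all P A [] cs = True"
| "check_all P A (x # xs) [] = False"
| "check_all P A ((n, (d, c), ax) # xs) (C # cs) =
    (if check (map (place A d c) (star_code n ax) @ P) C then check_all P A xs cs else False)"

text \<open>The certificate concerns the right angle of the tile with index \<open>j\<close>. By \<open>paired_iff\<close> a paired tile is one
with star \<open>C\<^sub>1\<close> or \<open>C\<^sub>3\<close> there and an unpaired one has \<open>C\<^sub>2\<close> or \<open>C\<^sub>4\<close>, so only the candidates of the two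
types that contradict the claim have to be refuted.\<close>

fun certified :: "nat \<Rightarrow> (bool \<times> z4) option \<Rightarrow> nat \<Rightarrow> bool \<Rightarrow> certificate list \<Rightarrow> bool" where
  "certified n ax j paired cs =
    (let P = map (place pzero (Q0, 0) True) (star_code n ax) in
     case ptile_germ SR (P ! j) of (A, g) \<Rightarrow>
       check_all P A (filter (\<lambda>(m, _). if paired then m = 2 \<or> m = 4 else m = 1 \<or> m = 3) (candidates (germs_at A P) g)) cs)"

lemma dadd_zero [simp]: "dadd (Q0, 0) d = d"
  by (cases d) simp

lemma turn_zero [simp]: "turn (Q0, 0) True g = g"
  by (cases g) simp

definition agrees :: "decs \<Rightarrow> tile \<Rightarrow> (side \<Rightarrow> decoration) \<Rightarrow> bool" where
  "agrees ds t d \<longleftrightarrow> (\<forall>s x. dec_at ds s = Some x \<longrightarrow> d s = decoration_of t s x)"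

definition present :: "colored_tile set \<Rightarrow> (complex \<Rightarrow> complex) \<Rightarrow> complex \<Rightarrow> germ \<Rightarrow> bool" where
  "present T f A g \<longleftrightarrow> (\<exists>d. (map_tile f (germ_tile A g), d) \<in> T \<and> agrees (gdecs g) (map_tile f (germ_tile A g)) d)"

text \<open>Leaving the axis decoration of a star open makes its germs weaker in this sense.\<close>

definition weaker :: "germ \<Rightarrow> germ \<Rightarrow> bool" where
  "weaker g h \<longleftrightarrow> gkind g = gkind h \<and> gslot g = gslot h \<and> gdir g = gdir h \<and> gchir g = gchir h \<and>
     (\<forall>s. dec_at (gdecs g) s = None \<or> dec_at (gdecs g) s = dec_at (gdecs h) s)"

lemma all_sides: "(\<forall>s. P s) \<longleftrightarrow> P Hyp \<and> P Long \<and> P Short"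
  by (metis side.exhaust)

lemma ray_code_None: "ray_code n None u = None \<or> ray_code n None u = ray_code n ax u"
  by (cases u; cases "fst u") auto

lemma weaker_fan_code:
  assumes "\<And>u. dec u = None \<or> dec u = dec' u"
  shows "list_all2 weaker (fan_code ccw dec u ws) (fan_code ccw dec' u ws)"
proof (induction ws arbitrary: u)
  case (Cons w ws)
  obtain X x y where w: "w = (X, x, y)" by (cases w)
  have "weaker (wedge_germ ccw u v (X, x, y) d e) (wedge_germ ccw u v (X, x, y) d' e')"
    if "d = None \<or> d = d'" "e = None \<or> e = e'" for v d e d' e'
    using that unfolding weaker_def all_sides by (cases x; cases y) auto
  with Cons show ?case by (simp add: w Let_def assms)
qed simp

lemma weaker_star_code: "list_all2 weaker (star_code n None) (star_code n (Some ax))"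
proof -
  have "list_all2 weaker (fan_code ccw (ray_code n None) u ws) (fan_code ccw (ray_code n (Some ax)) u ws)" for ccw u ws
    by (rule weaker_fan_code) (rule ray_code_None)
  moreover have "list_all2 weaker (lower_code n None) (lower_code n (Some ax))"
    using calculation by (auto simp: weaker_def all_sides)
  ultimately show ?thesis by (simp add: star_code_def list_all2_appendI)
qed

lemma germ_tile_weaker: "weaker g h \<Longrightarrow> germ_tile A g = germ_tile A h"
  by (simp add: weaker_def germ_tile_def)

lemma present_weaker:
  assumes "present T f A h" "weaker g h"
  shows "present T f A g"
  using assms germ_tile_weaker[OF assms(2), of A] unfolding present_def agrees_def weaker_def
  by (metis option.distinct(1))

lemma weaker_turn: "weaker g h \<Longrightarrow> weaker (turn d c g) (turn d c h)"
  by (simp add: weaker_def)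

lemma spot_inj:
  assumes "is_tile t"
  shows "spot t s = spot t s' \<longleftrightarrow> s = s'"
proof -
  obtain A w c where w: "norm w = 1" and t: "t = map_tile (motion A w c) (proto_tile (kind t))"
    using assms unfolding is_tile_iff_motion by blast
  have "spot t r = A + w * cj c (spot_offset (kind t) r)" for r
    by (subst t) (simp add: spot_motion motion_def spot_offset_def)
  moreover have "w \<noteq> 0" using w by auto
  ultimately show ?thesis by (simp add: spot_offset_inj)
qed

lemma map_germ_tile:
  "map_tile (motion B u b) (germ_tile A g) = map_tile (motion (motion B u b (A - direction (gdir g) * cj (gchir g) (spot_offset (gkind g) (gslot g))))
     (u * cj b (direction (gdir g))) (b = gchir g)) (proto_tile (gkind g))"
  by (simp add: germ_tile_def Let_def map_tile_map_tile motion_motion)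

lemma map_germ_tile_inj:
  assumes "norm u = 1" "norm u' = 1"
    "map_tile (motion B u b) (germ_tile A g) = map_tile (motion B' u' b') (germ_tile A' g')"
    "motion B u b A = motion B' u' b' A'"
  shows "gkind g = gkind g'" "gslot g = gslot g'"
    "u * cj b (direction (gdir g)) = u' * cj b' (direction (gdir g'))" "(b = gchir g) = (b' = gchir g')"
proof -
  have k: "gkind g = gkind g'" using arg_cong[OF assms(3), of kind] by simp
  show "gkind g = gkind g'" by (rule k)
  let ?t = "map_tile (motion B u b) (germ_tile A g)"
  have "is_tile ?t"
    unfolding is_tile_iff_motion map_germ_tile using assms(1) by (intro exI conjI) (auto simp: norm_mult)
  moreover have "spot ?t (gslot g) = motion B u b A" by (simp add: spot_motion spot_germ_tile)
  moreover have "spot ?t (gslot g') = motion B u b A"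
    unfolding assms(3,4) by (simp add: spot_motion spot_germ_tile)
  ultimately show "gslot g = gslot g'" using spot_inj by metis
  have "u * cj b (direction (gdir g)) \<noteq> 0"
    using assms(1) norm_direction[of "gdir g"] by (auto simp del: norm_direction)
  from motion_proto_tile_inj[OF assms(3)[unfolded map_germ_tile k] this]
  show "u * cj b (direction (gdir g)) = u' * cj b' (direction (gdir g'))" "(b = gchir g) = (b' = gchir g')"
    by auto
qed

lemma is_tile_map_germ_tile: "norm u = 1 \<Longrightarrow> is_tile (map_tile (motion B u b) (germ_tile A g))"
  unfolding is_tile_iff_motion map_germ_tile by (intro exI conjI) (auto simp: norm_mult)

text \<open>A single tile of the star determines how the star is placed, since a tile has no symmetries.\<close>

lemma turn_to_star:
  assumes "norm u = 1" "norm w = 1"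
    "map_tile (motion B u b) (germ_tile A g0) = placed (motion B u b A) w c g1"
    "rel_turn g0 g1 = (d, e)"
  shows "placed (motion B u b A) w c g = map_tile (motion B u b) (germ_tile A (turn d e g))"
proof -
  have eq: "motion B u b A = motion (motion B u b A) w c 0" by simp
  note inj = map_germ_tile_inj[OF assms(1,2) assms(3)[unfolded placed_def] eq]
  have un: "direction x * cnj (direction x) = 1" "cnj (direction x) * direction x = 1" for x
    using unit_times_cnj[OF norm_direction, of x 1] by simp_all
  have ec: "c = (b = e)" using inj(4) assms(4) by (auto split: if_splits)
  have "u * cj b (direction d) = w"
  proof (cases "gchir g0 = gchir g1")
    case True
    then have "c = b" "d = dadd (gdir g0) (dneg (gdir g1))" using inj(4) assms(4) by auto
    then have "u * cj b (direction d) = w * cj b (direction (gdir g1) * cnj (direction (gdir g1)))"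
      using inj(3) by (simp add: direction_simps mult.assoc[symmetric])
    then show ?thesis by (simp add: un del: cj_simps(5))
  next
    case False
    then have "c = (\<not> b)" "d = dadd (gdir g0) (gdir g1)" using inj(4) assms(4) by auto
    then have "u * cj b (direction d) = w * cj c (direction (gdir g1)) * cj b (direction (gdir g1))"
      using inj(3) by (simp add: direction_simps mult.assoc[symmetric])
    also have "\<dots> = w" using \<open>c = (\<not> b)\<close> by (simp add: cj_def un mult.assoc)
    finally show ?thesis .
  qed
  then show ?thesis
    unfolding germ_tile_turn map_tile_map_tile motion_motion placed_def by (simp add: ec)
qed

lemma fits_someI: "h \<in> set hs \<Longrightarrow> fits h g \<Longrightarrow> fits_some hs g"
  by (induction hs) auto

lemma all_fitI: "(\<And>g. g \<in> set gs \<Longrightarrow> \<exists>h\<in>set hs. fits h g) \<Longrightarrow> all_fit hs gs"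
  by (induction gs) (auto intro: fits_someI)

lemma compatible_iff: "compatible x y \<longleftrightarrow> (\<forall>a b. x = Some a \<longrightarrow> y = Some b \<longrightarrow> a = b)"
  by (cases x; cases y; simp)

lemma fits_iff: "fits h g \<longleftrightarrow> gkind h = gkind g \<and> gslot h = gslot g \<and> gdir h = gdir g \<and> gchir h = gchir g \<and>
  (\<forall>s. compatible (dec_at (gdecs h) s) (dec_at (gdecs g) s))"
proof -
  obtain k s d c hy l a where h: "h = Germ k s d c (Decs hy l a)" by (metis germ.exhaust decs.exhaust)
  obtain k' s' d' c' hy' l' a' where g: "g = Germ k' s' d' c' (Decs hy' l' a')" by (metis germ.exhaust decs.exhaust)
  show ?thesis unfolding h g all_sides by simp
qed

lemma fits_weaker: "weaker h h' \<Longrightarrow> fits h' g \<Longrightarrow> fits h g"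
  unfolding fits_iff weaker_def by (metis compatible.simps(2))

lemma fits_some_weaker: "list_all2 weaker hs hs' \<Longrightarrow> fits_some hs' g \<Longrightarrow> fits_some hs g"
  by (induction rule: list_all2_induct) (auto dest: fits_weaker split: if_splits)

lemma all_fit_weaker: "list_all2 weaker hs hs' \<Longrightarrow> all_fit hs' N \<Longrightarrow> all_fit hs N"
  by (induction N) (auto dest: fits_some_weaker split: if_splits)

locale legal_tiling =
  fixes T :: "colored_tile set"
  assumes L_tiling: "L_tiling T"
begin

lemma tiling: "colored_tiling T" and covers: "support T = UNIV" and matching: "sides_match T"
  and legal_at_vertices: "x \<in> T \<Longrightarrow> A \<in> vertices (fst x) \<Longrightarrow> legal_star (star_within T A)"
  using L_tiling by (auto simp: L_tiling_def)

lemma star_exists: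
  assumes "(t, d) \<in> T" "s \<in> {SR, SP, SQ}"
  obtains w c n ax where "star_is T (spot t s) w c n ax"
proof -
  have "spot t s \<in> vertices t" using assms(2) by (auto simp: vertices_def)
  then show thesis using legal_at_vertices[OF assms(1)] legal_starE that by (metis fst_conv)
qed

text \<open>The star at the point is legal, and one of its entries is the tile with germ \<open>g0\<close>; this fixes the
placement. The star contains every tile of the tiling through its center, in particular the known ones,
and a tile has only one germ at a given point. Hence all of \<open>N\<close> fits, and the star is listed.\<close>

lemma candidate_exists:
  assumes u: "norm u = 1" and s: "gslot g0 \<in> {SR, SP, SQ}"
    and g0: "present T (motion B u b) A g0" and N: "\<And>g. g \<in> set N \<Longrightarrow> present T (motion B u b) A g"
  obtains n t ax w c ax' where "(n, t, ax) \<in> set (candidates N g0)" "star_is T (motion B u b A) w c n ax'"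
    "\<And>g. g \<in> set (candidate_germs (n, t, ax)) \<Longrightarrow> present T (motion B u b) A g"
proof -
  let ?f = "motion B u b"
  obtain d0 where d0: "(map_tile ?f (germ_tile A g0), d0) \<in> T" using g0 by (auto simp: present_def)
  have sp: "spot (map_tile ?f (germ_tile A g)) (gslot g) = ?f A" for g
    by (simp add: spot_motion spot_germ_tile)
  obtain w c n ax where star: "star_is T (?f A) w c n ax"
    using star_exists[OF d0 s] unfolding sp by blast
  have w: "norm w = 1" and n: "n \<in> {1..7}" and ax: "ax \<in> set (axes n)"
    using star by (auto simp: star_is_def)
  have in_region: "?f A \<in> region (map_tile ?f (germ_tile A g))" for g
    using spot_in_region sp by metis
  obtain g1 where g1: "g1 \<in> set (star_code n (Some ax))"
    and t1: "map_tile ?f (germ_tile A g0) = placed (?f A) w c g1"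
    using star_is_tile[OF star d0 in_region] by metis
  obtain d e where rel: "rel_turn g0 g1 = (d, e)" by (cases "rel_turn g0 g1")
  note turn = turn_to_star[OF u w t1 rel]
  have fit: "all_fit (candidate_germs (n, (d, e), Some ax)) N"
  proof (rule all_fitI)
    fix g assume "g \<in> set N"
    then obtain dd where dd: "(map_tile ?f (germ_tile A g), dd) \<in> T" "agrees (gdecs g) (map_tile ?f (germ_tile A g)) dd"
      using N by (auto simp: present_def)
    obtain h where h: "h \<in> set (star_code n (Some ax))" "map_tile ?f (germ_tile A g) = placed (?f A) w c h"
      "\<And>s x. dec_at (gdecs h) s = Some x \<Longrightarrow> dd s = decoration_of (map_tile ?f (germ_tile A g)) s x"
      using star_is_tile[OF star dd(1) in_region] by metis
    have "fits (turn d e h) g"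
      unfolding fits_iff
    proof (intro conjI allI)
      have eq: "map_tile ?f (germ_tile A (turn d e h)) = map_tile ?f (germ_tile A g)" using h(2) turn by simp
      note inj = map_germ_tile_inj[OF u u eq refl]
      have "u \<noteq> 0" using u by auto
      show "gkind (turn d e h) = gkind g" "gslot (turn d e h) = gslot g" by (rule inj(1) inj(2))+
      show "gdir (turn d e h) = gdir g"
        using inj(3) \<open>u \<noteq> 0\<close> by (simp only: mult_cancel_left cj_simps direction_inj) simp
      show "gchir (turn d e h) = gchir g" using inj(4) by metis
      show "compatible (dec_at (gdecs (turn d e h)) s) (dec_at (gdecs g) s)" for s
        using h(3)[of s] dd(2) decoration_of_inj[OF is_tile_map_germ_tile[OF u]]
        unfolding agrees_def turn_simps compatible_iff by metis
    qed
    then show "\<exists>h\<in>set (candidate_germs (n, (d, e), Some ax)). fits h g"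
      using h(1) unfolding candidate_germs_simp set_map by blast
  qed
  have strong: "present T ?f A g" if gc: "g \<in> set (candidate_germs (n, (d, e), Some ax))" for g
  proof -
    obtain h where h: "h \<in> set (star_code n (Some ax))" "g = turn d e h"
      using gc unfolding candidate_germs_simp set_map by blast
    from star_is_germ[OF star h(1)] obtain dd where
      "(placed (?f A) w c h, dd) \<in> T" "\<And>s x. dec_at (gdecs h) s = Some x \<Longrightarrow> dd s = decoration_of (placed (?f A) w c h) s x"
      by metis
    then show ?thesis unfolding present_def agrees_def h(2) turn by auto
  qed
  have wk: "\<exists>h\<in>set (candidate_germs (n, (d, e), Some ax)). weaker g h"
    if gc: "g \<in> set (candidate_germs (n, (d, e), None))" for g
  proof -
    obtain h where h: "h \<in> set (star_code n None)" "g = turn d e h"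
      using gc unfolding candidate_germs_simp set_map by blast
    obtain h' where "h' \<in> set (star_code n (Some ax))" "weaker h h'"
      using weaker_star_code[of n ax] h(1) by (metis list_all2_conv_all_nth in_set_conv_nth)
    then show ?thesis unfolding candidate_germs_simp set_map h(2) using weaker_turn by blast
  qed
  have fit_None: "all_fit (candidate_germs (n, (d, e), None)) N"
    unfolding candidate_germs_simp using all_fit_weaker[OF _ fit[unfolded candidate_germs_simp]]
      weaker_star_code[of n ax] weaker_turn by (simp add: list_all2_map1 list_all2_map2 list.rel_mono_strong)
  obtain i where i: "i < length (star_code n (Some ax))" "g1 = star_code n (Some ax) ! i"
    using g1 by (auto simp: in_set_conv_nth)
  define g2 where "g2 = star_code n None ! i"
  have g2: "weaker g2 g1" "g2 \<in> set (star_code n None)"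
    using weaker_star_code[of n ax] i by (auto simp: list_all2_conv_all_nth g2_def)
  have "gkind g2 = gkind g0" "gslot g2 = gslot g0" "rel_turn g0 g2 = (d, e)"
    using g2(1) rel map_germ_tile_inj(1,2)[OF u w t1[unfolded placed_def]] by (auto simp: weaker_def)
  then have g2': "g2 \<in> set (filter (\<lambda>g. if gkind g = gkind g0 then gslot g = gslot g0 else False) (star_code n None))"
    "rel_turn g0 g2 = (d, e)"
    using g2(2) by simp_all
  have "n \<in> set [1, 2, 3, 4, 5, 6, 7]" using n by auto
  then have sub: "x \<in> set (candidates N g0)" if x: "x \<in> set (axis_choices N n (d, e))" for x
    unfolding candidates_def candidates_of_def set_concat set_map
    by (rule UN_I[OF imageI], unfold set_concat set_map)
       (rule UN_I[OF imageI[OF g2'(1)[unfolded set_map]]], use x g2'(2) in simp)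
  show thesis
  proof (cases "(n, (d, e), None) \<in> set (axis_choices N n (d, e))")
    case True
    show thesis by (rule that[OF sub[OF True] star]) (use wk strong present_weaker in blast)
  next
    case False
    then have "(n, (d, e), Some ax) \<in> set (axis_choices N n (d, e))"
      using fit fit_None ax by (auto simp: axis_choices_def Let_def split: if_splits)
    then show thesis by (rule that[OF sub star strong])
  qed
qed

definition realized :: "(complex \<Rightarrow> complex) \<Rightarrow> ptile \<Rightarrow> bool" where
  "realized f p = (case p of PTile k d c ds sp \<Rightarrow>
     (\<forall>s. \<exists>q. (s, q) \<in> set sp) \<and>
     (\<forall>(s, q)\<in>set sp. present T f (val q) (Germ k s d c ds)))"

lemma realized_germs_of_tile:
  assumes "realized f p" "g \<in> set (germs_of_tile A p)"
  shows "present T f (val A) g"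
  using assms by (cases p) (auto simp: realized_def)

lemma realized_ptile_germ:
  assumes "realized f p" "ptile_germ s p = (A, g)"
  shows "present T f (val A) g" "gslot g = s"
proof -
  obtain k d c ds sp where p: "p = PTile k d c ds sp" by (cases p)
  have "(s, slot_point s sp) \<in> set sp" if "(s, q) \<in> set sp" for q
    using that by (induction s sp rule: slot_point.induct) auto
  then have "(s, slot_point s sp) \<in> set sp" using assms(1) by (auto simp: p realized_def)
  then show "present T f (val A) g" "gslot g = s"
    using assms by (auto simp: p realized_def)
qed

lemma spot_points:
  assumes "(s', q) \<in> set (spot_points A g)"
  shows "val q = spot (germ_tile (val A) g) s'"
proof -
  obtain k s d c ds where g: "g = Germ k s d c ds" by (cases g)
  have scale: "val (case k of Large \<Rightarrow> pdirection d | Small \<Rightarrow> ptimes_phi (pdirection d)) = of_real (hyp_length k) * direction d"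
    by (cases k) (simp_all add: hyp_length_simps)
  have turn: "val (if c then ptimes_i p else pneg (ptimes_i p)) = cj c \<i> * val p" for p
    by (simp add: cj_def)
  have "spot (germ_tile (val A) g) s' = val A + direction d * cj c (spot_offset k s' - spot_offset k s)"
    by (simp add: g germ_tile_def Let_def spot_motion motion_def algebra_simps flip: spot_offset_def)
  moreover have "val q = val A + direction d * cj c (spot_offset k s' - spot_offset k s)"
  proof -
    define z where "z = (case k of Large \<Rightarrow> pdirection d | Small \<Rightarrow> ptimes_phi (pdirection d))"
    define t where "t = (\<lambda>p. if c then ptimes_i p else pneg (ptimes_i p))"
    define off where "off = (\<lambda>s. case s of SR \<Rightarrow> pzero | SP \<Rightarrow> t (ptimes_phi (ptimes_phi z)) | SQ \<Rightarrow> ptimes_phi z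
      | SF \<Rightarrow> padd (ptimes_phi (ptimes_phi (ptimes_phi (ptimes_phi (ptimes_phi z))))) (t (ptimes_phi (ptimes_phi (ptimes_phi (ptimes_phi z)))))
      | SM \<Rightarrow> ptimes_phi (ptimes_phi (ptimes_phi (ptimes_phi (ptimes_phi z)))))"
    have vz: "val z = of_real (hyp_length k) * direction d" and vt: "val (t p) = cj c \<i> * val p" for p
      using scale turn by (simp_all add: z_def t_def)
    have v: "val (off s) = direction d * cj c (spot_offset k s)" for s
      by (cases s) (simp_all add: off_def vz vt spot_offset_simps eval_nat_numeral distrib_left mult_ac)
    have "q = (if s' = SR then padd A (pneg (off s)) else padd (padd A (pneg (off s))) (off s'))"
      using assms unfolding g spot_points.simps Let_def z_def[symmetric] t_def[symmetric]
      by (cases s) (auto simp: off_def t_def)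
    then have "val q = val A - val (off s) + val (off s')" by (simp add: off_def)
    then show ?thesis by (simp add: v right_diff_distrib)
  qed
  ultimately show ?thesis by simp
qed

lemma realized_ptile_of:
  assumes "present T f (val A) g"
  shows "realized f (ptile_of A g)"
proof -
  obtain k s d c ds where g: "g = Germ k s d c ds" by (cases g)
  have "\<exists>q. (s', q) \<in> set (spot_points A g)" for s' by (cases s') (auto simp: g Let_def)
  moreover have "present T f (val q) (Germ k s' d c ds)" if "(s', q) \<in> set (spot_points A g)" for s' q
  proof -
    have "val q - direction d * cj c (spot_offset k s') = val A - direction d * cj c (spot_offset k s)"
      unfolding spot_points[OF that]
      by (simp add: g germ_tile_def Let_def spot_motion motion_def flip: spot_offset_def)
    then have "germ_tile (val q) (Germ k s' d c ds) = germ_tile (val A) g"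
      unfolding g germ_tile_def Let_def germ.sel by simp
    then show ?thesis using assms by (simp add: present_def g)
  qed
  ultimately show ?thesis by (auto simp: realized_def g simp del: spot_points.simps)
qed

text \<open>By \<open>candidate_exists\<close> one of the candidates at each node is actually present, so following the present
candidates leads to a leaf; but there no candidate is left.\<close>

lemma check_sound:
  assumes f: "f = motion B u b" "norm u = 1"
  shows "check P C \<Longrightarrow> (\<And>p. p \<in> set P \<Longrightarrow> realized f p) \<Longrightarrow> False"
    and "check_all P A xs cs \<Longrightarrow> (\<And>p. p \<in> set P \<Longrightarrow> realized f p) \<Longrightarrow> x \<in> set xs \<Longrightarrow>
      (\<And>g. g \<in> set (candidate_germs x) \<Longrightarrow> present T f (val A) g) \<Longrightarrow> False"
proof (induction P C and P A xs cs arbitrary: and x rule: check_check_all.induct)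
  case (1 P i s cs)
  obtain A g where Ag: "ptile_germ s (P ! i) = (A, g)" by (cases "ptile_germ s (P ! i)")
  have i: "i < length P" and s: "s \<in> {SR, SP, SQ}" and ca: "check_all P A (candidates (germs_at A P) g) cs"
    using "1.prems"(1) Ag by (cases s; auto split: if_splits)+
  note r = realized_ptile_germ[OF "1.prems"(2)[OF nth_mem[OF i]] Ag]
  have "present T f (val A) h" if "h \<in> set (germs_at A P)" for h
    using that "1.prems"(2) by (auto simp: germs_at_def intro: realized_germs_of_tile)
  from candidate_exists[OF f(2) s[folded r(2)] r(1)[unfolded f(1)] this[unfolded f(1)]]
  obtain x where x: "x \<in> set (candidates (germs_at A P) g)"
    "\<And>h. h \<in> set (candidate_germs x) \<Longrightarrow> present T f (val A) h"
    unfolding f(1) by metis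
  have "s \<noteq> SF" "s \<noteq> SM" using s by auto
  then show ?case by (rule "1.IH"[OF i _ _ Ag[symmetric] ca "1.prems"(2) x])
next
  case (4 P A n d c ax xs C cs x)
  have C: "check (map (place A d c) (star_code n ax) @ P) C" and cs: "check_all P A xs cs"
    using "4.prems"(1) by (auto split: if_splits)
  show ?case
  proof (cases "x = (n, (d, c), ax)")
    case True
    have "realized f p" if "p \<in> set (map (place A d c) (star_code n ax) @ P)" for p
      using that "4.prems"(2,4) True realized_ptile_of
      by (auto simp: candidate_germs_simp place_def)
    then show ?thesis using "4.IH"(1) C by blast
  next
    case False
    then have "x \<in> set xs" using "4.prems"(3) by simp
    then show ?thesis using "4.IH"(2)[OF C cs "4.prems"(2) _ "4.prems"(4)] by simp
  qed
qed auto

lemma certified: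
  assumes star: "star_is T A w c n ax" and ax0: "ax0 = None \<or> ax0 = Some ax" and j: "j < length (star_code n (Some ax))"
    and cert: "certified n ax0 j paired cs"
  obtains w' c' m ax' where "star_is T (vright (placed A w c (star_code n (Some ax) ! j))) w' c' m ax'"
    "if paired then m \<notin> {2, 4} else m \<notin> {1, 3}"
proof -
  let ?f = "motion A w c"
  have w: "norm w = 1" using star by (simp add: star_is_def)
  define P where "P = map (place pzero (Q0, 0) True) (star_code n ax0)"
  have strong: "present T ?f 0 g" if gc: "g \<in> set (star_code n (Some ax))" for g
    using star_is_germ[OF star gc] unfolding present_def agrees_def placed_def by metis
  have wk: "list_all2 weaker (star_code n ax0) (star_code n (Some ax))"
    using ax0
  proof
    assume "ax0 = None" then show ?thesis using weaker_star_code by simp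
  next
    assume "ax0 = Some ax" then show ?thesis by (auto simp: weaker_def intro: list.rel_refl)
  qed
  then have pres: "present T ?f 0 g" if gc: "g \<in> set (star_code n ax0)" for g
    using gc strong present_weaker by (metis list_all2_conv_all_nth in_set_conv_nth)
  then have P: "realized ?f p" if "p \<in> set P" for p
    using that realized_ptile_of[of ?f pzero] by (auto simp: P_def place_def)
  have jP: "j < length P" "P ! j \<in> set P"
    using j list_all2_lengthD[OF wk] by (auto simp: P_def)
  obtain R g where Rg: "ptile_germ SR (P ! j) = (R, g)" by (cases "ptile_germ SR (P ! j)")
  note r = realized_ptile_germ[OF P[OF jP(2)] Rg]
  have "present T ?f (val R) h" if "h \<in> set (germs_at R P)" for h
    using that P by (auto simp: germs_at_def intro: realized_germs_of_tile)
  from candidate_exists[OF w _ r(1) this] r(2)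
  obtain m t ax1 w' c' ax' where cand: "(m, t, ax1) \<in> set (candidates (germs_at R P) g)"
    and star': "star_is T (?f (val R)) w' c' m ax'"
    and germs: "\<And>h. h \<in> set (candidate_germs (m, t, ax1)) \<Longrightarrow> present T ?f (val R) h"
    by (metis insertCI)
  have ca: "check_all P R (filter (\<lambda>(m, _). if paired then m = 2 \<or> m = 4 else m = 1 \<or> m = 3) (candidates (germs_at R P) g)) cs"
    using cert Rg by (simp add: P_def Let_def)
  have m: "if paired then m \<notin> {2, 4} else m \<notin> {1, 3}"
  proof (rule ccontr)
    assume "\<not> ?thesis"
    then have "(m, t, ax1) \<in> set (filter (\<lambda>(m, _). if paired then m = 2 \<or> m = 4 else m = 1 \<or> m = 3) (candidates (germs_at R P) g))"
      using cand by (auto split: if_splits)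
    from check_sound(2)[OF refl w ca P this germs] show False .
  qed
  have "P ! j = ptile_of pzero (star_code n ax0 ! j)"
    using j list_all2_lengthD[OF wk] by (simp add: P_def place_def)
  then have "(SR, R) \<in> set (spot_points pzero (star_code n ax0 ! j))"
    using Rg by (cases "star_code n ax0 ! j") (auto simp: Let_def)
  then have "val R = spot (germ_tile 0 (star_code n ax0 ! j)) SR" using spot_points by fastforce
  also have "germ_tile 0 (star_code n ax0 ! j) = germ_tile 0 (star_code n (Some ax) ! j)"
    using wk j by (auto simp: list_all2_conv_all_nth intro: germ_tile_weaker)
  finally have "?f (val R) = vright (placed A w c (star_code n (Some ax) ! j))"
    by (simp add: placed_def)
  with star' m show thesis using that by simp
qed

end

section \<open>Certificates for the pairing of large tiles\<close>

text \<open>Each certificate excludes the wrong alternative for the large tile with the given index in the given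
star. The axis decoration is left open (\<open>None\<close>) where the argument does not depend on it. In the
names of the other facts, \<open>R\<close> or \<open>L\<close> stands for the orientation of the axis to the right or left, and
the last digit for its label. A branch without successors is a vertex where no legal star fits.\<close>

lemma certified_trivial: "list_all (\<lambda>(n, j, b). certified n None j b [])
   [(2, 0, True), (3, 2, True), (4, 0, False), (4, 1, True),
    (4, 6, True), (5, 1, True), (5, 2, False), (5, 5, True), (6, 0, False), (6, 1, True), (6, 3, True), (6, 6, True), (6, 7, False),
    (7, 2, False), (7, 5, False), (7, 6, True)]"
  by code_simp

lemma certified_2_3: "certified 2 None 3 True [Branch 2 SP [], Branch 4 SP []]"
  by code_simp

lemma certified_3_1: "certified 3 None 1 False [Branch 5 SP [Branch 3 SR [Branch 4 SP [Branch 29 SQ [Branch 4 SP [Branch 2 SR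
    [Branch 37 SP []]]]]]]]"
  by code_simp

lemma certified_4_3_L0: "certified 4 (Some (False, Q0)) 3 False [Branch 5 SP [Branch 7 SR [Branch 24 SR [Branch 12 SR [Branch 2 SR
    [Branch 35 SR [Branch 2 SR [Branch 29 SP [Branch 0 SR [Branch 11 SR [Branch 32 SP [Branch 42 SR [Branch 47 SQ
    [Branch 58 SQ []]]]]], Branch 2 SR [Branch 9 SR [Branch 32 SP [Branch 42 SR [Branch 47 SQ [Branch 58 SQ
    []]]]]]]]]]]]]]]"
  by code_simp

lemma certified_4_3_L2: "certified 4 (Some (False, Q2)) 3 False [Branch 0 SR [Branch 12 SR [Branch 2 SR [Branch 21 SP [Branch 0 SR
    [Branch 39 SR [Branch 9 SP []]], Branch 34 SR [Branch 3 SR [Branch 13 SP [Branch 2 SR [Branch 14 SP [Branch 21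
    SQ [Branch 4 SR [Branch 1 SQ [Branch 1 SR [Branch 34 SR [Branch 36 SQ [Branch 1 SR [Branch 45 SP []]], Branch
    8 SQ []]]]]], Branch 21 SQ [Branch 11 SR [Branch 9 SR [Branch 26 SQ [Branch 0 SR [Branch 37 SP []], Branch 4
    SP []]]]]]]]]]]]]]]"
  by code_simp

lemma certified_4_3_R0: "certified 4 (Some (True, Q0)) 3 False [Branch 5 SP [Branch 7 SR [Branch 24 SR [Branch 12 SR [Branch 2 SR
    [Branch 35 SR [Branch 2 SR [Branch 29 SP [Branch 0 SR [Branch 11 SR [Branch 32 SP [Branch 42 SR [Branch 47 SQ
    [Branch 58 SQ []]]]]], Branch 2 SR [Branch 9 SR [Branch 32 SP [Branch 42 SR [Branch 47 SQ [Branch 58 SQ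
    []]]]]]]]]]]]]]]"
  by code_simp

lemma certified_4_3_R2: "certified 4 (Some (True, Q2)) 3 False [Branch 7 SR [Branch 9 SR [Branch 15 SP [Branch 28 SR [Branch 15 SR
    [Branch 9 SR [Branch 2 SR [Branch 37 SP [Branch 44 SQ [Branch 4 SR [Branch 1 SQ [Branch 0 SR [Branch 56 SQ
    [Branch 6 SQ [], Branch 1 SR [Branch 65 SP []]]]]]], Branch 44 SQ [Branch 11 SR [Branch 9 SR [Branch 49 SQ
    [Branch 0 SR [Branch 60 SP []], Branch 4 SP []]]]]]]]]]]]]]"
  by code_simp

lemma certified_5_3: "certified 5 None 3 True [Branch 4 SQ [Branch 18 SR []], Branch 13 SR []]"
  by code_simp

lemma certified_5_6: "certified 5 None 6 False [Branch 8 SR [Branch 10 SQ [Branch 1 SR [Branch 2 SQ []]]]]"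
  by code_simp

lemma certified_7_1_L1: "certified 7 (Some (False, Q1)) 1 True [Branch 3 SP [Branch 12 SR [Branch 2 SQ []]], Branch 4 SP [Branch 1 SR
    []]]"
  by code_simp

lemma certified_7_1_L3: "certified 7 (Some (False, Q3)) 1 True [Branch 7 SR [Branch 0 SR [Branch 3 SP [Branch 5 SR [Branch 3 SR [Branch
    33 SR [Branch 13 SR [Branch 15 SR [Branch 40 SP [Branch 6 SR [Branch 58 SR [Branch 14 SR [Branch 3 SP [Branch
    16 SR [Branch 9 SQ [Branch 1 SR [Branch 9 SR [Branch 35 SP [Branch 80 SP [], Branch 81 SP
    []]]]]]]]]]]]]]]]]]], Branch 4 SP [Branch 1 SR []]]"
  by code_simp

lemma certified_7_1_R1: "certified 7 (Some (True, Q1)) 1 True [Branch 3 SP [Branch 12 SR [Branch 2 SQ []]], Branch 4 SP [Branch 1 SR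
    []]]"
  by code_simp

lemma certified_7_1_R3: "certified 7 (Some (True, Q3)) 1 True [Branch 3 SP [Branch 12 SR [Branch 2 SQ []]], Branch 4 SP [Branch 1 SR
    []]]"
  by code_simp

lemma certified_7_3: "certified 7 None 3 True [Branch 6 SR [Branch 3 SP []], Branch 4 SP []]"
  by code_simp

lemma certified_7_4: "certified 7 None 4 True [Branch 4 SQ [], Branch 7 SQ []]"
  by code_simp

section \<open>Large tiles and their mates\<close>

text \<open>The tile that forms a decomposed large tile together with \<open>t\<close>, across the small leg of \<open>t\<close>.\<close>

definition mate :: "tile \<Rightarrow> tile" where
  "mate t = Tile Small (vright t) (vright t - phi\<^sup>2 *\<^sub>R (vsmaller t - vright t)) (vlarger t)"

lemma mate_simps [simp]: "kind (mate t) = Small" "vright (mate t) = vright t"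
  "vlarger (mate t) = vright t - phi\<^sup>2 *\<^sub>R (vsmaller t - vright t)" "vsmaller (mate t) = vlarger t"
  by (simp_all add: mate_def)

lemma mate_motion: "mate (map_tile (motion A w c) t) = map_tile (motion A w c) (mate t)"
  by (simp add: mate_def map_tile_def motion_def scaleR_conv_of_real algebra_simps)

text \<open>Of the special points of a large tile, the ends of its small leg are special points of its mate, too.\<close>

fun mate_germ :: "germ \<Rightarrow> germ" where
  "mate_germ (Germ k s d c ds) =
    Germ Small (if s = SP then SQ else s) (dadd (if c then Q1 else Q3, 0) d) c ds"

lemma mate_placed:
  assumes "gkind g = Large" "gslot g \<in> {SR, SP}"
  shows "mate (placed A w c g) = placed A w c (mate_germ g)"
proof -
  obtain k s d c' ds where g: "g = Germ k s d c' ds" by (cases g)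
  have dir: "direction (dadd (if c' then Q1 else Q3, 0) d) = cj c' \<i> * direction d"
    by (simp add: direction_simps cj_def)
  have "mate (germ_tile 0 g) = germ_tile 0 (mate_germ g)"
    unfolding g mate_germ.simps germ_tile_def germ.sel Let_def dir
    using assms
    by (auto simp: g mate_def map_tile_def motion_def spot_offset_simps hyp_length_simps scaleR_conv_of_real
        cj_def power2_eq_square algebra_simps)
  then show ?thesis by (simp add: placed_def mate_motion)
qed

lemma placed_cong:
  "gkind g = gkind h \<Longrightarrow> gslot g = gslot h \<Longrightarrow> gdir g = gdir h \<Longrightarrow> gchir g = gchir h \<Longrightarrow> placed A w c g = placed A w c h"
  by (simp add: placed_def germ_tile_def)

fun same_place :: "germ \<Rightarrow> germ \<Rightarrow> bool" where
  "same_place (Germ k s d c ds) (Germ k' s' d' c' ds') \<longleftrightarrow> s = s' \<and> k = k' \<and> c = c' \<and> d = d'"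

lemma same_place: "same_place g h \<longleftrightarrow> gkind g = gkind h \<and> gslot g = gslot h \<and> gdir g = gdir h \<and> gchir g = gchir h"
  by (cases g; cases h) auto

definition matched_decs :: "decs \<Rightarrow> decs \<Rightarrow> bool" where
  "matched_decs l s \<longleftrightarrow> dec_short l = Some (True, Q0) \<and> dec_long s = Some (True, Q0) \<and>
     dec_short s = map_option (map_prod Not id) (dec_long l) \<and> dec_long l \<noteq> None"

text \<open>This is read off the legal stars: large and small tiles with right angle at the center are neighbours
in \<open>C\<^sub>1\<close> and \<open>C\<^sub>3\<close>, their common leg has label \<open>3 + 1\<close> or \<open>1 + 3\<close>, that is 0, and their other legs lie on
the axis and are decorated alike. In \<open>C\<^sub>2\<close> and \<open>C\<^sub>4\<close> there is only a large right angle, and in the other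
stars there is none.\<close>

definition right_angles_matched :: "nat \<Rightarrow> bool \<times> z4 \<Rightarrow> bool" where
  "right_angles_matched n ax \<longleftrightarrow> (let G = filter (\<lambda>g. gslot g = SR) (star_code n (Some ax)) in
     if n \<in> {1, 3} then
       list_all (\<lambda>g. gkind g = Large \<longrightarrow> list_ex (\<lambda>h. same_place (mate_germ g) h) G) G \<and>
       list_all (\<lambda>g. gkind g = Large \<longrightarrow> list_all (\<lambda>h. same_place (mate_germ g) h \<longrightarrow> matched_decs (gdecs g) (gdecs h)) G) G \<and>
       list_all (\<lambda>h. gkind h = Small \<longrightarrow> list_ex (\<lambda>g. gkind g = Large \<and> same_place (mate_germ g) h) G) G
     else list_all (\<lambda>g. gkind g = Large \<and> n \<in> {2, 4}) G)"

lemma right_angles_matched: "n \<in> {1..7} \<Longrightarrow> ax \<in> set (axes n) \<Longrightarrow> right_angles_matched n ax"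
proof -
  have "list_all (\<lambda>n. list_all (right_angles_matched n) (axes n)) [1, 2, 3, 4, 5, 6, 7]"
    by code_simp
  moreover assume "n \<in> {1..7}" "ax \<in> set (axes n)"
  moreover from \<open>n \<in> {1..7}\<close> have "n \<in> set [1, 2, 3, 4, 5, 6, 7]" by auto
  ultimately show ?thesis unfolding list_all_iff by blast
qed

context legal_tiling
begin

lemma colored: "(t, d) \<in> T \<Longrightarrow> is_colored_tile (t, d)"
  using tiling by (auto simp: colored_tiling_def)

lemma tiles: "(t, d) \<in> T \<Longrightarrow> is_tile t"
  using colored by (auto simp: is_colored_tile_def)

definition paired :: "tile \<Rightarrow> bool" where
  "paired t \<longleftrightarrow> (\<exists>d. (mate t, d) \<in> T)"

lemma vright_in_region: "vright t \<in> region t"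
  using spot_in_region[of t SR] by simp

lemma right_angle_germ:
  assumes "star_is T (vright t) w c m ax" "(t, d) \<in> T"
  obtains g where "g \<in> set (star_code m (Some ax))" "t = placed (vright t) w c g" "gslot g = SR" "gkind g = kind t"
    "\<And>s x. dec_at (gdecs g) s = Some x \<Longrightarrow> d s = decoration_of t s x"
proof -
  from star_is_tile[OF assms vright_in_region] obtain g where g: "g \<in> set (star_code m (Some ax))" "t = placed (vright t) w c g"
    "\<And>s x. dec_at (gdecs g) s = Some x \<Longrightarrow> d s = decoration_of t s x" by metis
  have "spot t (gslot g) = spot t SR" using g(2) spot_placed by (metis spot.simps(1))
  then have "gslot g = SR" using spot_inj[OF tiles[OF assms(2)]] by blast
  moreover have "gkind g = kind t" using g(2) by (metis kind_placed)
  ultimately show thesis using g that by blast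
qed

lemma star_is_range: "star_is T A w c n ax \<Longrightarrow> n \<in> {1..7} \<and> ax \<in> set (axes n) \<and> norm w = 1"
  by (simp add: star_is_def)

text \<open>The mate has its right angle where \<open>t\<close> has it, so the star at this point decides.\<close>

lemma paired_iff:
  assumes star: "star_is T (vright t) w c m ax" and t: "(t, d) \<in> T" "kind t = Large"
  shows "m \<in> {1, 2, 3, 4}" "paired t \<longleftrightarrow> m \<in> {1, 3}"
proof -
  obtain g where g: "g \<in> set (star_code m (Some ax))" "t = placed (vright t) w c g" "gslot g = SR" "gkind g = Large"
    using right_angle_germ[OF star t(1)] t(2) by metis
  have mt: "mate t = placed (vright t) w c (mate_germ g)"
    by (subst (1) g(2), rule mate_placed) (simp_all add: g)
  have ram: "right_angles_matched m ax" using star_is_range[OF star] right_angles_matched by blast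
  show "m \<in> {1, 2, 3, 4}"
    using ram g by (auto simp: right_angles_matched_def Let_def list_all_iff split: if_splits)
  show "paired t \<longleftrightarrow> m \<in> {1, 3}"
  proof
    assume "paired t"
    then obtain d' where d': "(mate t, d') \<in> T" by (auto simp: paired_def)
    obtain h where "h \<in> set (star_code m (Some ax))" "gslot h = SR" "gkind h = Small"
      using right_angle_germ[of "mate t", simplified, OF star d'] by metis
    then show "m \<in> {1, 3}"
      using ram by (auto simp: right_angles_matched_def Let_def list_all_iff split: if_splits)
  next
    assume "m \<in> {1, 3}"
    then have "\<exists>h\<in>set (star_code m (Some ax)). same_place (mate_germ g) h"
      using ram g(1,3,4) unfolding right_angles_matched_def Let_def list_all_iff list_ex_iff by auto
    then obtain h where h: "h \<in> set (star_code m (Some ax))" "same_place (mate_germ g) h" by blast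
    then have "mate t = placed (vright t) w c h" using mt placed_cong[of "mate_germ g" h] unfolding same_place by auto
    then show "paired t" using star_is_germ[OF star h(1)] unfolding paired_def by metis
  qed
qed

lemma side_dir_mate: "side_dir (mate t) Long = side_dir t Short" "side_dir (mate t) Short = - side_dir t Long"
proof -
  show "side_dir (mate t) Long = side_dir t Short" by (simp add: side_dir_def)
  have "side_dir (mate t) Short = sgn (- (phi\<^sup>2 *\<^sub>R (vsmaller t - vright t)))"
    by (simp add: side_dir_def)
  also have "\<dots> = - sgn (phi\<^sup>2 *\<^sub>R (vsmaller t - vright t))" by (rule sgn_minus)
  also have "\<dots> = - sgn (vsmaller t - vright t)" using phi_pos by (simp add: sgn_scaleR)
  finally show "side_dir (mate t) Short = - side_dir t Long" by (simp add: side_dir_def)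
qed

text \<open>What the inverse of a cut requires: the common leg is decorated like an altitude, and the two parts of
the hypotenuse are decorated alike.\<close>

lemma mate_decorations:
  assumes t: "(t, d) \<in> T" "kind t = Large" and s: "(mate t, d') \<in> T"
  shows "d Short = (side_dir t Short, 0)" "d' Long = (side_dir t Short, 0)" "d' Short = d Long"
proof -
  obtain w c m ax where star: "star_is T (vright t) w c m ax"
    using star_exists[OF t(1), of SR] by (metis insertI1 spot.simps(1))
  have star': "star_is T (vright (mate t)) w c m ax" using star by simp
  obtain g where g: "g \<in> set (star_code m (Some ax))" "t = placed (vright t) w c g" "gslot g = SR" "gkind g = Large"
    "\<And>s x. dec_at (gdecs g) s = Some x \<Longrightarrow> d s = decoration_of t s x"
    using right_angle_germ[OF star t(1)] t(2) by metis
  obtain h where h: "h \<in> set (star_code m (Some ax))" "mate t = placed (vright t) w c h" "gslot h = SR" "gkind h = Small"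
    "\<And>s x. dec_at (gdecs h) s = Some x \<Longrightarrow> d' s = decoration_of (mate t) s x"
    using right_angle_germ[OF star' s] by (metis mate_simps(1,2))
  have mt: "mate t = placed (vright t) w c (mate_germ g)"
    by (subst (1) g(2), rule mate_placed) (simp_all add: g)
  have w: "norm w = 1" "w \<noteq> 0" using star_is_range[OF star] by auto
  note inj = map_germ_tile_inj[OF w(1) w(1) h(2)[unfolded mt, unfolded placed_def] refl]
  have "same_place (mate_germ g) h"
    unfolding same_place using inj w(2) direction_inj by (auto simp: eq_commute[of "c"])
  moreover have "m \<in> {1, 3}" using paired_iff(2)[OF star t] s by (auto simp: paired_def)
  ultimately have "matched_decs (gdecs g) (gdecs h)"
    using right_angles_matched[of m ax] star_is_range[OF star] g h
    unfolding right_angles_matched_def Let_def list_all_iff by auto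
  then obtain b l where decs: "dec_short (gdecs g) = Some (True, Q0)" "dec_long (gdecs h) = Some (True, Q0)"
    "dec_long (gdecs g) = Some (b, l)" "dec_short (gdecs h) = Some (\<not> b, l)"
    by (auto simp: matched_decs_def)
  show "d Short = (side_dir t Short, 0)" using g(5)[of Short] decs by simp
  show "d' Long = (side_dir t Short, 0)" using h(5)[of Long] decs by (simp add: side_dir_mate)
  show "d' Short = d Long" using h(5)[of Short] g(5)[of Long] decs by (simp add: side_dir_mate)
qed

lemma small_tile_is_mate:
  assumes s: "(s, d') \<in> T" "kind s = Small"
  obtains t d where "(t, d) \<in> T" "kind t = Large" "s = mate t"
proof -
  obtain w c m ax where star: "star_is T (vright s) w c m ax"
    using star_exists[OF s(1), of SR] by (metis insertI1 spot.simps(1))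
  obtain h where h: "h \<in> set (star_code m (Some ax))" "s = placed (vright s) w c h" "gslot h = SR" "gkind h = Small"
    using right_angle_germ[OF star s(1)] s(2) by metis
  have "\<exists>g\<in>set (star_code m (Some ax)). gslot g = SR \<and> gkind g = Large \<and> same_place (mate_germ g) h"
    using right_angles_matched[of m ax] star_is_range[OF star] h
    unfolding right_angles_matched_def Let_def list_all_iff list_ex_iff by (auto split: if_splits)
  then obtain g where g: "g \<in> set (star_code m (Some ax))" "gslot g = SR" "gkind g = Large" "same_place (mate_germ g) h"
    by blast
  have "mate (placed (vright s) w c g) = placed (vright s) w c (mate_germ g)"
    by (rule mate_placed) (simp_all add: g)
  also have "\<dots> = s" using placed_cong[of "mate_germ g" h] g(4) h(2) unfolding same_place by metis
  finally have "mate (placed (vright s) w c g) = s" .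
  moreover obtain d where "(placed (vright s) w c g, d) \<in> T" using star_is_germ[OF star g(1)] by metis
  ultimately show thesis using that g(3) by (metis kind_placed)
qed

end

text \<open>The pairing of the large tiles of \<open>C\<^sub>n\<close>, by their indices in \<open>star_code\<close>. Two large tiles are missing: the
tile with index 4 of \<open>C\<^sub>6\<close>, which may or may not be paired, and the lower tile of \<open>C\<^sub>1\<close>, where the center
becomes no vertex in either case.\<close>

definition forced_pairing :: "nat \<Rightarrow> (nat \<times> bool) list" where
  "forced_pairing n =
     (if n = 1 then [(0, True)]
      else if n = 2 then [(0, True), (2, False), (3, True)]
      else if n = 3 then [(1, False), (2, True), (5, True)]
      else if n = 4 then [(0, False), (1, True), (3, False), (4, False), (6, True)]
      else if n = 5 then [(1, True), (2, False), (3, True), (5, True), (6, False)]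
      else if n = 6 then [(0, False), (1, True), (3, True), (6, True), (7, False)]
      else [(1, True), (2, False), (3, True), (4, True), (5, False), (6, True)])"

lemma forced_pairing_germs:
  assumes "n \<in> {1..7}" "ax \<in> set (axes n)" "(j, b) \<in> set (forced_pairing n)"
  shows "j < length (star_code n (Some ax)) \<and> gkind (star_code n (Some ax) ! j) = Large \<and>
    (if gslot (star_code n (Some ax) ! j) = SR then b = (n = 1 \<or> n = 3)
     else (n, j) \<notin> {(1, 0), (2, 2), (3, 5), (4, 4)})"
proof -
  have "list_all (\<lambda>n. list_all (\<lambda>ax. list_all (\<lambda>(j, b). j < length (star_code n (Some ax)) \<and>
      gkind (star_code n (Some ax) ! j) = Large \<and>
      (if gslot (star_code n (Some ax) ! j) = SR then b = (n = 1 \<or> n = 3)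
       else (n, j) \<notin> {(1, 0), (2, 2), (3, 5), (4, 4)})) (forced_pairing n)) (axes n)) [1, 2, 3, 4, 5, 6, 7]"
    by code_simp
  moreover from assms(1) have "n \<in> set [1, 2, 3, 4, 5, 6, 7]" by auto
  ultimately show ?thesis using assms(2,3) unfolding list_all_iff by blast
qed

text \<open>The four excluded tiles have their right angle at the center, so their own star decides about them.\<close>

lemma certificate_exists:
  assumes "n \<in> {1..7}" "ax \<in> set (axes n)" "(j, b) \<in> set (forced_pairing n)" "(n, j) \<notin> {(1, 0), (2, 2), (3, 5), (4, 4)}"
  shows "\<exists>ax0 cs. (ax0 = None \<or> ax0 = Some ax) \<and> certified n ax0 j b cs"
proof -
  have "(n, j, b) \<in> set [(2, 0, True), (3, 2, True), (4, 0, False), (4, 1, True), (4, 6, True), (5, 1, True),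
      (5, 2, False), (5, 5, True), (6, 0, False), (6, 1, True), (6, 3, True), (6, 6, True), (6, 7, False),
      (7, 2, False), (7, 5, False), (7, 6, True)] \<or>
    (n, j, b) \<in> {(2, 3, True), (3, 1, False), (5, 3, True), (5, 6, False), (7, 3, True), (7, 4, True)} \<or>
    (n, j, b) = (4, 3, False) \<or> (n, j, b) = (7, 1, True)" (is "?A \<or> ?B \<or> ?C \<or> ?D")
  proof -
    have "n = 1 \<or> n = 2 \<or> n = 3 \<or> n = 4 \<or> n = 5 \<or> n = 6 \<or> n = 7" using assms(1) by auto
    then show ?thesis using assms(3,4) by (elim disjE) (auto simp: forced_pairing_def)
  qed
  then consider ?A | ?B | ?C | ?D by blast
  then show ?thesis
  proof cases
    case 1 then show ?thesis using certified_trivial unfolding list_all_iff by blast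
  next
    case 2 then show ?thesis
      using certified_2_3 certified_3_1 certified_5_3 certified_5_6 certified_7_3 certified_7_4 by blast
  next
    case 3
    then have "ax \<in> {(True, Q0), (True, Q2), (False, Q0), (False, Q2)}" using assms(2) by (simp add: axes_def)
    with 3 show ?thesis
      using certified_4_3_L0 certified_4_3_L2 certified_4_3_R0 certified_4_3_R2 by blast
  next
    case 4
    then have "ax \<in> {(True, Q1), (True, Q3), (False, Q1), (False, Q3)}" using assms(2) by (simp add: axes_def)
    with 4 show ?thesis
      using certified_7_1_L1 certified_7_1_L3 certified_7_1_R1 certified_7_1_R3 by blast
  qed
qed

lemma (in legal_tiling) forced_pairing:
  assumes star: "star_is T A w c n ax" and jb: "(j, b) \<in> set (forced_pairing n)"
  shows "paired (placed A w c (star_code n (Some ax) ! j)) \<longleftrightarrow> b"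
proof -
  let ?g = "star_code n (Some ax) ! j"
  let ?t = "placed A w c ?g"
  have n: "n \<in> {1..7}" "ax \<in> set (axes n)" using star_is_range[OF star] by auto
  note fp = forced_pairing_germs[OF n jb]
  have g: "?g \<in> set (star_code n (Some ax))" using fp by simp
  obtain d where t: "(?t, d) \<in> T" using star_is_germ[OF star g] by metis
  have k: "kind ?t = Large" using fp by simp
  show ?thesis
  proof (cases "gslot ?g = SR")
    case True
    then have "vright ?t = A" using spot_placed[of A w c ?g] by simp
    then have "star_is T (vright ?t) w c n ax" using star by simp
    from paired_iff(2)[OF this t k] show ?thesis using fp True by auto
  next
    case False
    have "(n, j) \<notin> {(1, 0), (2, 2), (3, 5), (4, 4)}" using fp False by simp
    then obtain ax0 cs where "ax0 = None \<or> ax0 = Some ax" "certified n ax0 j b cs"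
      using certificate_exists[OF n jb] by blast
    from certified[OF star this(1) _ this(2)] fp
    obtain w' c' m ax' where star': "star_is T (vright ?t) w' c' m ax'"
      and "if b then m \<notin> {2, 4} else m \<notin> {1, 3}" by metis
    then show ?thesis using paired_iff[OF star' t k] by (auto split: if_splits)
  qed
qed

section \<open>Merging a tile with its mate\<close>

lemma tile_not_collinear:
  assumes "is_tile t"
  shows "\<not> collinear {vright t, vlarger t, vsmaller t}"
proof
  assume col: "collinear {vright t, vlarger t, vsmaller t}"
  obtain A w c where w: "norm w = 1" and t: "t = map_tile (motion A w c) (proto_tile (kind t))"
    using assms unfolding is_tile_iff_motion by blast
  let ?k = "kind t"
  have v: "vright t = A" "vlarger t = A + w * cj c (\<i> * of_real (phi\<^sup>2 * hyp_length ?k))"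
    "vsmaller t = A + w * of_real (phi * hyp_length ?k)"
    by (subst t, simp add: motion_def)+
  have pos: "phi\<^sup>2 * hyp_length ?k \<noteq> 0" "phi * hyp_length ?k \<noteq> 0" using phi_pos hyp_length_pos[of ?k] by auto
  have "collinear {0, vlarger t - vright t, vsmaller t - vright t}"
    using col collinear_3[of "vlarger t" "vright t" "vsmaller t"] by (simp add: insert_commute)
  then obtain k where k: "vsmaller t - vright t = k *\<^sub>R (vlarger t - vright t)"
    using pos w unfolding collinear_lemma v by auto
  then have "w * of_real (phi * hyp_length ?k) = w * (of_real k * cj c (\<i> * of_real (phi\<^sup>2 * hyp_length ?k)))"
    unfolding v by (simp add: scaleR_conv_of_real)
  moreover have "w \<noteq> 0" using w by auto
  ultimately have "of_real (phi * hyp_length ?k) = of_real k * cj c (\<i> * of_real (phi\<^sup>2 * hyp_length ?k))"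
    using mult_left_cancel by blast
  then have "Re (of_real (phi * hyp_length ?k)) = Re (of_real k * cj c (\<i> * of_real (phi\<^sup>2 * hyp_length ?k)))"
    by (rule arg_cong)
  also have "\<dots> = 0" by (cases c) (simp_all add: cj_def del: of_real_mult of_real_power)
  finally show False using pos by (simp only: Re_complex_of_real)
qed

lemma interior_region_nonempty:
  assumes "is_tile t"
  shows "interior (region t) \<noteq> {}"
proof -
  note nc = tile_not_collinear[OF assms]
  then have "vright t \<noteq> vlarger t" "vright t \<noteq> vsmaller t" "vlarger t \<noteq> vsmaller t"
    by (auto simp: insert_commute)
  then have "card {vright t, vlarger t, vsmaller t} = Suc (DIM(complex))" by simp
  then show ?thesis
    using nc interior_convex_hull_eq_empty[of "{vright t, vlarger t, vsmaller t}"]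
    by (auto simp: region_def vertices_def collinear_3_eq_affine_dependent)
qed

lemma closed_region: "closed (region t)"
  by (simp add: region_def vertices_def compact_imp_closed finite_imp_compact_convex_hull)

lemma homothety_affine: "homothety c k = (\<lambda>z. (c - k *\<^sub>R c) + k *\<^sub>R z)"
  by (rule ext) (simp add: homothety_def algebra_simps)

lemma homothety_inverse: "k \<noteq> 0 \<Longrightarrow> homothety c (1 / k) (homothety c k z) = z"
  "k \<noteq> 0 \<Longrightarrow> homothety c k (homothety c (1 / k) z) = z"
  by (simp_all add: homothety_def)

lemma homothety_diff: "homothety c k y - homothety c k x = k *\<^sub>R (y - x)"
  by (simp add: homothety_def algebra_simps)

lemma inj_homothety: "k \<noteq> 0 \<Longrightarrow> inj (homothety c k)"
  by (auto simp: inj_def homothety_def)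

lemma vertices_map: "vertices (map_tile f t) = f ` vertices t"
  by (simp add: vertices_def)

lemma region_homothety: "region (map_tile (homothety c k) t) = homothety c k ` region t"
  unfolding region_def vertices_map homothety_affine by (rule convex_hull_affinity)

lemma side_segment_homothety: "side_segment (map_tile (homothety c k) t) s = homothety c k ` side_segment t s"
proof -
  obtain p q where pq: "side_ends t s = (p, q)" by (cases "side_ends t s")
  have "closed_segment (homothety c k p) (homothety c k q) = homothety c k ` closed_segment p q"
    unfolding segment_convex_hull homothety_affine using convex_hull_affinity[of "c - k *\<^sub>R c" k "{p, q}"] by simp
  then show ?thesis by (simp add: side_segment_def side_ends_map pq)
qed

lemma side_dir_homothety: "k > 0 \<Longrightarrow> side_dir (map_tile (homothety c k) t) s = side_dir t s"
  by (simp add: side_dir_def side_ends_map homothety_diff sgn_scaleR split: prod.split)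

lemma homothety_motion: "homothety c k (motion A w b z) = motion (homothety c k A) w b (of_real k * z)"
  by (simp add: homothety_def motion_def scaleR_conv_of_real algebra_simps)

text \<open>The right angle of \<open>t\<close> becomes the foot of the altitude of the merged tile, and its small leg the
altitude.\<close>

definition merge :: "tile \<Rightarrow> tile" where
  "merge t = Tile Large (vlarger t) (vlarger (mate t)) (vsmaller t)"

text \<open>A large tile that is left alone becomes a small one: after scaling by \<open>phi\<close> it has the right size.\<close>

definition shrink :: "tile \<Rightarrow> tile" where
  "shrink t = Tile Small (vright t) (vlarger t) (vsmaller t)"

lemma merge_simps [simp]: "kind (merge t) = Large" "vright (merge t) = vlarger t"
  "vlarger (merge t) = vright t - phi\<^sup>2 *\<^sub>R (vsmaller t - vright t)" "vsmaller (merge t) = vsmaller t"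
  by (simp_all add: merge_def)

lemma shrink_simps [simp]: "kind (shrink t) = Small" "vright (shrink t) = vright t"
  "vlarger (shrink t) = vlarger t" "vsmaller (shrink t) = vsmaller t"
  by (simp_all add: shrink_def)

lemma right_vertex_on_hypotenuse: "vright t \<in> closed_segment (vlarger (merge t)) (vsmaller t)"
proof -
  define u where "u = phi\<^sup>2 / (1 + phi\<^sup>2)"
  have p: "1 + phi\<^sup>2 > 0" by (simp add: add_pos_nonneg)
  have u: "0 \<le> u" "u \<le> 1" "u * (1 + phi\<^sup>2) = phi\<^sup>2" using p by (simp_all add: u_def)
  have e: "vsmaller t - vlarger (merge t) = (1 + phi\<^sup>2) *\<^sub>R (vsmaller t - vright t)"
    by (simp add: algebra_simps)
  have "vlarger (merge t) + u *\<^sub>R (vsmaller t - vlarger (merge t)) = vright t"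
    unfolding e scaleR_scaleR u(3) by simp
  then have "vright t = (1 - u) *\<^sub>R vlarger (merge t) + u *\<^sub>R vsmaller t"
    by (simp add: algebra_simps)
  then show ?thesis using u unfolding in_segment by blast
qed

lemma side_segment_merge:
  "side_segment (merge t) Hyp = side_segment (mate t) Short \<union> side_segment t Long"
  "side_segment (merge t) Long = side_segment t Hyp"
  "side_segment (merge t) Short = side_segment (mate t) Hyp"
  using Un_closed_segment[OF right_vertex_on_hypotenuse[of t]]
  by (simp_all add: side_segment_def closed_segment_commute)

lemma side_segment_shrink: "side_segment (shrink t) s = side_segment t s"
  by (cases s) (simp_all add: side_segment_def)

lemma region_shrink: "region (shrink t) = region t"
  by (simp add: region_def vertices_def)

text \<open>A triangle consists of the segments from one vertex to the points of the opposite side, and the foot of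
the altitude divides this side.\<close>

lemma region_merge: "region (merge t) = region t \<union> region (mate t)"
proof -
  have tri: "convex hull {a, b, c} = (\<Union>x\<in>closed_segment b c. closed_segment a x)" for a b c :: complex
    using convex_hull_insert_segments[of a "{b, c}"] by (simp add: segment_convex_hull)
  let ?p = "vlarger (merge t)"
  have "region (merge t) = (\<Union>x\<in>closed_segment ?p (vsmaller t). closed_segment (vlarger t) x)"
    by (simp add: region_def vertices_def tri)
  also have "closed_segment ?p (vsmaller t) = closed_segment ?p (vright t) \<union> closed_segment (vright t) (vsmaller t)"
    using Un_closed_segment[OF right_vertex_on_hypotenuse[of t]] by simp
  also have "(\<Union>x\<in>closed_segment ?p (vright t) \<union> closed_segment (vright t) (vsmaller t). closed_segment (vlarger t) x)
     = convex hull {vlarger t, ?p, vright t} \<union> convex hull {vlarger t, vright t, vsmaller t}"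
    by (simp add: tri UN_Un)
  also have "\<dots> = region (mate t) \<union> region t"
    by (simp add: region_def vertices_def insert_commute)
  finally show ?thesis by blast
qed

lemma side_dir_shrink: "side_dir (shrink t) s = side_dir t s"
  by (cases s) (simp_all add: side_dir_def)

lemma side_dir_merge: "side_dir (merge t) Hyp = side_dir t Long" "side_dir (merge t) Long = side_dir t Hyp"
  "side_dir (merge t) Short = - side_dir (mate t) Hyp"
proof -
  have "vsmaller t - vlarger (merge t) = (1 + phi\<^sup>2) *\<^sub>R (vsmaller t - vright t)"
    by (simp add: algebra_simps)
  moreover have "1 + phi\<^sup>2 > 0" by (simp add: add_pos_nonneg)
  ultimately show "side_dir (merge t) Hyp = side_dir t Long"
    by (simp add: side_dir_def sgn_scaleR del: merge_simps(3))
  show "side_dir (merge t) Long = side_dir t Hyp" by (simp add: side_dir_def)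
  have "sgn (vlarger (mate t) - vlarger t) = - sgn (vlarger t - vlarger (mate t))"
    by (metis minus_diff_eq sgn_minus)
  then show "side_dir (merge t) Short = - side_dir (mate t) Hyp"
    by (simp add: side_dir_def)
qed

text \<open>The hypotenuse of \<open>t\<close> becomes the large leg of the merged tile, which turns the frame by the smaller
angle and reverses its chirality. The foot of the altitude of \<open>t\<close> becomes the special point on the large
leg. For \<open>SM\<close> the value is arbitrary, as this point of \<open>t\<close> is not special in the merged tile.\<close>

fun merge_germ :: "germ \<Rightarrow> decs \<Rightarrow> germ" where
  "merge_germ (Germ k s d c ds) ds' =
     Germ Large (case s of SP \<Rightarrow> SR | SQ \<Rightarrow> SQ | SR \<Rightarrow> SF | SF \<Rightarrow> SM | SM \<Rightarrow> SM)
       (dadd d (Q0, if c then - 1 else 1)) (\<not> c) ds'"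

fun shrink_germ :: "germ \<Rightarrow> decs \<Rightarrow> germ" where
  "shrink_germ (Germ k s d c ds) ds' = Germ Small s d c ds'"

text \<open>The merged tile seen from its vertex outside the large part, which is the larger acute angle of the mate.\<close>

fun merge_small_germ :: "germ \<Rightarrow> decs \<Rightarrow> germ" where
  "merge_small_germ (Germ k s d c ds) ds' =
     Germ Large SP (dadd d (if c then (Q3, - 1) else (Q1, 1))) (\<not> c) ds'"

lemma merge_motion: "merge (map_tile (motion A w b) t) = map_tile (motion A w b) (merge t)"
  by (simp add: merge_def map_tile_def motion_def scaleR_conv_of_real algebra_simps)

lemma shrink_motion: "shrink (map_tile f t) = map_tile f (shrink t)"
  by (simp add: shrink_def map_tile_def)

lemma scale_placed:
  assumes "map_tile (\<lambda>z. of_real phi * z) u = germ_tile 0 g"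
  shows "map_tile (homothety c phi) (map_tile (motion A w b) u) = placed (homothety c phi A) w b g"
  unfolding placed_def assms[symmetric] map_tile_map_tile homothety_motion ..

lemma direction_unit:
  "direction (Q0, 1) = of_real phi + \<i> * (of_real phi * of_real phi)"
  "direction (Q0, - 1) = of_real phi - \<i> * (of_real phi * of_real phi)"
  "direction (Q3, - 1) = - (of_real phi * of_real phi) - \<i> * of_real phi"
  "direction (Q1, 1) = - (of_real phi * of_real phi) + \<i> * of_real phi"
  unfolding direction_table by (simp_all add: complex_eq_iff power2_eq_square)

lemma merge_placed:
  assumes "gkind g = Large" "gslot g \<noteq> SM"
  shows "map_tile (homothety c phi) (merge (placed A w b g)) = placed (homothety c phi A) w b (merge_germ g ds')"
proof -
  obtain k s d e ds where g: "g = Germ k s d e ds" by (cases g)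
  define x where "x = complex_of_real phi"
  have cx: "cnj x = x" by (simp add: x_def)
  note p4 = of_real_phi_reduce[folded x_def]
  have "map_tile (\<lambda>z. of_real phi * z) (merge (germ_tile 0 g)) = germ_tile 0 (merge_germ g ds')"
    using assms unfolding g merge_germ.simps germ_tile_def germ.sel Let_def direction_simps
    by (cases s; cases e)
       (simp_all add: merge_def map_tile_def motion_def spot_offset_simps hyp_length_simps scaleR_conv_of_real
        cj_def direction_unit p4 cx eval_nat_numeral algebra_simps del: direction.simps flip: x_def)
  from scale_placed[OF this, of c A w b] show ?thesis by (simp add: placed_def merge_motion)
qed

lemma shrink_placed:
  assumes "gkind g = Large"
  shows "map_tile (homothety c phi) (shrink (placed A w b g)) = placed (homothety c phi A) w b (shrink_germ g ds')"
proof -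
  obtain k s d e ds where g: "g = Germ k s d e ds" by (cases g)
  have "map_tile (\<lambda>z. of_real phi * z) (shrink (germ_tile 0 g)) = germ_tile 0 (shrink_germ g ds')"
    using assms unfolding g shrink_germ.simps germ_tile_def germ.sel Let_def
    by (cases s) (simp_all add: shrink_def map_tile_def motion_def spot_offset_simps hyp_length_simps algebra_simps)
  from scale_placed[OF this, of c A w b] show ?thesis by (simp add: placed_def shrink_motion)
qed

text \<open>The merged tile in terms of the mate, whose small leg points from the right angle away from the missing
vertex; note that \<open>1 / phi\<^sup>2 = 1 + phi\<^sup>2\<close>.\<close>

definition merge_of_small :: "tile \<Rightarrow> tile" where
  "merge_of_small s = Tile Large (vsmaller s) (vlarger s) (vright s - (1 + phi\<^sup>2) *\<^sub>R (vlarger s - vright s))"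

lemma merge_of_small: "merge_of_small (mate t) = merge t"
proof -
  have "(1 + phi\<^sup>2) * phi\<^sup>2 = 1" using phi_4 by (simp add: algebra_simps flip: power_add)
  then have "vright t - (1 + phi\<^sup>2) *\<^sub>R (- (phi\<^sup>2 *\<^sub>R (vsmaller t - vright t))) = vsmaller t"
    by (simp only: scaleR_minus_right scaleR_scaleR) simp
  then show ?thesis by (simp add: merge_of_small_def merge_def)
qed

lemma merge_of_small_motion: "merge_of_small (map_tile (motion A w b) t) = map_tile (motion A w b) (merge_of_small t)"
  by (cases b) (simp_all add: cj_def merge_of_small_def map_tile_def motion_def scaleR_conv_of_real algebra_simps)

lemma merge_small_placed:
  assumes "gkind g = Small" "gslot g = SP" "mate t = placed A w b g"
  shows "map_tile (homothety c phi) (merge t) = placed (homothety c phi A) w b (merge_small_germ g ds')"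
proof -
  obtain k s d e ds where g: "g = Germ k s d e ds" by (cases g)
  define x where "x = complex_of_real phi"
  have cx: "cnj x = x" by (simp add: x_def)
  note p4 = of_real_phi_reduce[folded x_def]
  have "map_tile (\<lambda>z. of_real phi * z) (merge_of_small (germ_tile 0 g)) = germ_tile 0 (merge_small_germ g ds')"
    using assms unfolding g merge_small_germ.simps germ_tile_def germ.sel Let_def direction_simps
    by (cases e)
       (simp_all add: merge_of_small_def map_tile_def motion_def spot_offset_simps hyp_length_simps scaleR_conv_of_real
        cj_def direction_unit p4 cx eval_nat_numeral algebra_simps del: direction.simps flip: x_def)
  from scale_placed[OF this, of c A w b]
  have "map_tile (homothety c phi) (merge_of_small (placed A w b g)) = placed (homothety c phi A) w b (merge_small_germ g ds')"
    by (simp add: placed_def merge_of_small_motion)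
  then show ?thesis unfolding assms(3)[symmetric] merge_of_small .
qed

section \<open>Composing the legal stars\<close>

fun pred_label :: "decoration \<Rightarrow> decoration" where
  "pred_label (u, l) = (u, l - 1)"

lemma increase_pred_label: "increase (pred_label x) = x"
  by (cases x) (simp add: increase_def)

lemma even_label_pred: "even_label (l - 1) \<longleftrightarrow> \<not> even_label l"
proof -
  obtain x where x: "l = z4_val x" using z4_val_surj by blast
  have "l - 1 = z4_val (z4_add Q3 x)" unfolding x z4_val_add by (cases x) simp_all
  then show ?thesis unfolding x by (cases x) (simp_all add: even_label_def)
qed

fun pred_dec :: "bool \<times> z4 \<Rightarrow> bool \<times> z4" where
  "pred_dec (b, l) = (b, z4_add Q3 l)"

fun flip_dec :: "bool \<times> z4 \<Rightarrow> bool \<times> z4" where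
  "flip_dec (b, l) = (\<not> b, l)"

lemma pred_label_decoration_of:
  assumes "side_dir t' s' = side_dir t s"
  shows "pred_label (decoration_of t s x) = decoration_of t' s' (pred_dec x)"
  using assms by (cases x; cases "snd x") simp_all

lemma pred_label_decoration_of_flip:
  assumes "side_dir t' s' = - side_dir t s"
  shows "pred_label (decoration_of t s x) = decoration_of t' s' (pred_dec (flip_dec x))"
  using assms by (cases x; cases "snd x") simp_all

definition no_decs :: decs where
  "no_decs = Decs None None None"

fun pred_decs :: "decs \<Rightarrow> decs" where
  "pred_decs (Decs h l a) = Decs (map_option pred_dec h) (map_option pred_dec l) (map_option pred_dec a)"

text \<open>The hypotenuse of the merged tile consists of the large leg of \<open>t\<close> and the small leg of its mate, and
the center can lie on either. The sides of the mate run in the opposite direction.\<close>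

fun merge_decs :: "decs \<Rightarrow> decs \<Rightarrow> decs" where
  "merge_decs (Decs h l a) (Decs h' l' a') =
    Decs (map_option pred_dec (case l of Some x \<Rightarrow> Some x | None \<Rightarrow> map_option flip_dec a'))
      (map_option pred_dec h) (map_option pred_dec (map_option flip_dec h'))"

fun mate_decs :: "germ list \<Rightarrow> germ \<Rightarrow> decs" where
  "mate_decs [] g = no_decs"
| "mate_decs (h # G) g = (if same_place (mate_germ g) h then gdecs h else mate_decs G g)"

definition compose_germ :: "germ list \<Rightarrow> bool \<Rightarrow> germ \<Rightarrow> germ" where
  "compose_germ G p g =
    (if p then merge_germ g (merge_decs (gdecs g) (if gslot g = SR then mate_decs G g else if gslot g = SP then mate_decs G g else no_decs))
     else shrink_germ g (pred_decs (gdecs g)))"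

text \<open>The merged tiles are listed by their large parts. A small tile yields a new entry only if the center
lies outside the large part, that is, at the larger acute angle of the small tile; otherwise its large
part belongs to the star as well.\<close>

definition compose_star :: "(nat \<Rightarrow> bool) \<Rightarrow> germ list \<Rightarrow> germ list" where
  "compose_star P G =
     map (\<lambda>j. compose_germ G (P j) (G ! j)) (filter (\<lambda>j. gkind (G ! j) = Large) [0..<length G]) @
     map (\<lambda>g. merge_small_germ g (merge_decs no_decs (gdecs g))) (filter (\<lambda>g. gkind g = Small \<and> gslot g = SP) G)"

definition pairing :: "nat \<Rightarrow> bool \<Rightarrow> nat \<Rightarrow> bool" where
  "pairing n v j = (case map_of (forced_pairing n) j of Some b \<Rightarrow> b | None \<Rightarrow> v)"

text \<open>\<open>C\<^sub>6\<close> is the decomposition of both \<open>C\<^sub>5\<close> and \<open>C\<^sub>7\<close>; the pairing \<open>v\<close> of its undetermined tile tells them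
apart.\<close>

definition target :: "nat \<Rightarrow> bool \<Rightarrow> nat" where
  "target n v = (if n = 6 then if v then 7 else 5 else n - 1)"

text \<open>In some cases the composed star appears upside down, whence the possible half turn \<open>(Q2, 0)\<close>.\<close>

definition composes :: "nat \<Rightarrow> bool \<times> z4 \<Rightarrow> bool \<Rightarrow> bool" where
  "composes n ax v = list_ex (\<lambda>(d, ax'). set (compose_star (pairing n v) (star_code n (Some ax)))
      = set (map (turn d True) (star_code (target n v) (Some ax'))))
    [(d, ax'). d \<leftarrow> [(Q0, 0), (Q2, 0)], ax' \<leftarrow> axes (target n v)]"

text \<open>Which special points of tiles are centers, and that \<open>forced_pairing\<close> covers all large tiles but one.\<close>

definition regular :: "nat \<Rightarrow> bool \<times> z4 \<Rightarrow> bool" where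
  "regular n ax = list_all (\<lambda>j. let g = star_code n (Some ax) ! j in
     if n = 1 then gslot g = SR \<or> gkind g = Large \<and> gslot g = SM
     else if gkind g = Large then gslot g \<noteq> SM \<and> (n = 6 \<and> j = 4 \<or> map_of (forced_pairing n) j \<noteq> None)
     else gslot g \<noteq> SF \<and> gslot g \<noteq> SM) [0..<length (star_code n (Some ax))]"

lemma composes: "n \<in> {2..7} \<Longrightarrow> ax \<in> set (axes n) \<Longrightarrow> composes n ax v"
proof -
  have "list_all (\<lambda>n. list_all (\<lambda>ax. list_all (composes n ax) [True, False]) (axes n)) [2, 3, 4, 5, 6, 7]"
    by code_simp
  moreover assume "n \<in> {2..7}" "ax \<in> set (axes n)"
  moreover from \<open>n \<in> {2..7}\<close> have "n \<in> set [2, 3, 4, 5, 6, 7]" by auto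
  moreover have "v \<in> set [True, False]" by auto
  ultimately show ?thesis unfolding list_all_iff by blast
qed

lemma regular: "n \<in> {1..7} \<Longrightarrow> ax \<in> set (axes n) \<Longrightarrow> regular n ax"
proof -
  have "list_all (\<lambda>n. list_all (regular n) (axes n)) [1, 2, 3, 4, 5, 6, 7]"
    by code_simp
  moreover assume "n \<in> {1..7}" "ax \<in> set (axes n)"
  moreover from \<open>n \<in> {1..7}\<close> have "n \<in> set [1, 2, 3, 4, 5, 6, 7]" by auto
  ultimately show ?thesis unfolding list_all_iff by blast
qed

section \<open>The composed tiles form a tiling\<close>

text \<open>Two of the ends and the midpoint belong to the same convex set.\<close>

lemma subsegment_in_union:
  fixes p q :: complex
  assumes "p \<noteq> q" "closed_segment p q \<subseteq> A \<union> B" "convex A" "convex B"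
  shows "\<exists>p' q'. p' \<noteq> q' \<and> closed_segment p' q' \<subseteq> closed_segment p q \<and> (closed_segment p' q' \<subseteq> A \<or> closed_segment p' q' \<subseteq> B)"
proof -
  have sub: "closed_segment x y \<subseteq> closed_segment p q" if "x \<in> closed_segment p q" "y \<in> closed_segment p q" for x y
    using that by (simp add: closed_segment_subset convex_closed_segment)
  have seg: "closed_segment x y \<subseteq> C" if "x \<in> C" "y \<in> C" "convex C" for x y and C :: "complex set"
    using that by (simp add: closed_segment_subset)
  define m where "m = midpoint p q"
  have m: "m \<in> closed_segment p q" "m \<noteq> p" "m \<noteq> q" using assms(1) by (simp_all add: m_def)
  have pq: "p \<in> closed_segment p q" "q \<in> closed_segment p q" by simp_all
  have in_u: "p \<in> A \<or> p \<in> B" "q \<in> A \<or> q \<in> B" "m \<in> A \<or> m \<in> B" using assms(2) m(1) pq by auto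
  consider "p \<in> A" "q \<in> A" | "p \<in> A" "m \<in> A" | "q \<in> A" "m \<in> A" | "p \<in> B" "q \<in> B" | "p \<in> B" "m \<in> B" | "q \<in> B" "m \<in> B"
    using in_u by blast
  then show ?thesis
    by cases (metis assms m pq sub seg)+
qed

lemma side_segment_subset_region: "side_segment t s \<subseteq> region t"
proof -
  have "fst (side_ends t s) \<in> region t" "snd (side_ends t s) \<in> region t"
    by (cases s; simp add: region_def vertices_def hull_inc)+
  then show ?thesis by (simp add: side_segment_def closed_segment_subset region_def)
qed

lemma convex_side_segment: "convex (side_segment t s)"
  by (simp add: side_segment_def)

lemma interior_Union_closed_empty:
  assumes "finite F" "\<And>S. S \<in> F \<Longrightarrow> closed S" "\<And>S. S \<in> F \<Longrightarrow> interior S = {}"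
  shows "interior (\<Union> F) = ({} :: complex set)"
  using assms
proof (induction F rule: finite_induct)
  case (insert S F)
  then have "interior (S \<union> \<Union> F) = interior S" by (intro interior_closed_Un_empty_interior) auto
  then show ?case using insert by simp
qed simp

lemma interior_homothety_empty:
  assumes "k > 0" "interior S = {}"
  shows "interior (homothety c k ` S) = {}"
proof (rule ccontr)
  let ?U = "homothety c (1 / k) ` interior (homothety c k ` S)"
  assume "interior (homothety c k ` S) \<noteq> {}"
  moreover have "open ?U" unfolding homothety_affine[of c "1 / k"] using assms(1) by (intro open_affinity) auto
  moreover have "?U \<subseteq> S"
  proof -
    have "?U \<subseteq> homothety c (1 / k) ` homothety c k ` S" by (intro image_mono interior_subset)
    then show ?thesis using assms(1) by (simp add: image_image homothety_inverse)
  qed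
  ultimately have "interior S \<noteq> {}" by (metis image_is_empty interior_maximal subset_empty)
  then show False using assms(2) by simp
qed

text \<open>Zero on the line of the small leg of \<open>t\<close>, which separates \<open>t\<close> from its mate.\<close>

definition level :: "tile \<Rightarrow> complex \<Rightarrow> real" where
  "level t z = (z - vright t) \<bullet> (vsmaller t - vright t)"

lemma tile_level:
  assumes "is_tile t"
  shows "level t (vlarger t) = 0" "level t (vsmaller t) > 0"
proof -
  obtain A w c where w: "norm w = 1" and t: "t = map_tile (motion A w c) (proto_tile (kind t))"
    using assms unfolding is_tile_iff_motion by blast
  let ?k = "kind t"
  have v: "vright t = A" "vlarger t = A + w * cj c (\<i> * of_real (phi\<^sup>2 * hyp_length ?k))"
    "vsmaller t = A + w * of_real (phi * hyp_length ?k)"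
    by (subst t, simp add: motion_def)+
  have "Re (cj c \<i>) = 0" by (simp add: cj_def)
  then show "level t (vlarger t) = 0"
    unfolding level_def v by (simp add: inner_complex_def algebra_simps)
  have "vsmaller t - vright t \<noteq> 0" unfolding v using w phi_pos hyp_length_pos[of ?k] by auto
  then show "level t (vsmaller t) > 0" unfolding level_def by simp
qed

lemma level_region:
  assumes "is_tile t"
  shows "z \<in> region t \<Longrightarrow> level t z \<ge> 0" "z \<in> region (mate t) \<Longrightarrow> level t z \<le> 0"
proof -
  note l = tile_level[OF assms]
  have r: "level t (vright t) = 0" by (simp add: level_def)
  have m: "level t (vlarger (mate t)) = - (phi\<^sup>2 * level t (vsmaller t))"
    by (simp add: level_def)
  have "convex {z. level t z \<ge> 0}" "convex {z. level t z \<le> 0}"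
    using convex_halfspace_ge[of "vright t \<bullet> (vsmaller t - vright t)" "vsmaller t - vright t"]
      convex_halfspace_le[of "vsmaller t - vright t" "vright t \<bullet> (vsmaller t - vright t)"]
    by (simp_all add: level_def inner_diff_left inner_commute)
  moreover have "vertices t \<subseteq> {z. level t z \<ge> 0}" "vertices (mate t) \<subseteq> {z. level t z \<le> 0}"
    using l r m by (simp_all add: vertices_def del: mate_simps(3))
  ultimately have "region t \<subseteq> {z. level t z \<ge> 0}" "region (mate t) \<subseteq> {z. level t z \<le> 0}"
    unfolding region_def by (simp_all add: hull_minimal)
  then show "z \<in> region t \<Longrightarrow> level t z \<ge> 0" "z \<in> region (mate t) \<Longrightarrow> level t z \<le> 0" by auto
qed

lemma spot_not_in_mate:
  assumes "is_tile t" "s \<notin> {SR, SP}"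
  shows "spot t s \<notin> region (mate t)"
proof -
  note l = tile_level[OF assms(1)]
  have "phi ^ 4 > 0" using phi_pos by simp
  moreover have "level t (spot t SQ) = level t (vsmaller t)"
    "level t (spot t SM) = phi ^ 4 * level t (vsmaller t)"
    "level t (spot t SF) = level t (vlarger t) + phi ^ 4 * (level t (vsmaller t) - level t (vlarger t))"
    by (simp_all add: level_def inner_complex_def flip: of_real_power) (simp_all add: algebra_simps)
  ultimately have "level t (spot t s) > 0" using l assms(2) by (cases s) (simp_all del: spot.simps)
  then show ?thesis using level_region(2)[OF assms(1)] by force
qed

lemma mate_spot_not_in_region: "is_tile t \<Longrightarrow> vlarger (mate t) \<notin> region t"
proof
  assume t: "is_tile t" and "vlarger (mate t) \<in> region t"
  then have "level t (vlarger (mate t)) \<ge> 0" by (intro level_region)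
  moreover have "level t (vlarger (mate t)) = - (phi\<^sup>2 * level t (vsmaller t))"
    by (simp add: level_def)
  moreover have "phi\<^sup>2 * level t (vsmaller t) > 0" using tile_level(2)[OF t] phi_pos by simp
  ultimately show False by linarith
qed

lemma is_tile_merge:
  assumes "is_tile t" "kind t = Large"
  shows "is_tile (map_tile (homothety c phi) (merge t))" "is_tile (map_tile (homothety c phi) (shrink t))"
proof -
  obtain A w b where w: "norm w = 1" and t: "t = map_tile (motion A w b) (proto_tile Large)"
    using assms unfolding is_tile_iff_motion by metis
  let ?g = "Germ Large SR (Q0, 0) True no"
  have "germ_tile 0 ?g = proto_tile Large" for no
    by (rule tile.expand) (simp add: germ_tile_def spot_offset_simps motion_def cj_def)
  then have "t = placed A w b ?g" for no using t by (simp add: placed_def)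
  then show "is_tile (map_tile (homothety c phi) (merge t))" "is_tile (map_tile (homothety c phi) (shrink t))"
    using merge_placed[of ?g c A w b] shrink_placed[of ?g c A w b] is_tile_placed[OF w]
    by (metis germ.sel(1,2) slot.distinct(7))+
qed

context legal_tiling
begin

lemma tiles_overlap:
  assumes "(t, d) \<in> T" "(t', d') \<in> T" "interior (region t) \<inter> interior (region t') \<noteq> {}"
  shows "(t, d) = (t', d')"
  using tiling assms unfolding colored_tiling_def disjoint_family_on_def by fastforce

lemma decoration_unique:
  assumes "(t, d) \<in> T" "(t, d') \<in> T"
  shows "d = d'"
  using tiles_overlap[OF assms] interior_region_nonempty[OF tiles[OF assms(1)]] by simp

definition mate_dec :: "tile \<Rightarrow> side \<Rightarrow> decoration" where
  "mate_dec t = (SOME d. (mate t, d) \<in> T)"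

lemma mate_dec: "paired t \<Longrightarrow> (mate t, mate_dec t) \<in> T"
  unfolding paired_def mate_dec_def by (rule someI_ex[where P = "\<lambda>d. (mate t, d) \<in> T"])

definition composed_tile :: "tile \<Rightarrow> tile" where
  "composed_tile t = (if paired t then merge t else shrink t)"

definition composed_dec :: "tile \<Rightarrow> (side \<Rightarrow> decoration) \<Rightarrow> side \<Rightarrow> decoration" where
  "composed_dec t d s = pred_label
     (if paired t then (case s of Hyp \<Rightarrow> d Long | Long \<Rightarrow> d Hyp | Short \<Rightarrow> mate_dec t Hyp) else d s)"

definition compose :: "complex \<Rightarrow> tile \<times> (side \<Rightarrow> decoration) \<Rightarrow> colored_tile" where
  "compose c = (\<lambda>(t, d). (map_tile (homothety c phi) (composed_tile t), composed_dec t d))"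

definition composition :: "complex \<Rightarrow> colored_tile set" where
  "composition c = compose c ` {x \<in> T. kind (fst x) = Large}"

lemma compositionE:
  assumes "x \<in> composition c"
  obtains t d where "(t, d) \<in> T" "kind t = Large" "x = compose c (t, d)"
  using assms by (auto simp: composition_def)

lemma region_composed: "region (composed_tile t) = region t \<union> (if paired t then region (mate t) else {})"
  by (simp add: composed_tile_def region_merge region_shrink)

lemma composed_tiles:
  assumes "(t, d) \<in> T" "kind t = Large"
  shows "is_tile (fst (compose c (t, d)))"
  using is_tile_merge[OF tiles[OF assms(1)] assms(2)] by (simp add: compose_def composed_tile_def)

text \<open>This reduces matching of sides of composed tiles to matching of sides in \<open>T\<close>; a side that is not made
of two parts counts twice.\<close>

lemma composed_side_pieces:
  assumes "(t, d) \<in> T" "kind t = Large"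
  obtains t1 d1 s1 t2 d2 s2 where "(t1, d1) \<in> T" "(t2, d2) \<in> T"
    "side_segment (composed_tile t) s = side_segment t1 s1 \<union> side_segment t2 s2"
    "composed_dec t d s = pred_label (d1 s1)" "composed_dec t d s = pred_label (d2 s2)"
proof (cases "paired t")
  case False
  then show thesis
    using that[of t d t d s s] assms by (simp add: composed_tile_def composed_dec_def side_segment_shrink)
next
  case True
  note m = mate_dec[OF True]
  have "mate_dec t Short = d Long" using mate_decorations(3)[OF assms m] .
  then show thesis
    using that[of t d "mate t" "mate_dec t" Long Short] that[of t d t d Hyp Hyp]
      that[of "mate t" "mate_dec t" "mate t" "mate_dec t" Hyp Hyp] assms(1) m True
    by (cases s) (auto simp: composed_tile_def composed_dec_def side_segment_merge Un_commute)
qed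

lemma orientation_cases: "(t, d) \<in> T \<Longrightarrow> fst (d s) = side_dir t s \<or> fst (d s) = - side_dir t s"
proof -
  assume "(t, d) \<in> T"
  moreover obtain p q where pq: "side_ends t s = (p, q)" by (cases "side_ends t s")
  ultimately have "fst (d s) = sgn (q - p) \<or> fst (d s) = sgn (p - q)"
    using colored[of t d] unfolding is_colored_tile_def by (auto dest!: spec[of _ s])
  moreover have "sgn (p - q) = - sgn (q - p)" by (metis minus_diff_eq sgn_minus)
  ultimately show ?thesis by (simp add: side_dir_def pq)
qed

lemma parity: "(t, d) \<in> T \<Longrightarrow> even_label (snd (d s)) \<longleftrightarrow> (kind t, s) \<in> {(Large, Hyp), (Large, Short), (Small, Long)}"
  using colored by (auto simp: is_colored_tile_def)

lemma is_colored_tileI: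
  assumes "is_tile t" "\<And>s. fst (d s) = side_dir t s \<or> fst (d s) = - side_dir t s"
    "\<And>s. even_label (snd (d s)) \<longleftrightarrow> (kind t, s) \<in> {(Large, Hyp), (Large, Short), (Small, Long)}"
  shows "is_colored_tile (t, d)"
proof -
  have "case side_ends t s of (p, q) \<Rightarrow> fst (d s) = sgn (q - p) \<or> fst (d s) = sgn (p - q)" for s
  proof -
    obtain p q where pq: "side_ends t s = (p, q)" by (cases "side_ends t s")
    have "sgn (p - q) = - sgn (q - p)" by (metis minus_diff_eq sgn_minus)
    then show ?thesis using assms(2)[of s] by (simp add: side_dir_def pq)
  qed
  then show ?thesis using assms(1,3) by (simp add: is_colored_tile_def)
qed

lemma composed_colored:
  assumes "(t, d) \<in> T" "kind t = Large"
  shows "is_colored_tile (compose c (t, d))"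
proof -
  have p: "fst (pred_label x) = fst x" "even_label (snd (pred_label x)) \<longleftrightarrow> \<not> even_label (snd x)" for x
    by (cases x; simp add: even_label_pred)+
  note o = orientation_cases[OF assms(1)] and par = parity[OF assms(1)]
  have "is_colored_tile (fst (compose c (t, d)), composed_dec t d)"
  proof (rule is_colored_tileI[OF composed_tiles[OF assms]])
    fix s
    show "fst (composed_dec t d s) = side_dir (fst (compose c (t, d))) s \<or>
        fst (composed_dec t d s) = - side_dir (fst (compose c (t, d))) s"
      using o[of s] o[of Long] o[of Hyp] orientation_cases[OF mate_dec, of t Hyp]
      by (cases s) (auto simp: compose_def composed_dec_def composed_tile_def p side_dir_homothety[OF phi_pos]
          side_dir_merge side_dir_shrink)
    show "even_label (snd (composed_dec t d s)) \<longleftrightarrow>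
        (kind (fst (compose c (t, d))), s) \<in> {(Large, Hyp), (Large, Short), (Small, Long)}"
      using par[of s] par[of Long] par[of Hyp] parity[OF mate_dec, of t Hyp] assms(2)
      by (cases s) (auto simp: compose_def composed_dec_def composed_tile_def p)
  qed
  then show ?thesis by (simp add: compose_def)
qed

text \<open>The intersection of two composed tiles is a finite union of closed sets, the intersections of two
different tiles of \<open>T\<close>. Each of them has empty interior, hence so has the union.\<close>

lemma composition_tiling: "colored_tiling (composition c)"
  unfolding colored_tiling_def
proof (intro conjI ballI)
  show "is_colored_tile x" if "x \<in> composition c" for x
    using that composed_colored by (auto elim!: compositionE)
  show "disjoint_family_on (\<lambda>x. interior (region (fst x))) (composition c)"
    unfolding disjoint_family_on_def
  proof (intro ballI impI)
    fix x y assume x: "x \<in> composition c" and y: "y \<in> composition c" and ne: "x \<noteq> y"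
    obtain t d where t: "(t, d) \<in> T" "kind t = Large" "x = compose c (t, d)" using x by (rule compositionE)
    obtain t' d' where t': "(t', d') \<in> T" "kind t' = Large" "y = compose c (t', d')" using y by (rule compositionE)
    have tt: "t \<noteq> t'" using ne t t' decoration_unique by metis
    have mm: "mate t \<noteq> mate t'"
    proof
      assume eq: "mate t = mate t'"
      then have "merge t = merge t'" by (metis merge_of_small)
      then have "vsmaller t = vsmaller t'" by (metis merge_simps(4))
      moreover have "vright t = vright t'" "vlarger t = vlarger t'" using eq by (metis mate_simps(2,4))+
      ultimately show False using tt t(2) t'(2) by (metis tile.expand)
    qed
    have tm: "t \<noteq> mate t'" "mate t \<noteq> t'" using t(2) t'(2) by auto
    have disj: "interior (region u \<inter> region u') = {}"
      if "u \<noteq> u'" "(u, e) \<in> T" "(u', e') \<in> T" for u u' e e'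
      using that tiles_overlap[of u e u' e'] by auto
    define K where "K = (\<lambda>t. if paired t then {t, mate t} else {t})"
    have KT: "\<exists>e. (u, e) \<in> T" if "u \<in> K t \<or> u \<in> K t'" for u
      using that t(1) t'(1) mate_dec by (auto simp: K_def split: if_splits)
    have reg: "region (composed_tile v) = (\<Union>u\<in>K v. region u)" for v
      by (simp add: region_composed K_def)
    have empty: "interior (region (composed_tile t) \<inter> region (composed_tile t')) = {}"
    proof -
      have "region (composed_tile t) \<inter> region (composed_tile t') = \<Union> ((\<lambda>(a, b). region a \<inter> region b) ` (K t \<times> K t'))"
        unfolding reg by blast
      moreover have "interior (region a \<inter> region b) = {}" if ab: "a \<in> K t" "b \<in> K t'" for a b
      proof -
        have "a \<noteq> b" using ab tt mm tm by (auto simp: K_def split: if_splits)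
        then show ?thesis using KT[of a] KT[of b] ab disj by blast
      qed
      moreover have "finite (K t \<times> K t')" by (simp add: K_def)
      ultimately show ?thesis
        by (simp only:) (rule interior_Union_closed_empty, auto intro!: closed_Int closed_region)
    qed
    moreover have "region (fst x) \<inter> region (fst y) = homothety c phi ` (region (composed_tile t) \<inter> region (composed_tile t'))"
      unfolding t(3) t'(3) compose_def using phi_pos
      by (simp add: region_homothety image_Int[OF inj_homothety])
    ultimately show "interior (region (fst x)) \<inter> interior (region (fst y)) = {}"
      using interior_homothety_empty[OF phi_pos empty, of c] by (simp flip: interior_Int)
  qed
qed

end

section \<open>Decomposition, covering and matching sides\<close>

lemma line_foot_merge:
  assumes "is_tile t"
  shows "line_foot (homothety c phi (vlarger (merge t))) (homothety c phi (vsmaller t)) (homothety c phi (vlarger t))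
    = homothety c phi (vright t)"
proof -
  let ?h = "homothety c phi"
  define e where "e = vsmaller t - vright t"
  define a where "a = 1 + phi\<^sup>2"
  have a: "a > 0" by (simp add: a_def add_pos_nonneg)
  have ee: "e \<bullet> e > 0" using tile_level(2)[OF assms] by (simp add: level_def e_def)
  have q: "?h (vsmaller t) - ?h (vlarger (merge t)) = (phi * a) *\<^sub>R e"
    by (simp add: homothety_diff a_def e_def algebra_simps)
  have r: "?h (vlarger t) - ?h (vlarger (merge t)) = phi *\<^sub>R (vlarger t - vright t + phi\<^sup>2 *\<^sub>R e)"
    by (simp add: homothety_diff e_def algebra_simps)
  have "(vlarger t - vright t) \<bullet> e = 0" using tile_level(1)[OF assms] by (simp add: level_def e_def)
  then have I1: "(?h (vlarger t) - ?h (vlarger (merge t))) \<bullet> (?h (vsmaller t) - ?h (vlarger (merge t)))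
     = phi * (phi * a) * (phi\<^sup>2 * (e \<bullet> e))"
    unfolding q r by (simp add: inner_add_left)
  have I2: "(?h (vsmaller t) - ?h (vlarger (merge t))) \<bullet> (?h (vsmaller t) - ?h (vlarger (merge t)))
     = (phi * a) * (phi * a) * (e \<bullet> e)" unfolding q by simp
  have "line_foot (?h (vlarger (merge t))) (?h (vsmaller t)) (?h (vlarger t))
     = ?h (vlarger (merge t)) + (phi * (phi * a) * (phi\<^sup>2 * (e \<bullet> e)) / ((phi * a) * (phi * a) * (e \<bullet> e))) *\<^sub>R ((phi * a) *\<^sub>R e)"
    unfolding line_foot_def I1 I2 unfolding q ..
  also have "phi * (phi * a) * (phi\<^sup>2 * (e \<bullet> e)) / ((phi * a) * (phi * a) * (e \<bullet> e)) = phi\<^sup>2 / a"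
    using a ee phi_pos by (simp add: field_simps)
  also have "(phi\<^sup>2 / a) *\<^sub>R ((phi * a) *\<^sub>R e) = phi *\<^sub>R (phi\<^sup>2 *\<^sub>R e)" using a by simp
  also have "?h (vlarger (merge t)) + phi *\<^sub>R (phi\<^sup>2 *\<^sub>R e) = ?h (vright t)"
    by (simp add: homothety_def e_def algebra_simps)
  finally show ?thesis .
qed

context legal_tiling
begin

text \<open>Increasing the labels undoes their decrease, and \<open>mate_decorations\<close> tells that the two decorations that
a composed tile does not retain, those of the altitude, are the ones that cutting restores.\<close>

lemma scaled_cut_compose:
  assumes t: "(t, d) \<in> T" "kind t = Large"
  shows "(\<lambda>(t, d). (map_tile (homothety c (1 / phi)) t, d)) ` cut (compose c (t, d))
    = (if paired t then {(t, d), (mate t, mate_dec t)} else {(t, d)})"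
proof -
  let ?h = "homothety c phi"
  have inv: "homothety c (1 / phi) (?h z) = z" for z using phi_pos by (simp add: homothety_inverse)
  obtain r p q where tt: "t = Tile Large r p q" using t(2) by (cases t) auto
  show ?thesis
  proof (cases "paired t")
    case False
    have "compose c (t, d) = (Tile Small (?h r) (?h p) (?h q), composed_dec t d)"
      using False by (simp add: compose_def composed_tile_def shrink_def tt map_tile_def)
    moreover have "(\<lambda>s. increase (composed_dec t d s)) = d"
      using False by (simp add: composed_dec_def increase_pred_label)
    ultimately show ?thesis using False by (simp add: map_tile_def inv) (simp add: tt)
  next
    case True
    let ?p = "vlarger (merge t)"
    note m = mate_dec[OF True]
    have c: "compose c (t, d) = (Tile Large (?h p) (?h ?p) (?h q), composed_dec t d)"
      using True by (simp add: compose_def composed_tile_def merge_def tt map_tile_def)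
    have f: "line_foot (?h ?p) (?h q) (?h p) = ?h r"
      using line_foot_merge[OF tiles[OF t(1)], of c] by (simp add: tt)
    have alt: "(sgn (?h p - ?h r), 0) = (side_dir t Short, 0 :: 4)"
      using phi_pos by (simp add: homothety_diff sgn_scaleR side_dir_def tt)
    note md = mate_decorations[OF t m]
    have d1: "(\<lambda>s. case s of Hyp \<Rightarrow> increase (composed_dec t d Long) | Long \<Rightarrow> increase (composed_dec t d Hyp)
        | Short \<Rightarrow> (side_dir t Short, 0)) = d"
      using True md(1) by (auto simp: composed_dec_def increase_pred_label fun_eq_iff split: side.split)
    have d2: "(\<lambda>s. case s of Hyp \<Rightarrow> increase (composed_dec t d Short) | Long \<Rightarrow> (side_dir t Short, 0)
        | Short \<Rightarrow> increase (composed_dec t d Hyp)) = mate_dec t"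
      using True md(2,3) by (auto simp: composed_dec_def increase_pred_label fun_eq_iff split: side.split)
    have "cut (compose c (t, d)) = {(Tile Large (?h r) (?h p) (?h q), d), (Tile Small (?h r) (?h ?p) (?h p), mate_dec t)}"
      unfolding c cut.simps Let_def f alt d1 d2 ..
    then show ?thesis using True by (simp add: map_tile_def inv) (simp add: tt mate_def merge_def)
  qed
qed

lemma decomposition_composition: "decomposition c (composition c) = T"
proof -
  have "decomposition c (composition c) = (\<Union>(t, d)\<in>{x \<in> T. kind (fst x) = Large}.
      if paired t then {(t, d), (mate t, mate_dec t)} else {(t, d)})"
    unfolding decomposition_def composition_def UN_simps(10)
  proof (rule SUP_cong[OF refl])
    fix x assume "x \<in> {x \<in> T. kind (fst x) = Large}"
    then show "(\<lambda>(t, d). (map_tile (homothety c (1 / phi)) t, d)) ` cut (compose c x)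
      = (case x of (t, d) \<Rightarrow> if paired t then {(t, d), (mate t, mate_dec t)} else {(t, d)})"
      using scaled_cut_compose[of "fst x" "snd x" c] by (simp add: case_prod_beta)
  qed
  also have "\<dots> = T"
  proof (intro equalityI subsetI)
    fix x assume "x \<in> (\<Union>(t, d)\<in>{x \<in> T. kind (fst x) = Large}. if paired t then {(t, d), (mate t, mate_dec t)} else {(t, d)})"
    then show "x \<in> T" using mate_dec by (auto split: if_splits)
  next
    fix x assume x: "x \<in> T"
    obtain t d where xt: "x = (t, d)" by (cases x)
    show "x \<in> (\<Union>(t, d)\<in>{x \<in> T. kind (fst x) = Large}. if paired t then {(t, d), (mate t, mate_dec t)} else {(t, d)})"
    proof (cases "kind t")
      case Large
      then show ?thesis using x xt by (intro UN_I[of x]) auto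
    next
      case Small
      obtain t' d' where t': "(t', d') \<in> T" "kind t' = Large" "t = mate t'"
        using small_tile_is_mate x xt Small by metis
      then have p: "paired t'" using x xt by (auto simp: paired_def)
      have "d = mate_dec t'" using decoration_unique x xt mate_dec[OF p] t'(3) by metis
      then show ?thesis using t' p xt by (intro UN_I[of "(t', d')"]) auto
    qed
  qed
  finally show ?thesis .
qed

lemma composition_covers: "support (composition c) = UNIV"
proof -
  have "z \<in> support (composition c)" for z
  proof -
    let ?y = "homothety c (1 / phi) z"
    have "?y \<in> support T" using covers by simp
    then obtain t d where t: "(t, d) \<in> T" "?y \<in> region t" by (auto simp: support_def)
    have "\<exists>t' d'. (t', d') \<in> T \<and> kind t' = Large \<and> ?y \<in> region (composed_tile t')"
    proof (cases "kind t")
      case Large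
      then show ?thesis using t by (auto simp: region_composed)
    next
      case Small
      then obtain t' d' where "(t', d') \<in> T" "kind t' = Large" "t = mate t'"
        using small_tile_is_mate t(1) by metis
      then show ?thesis using t by (auto simp: region_composed paired_def)
    qed
    then obtain t' d' where t': "(t', d') \<in> T" "kind t' = Large" "?y \<in> region (composed_tile t')" by blast
    have "z = homothety c phi ?y" using phi_pos by (simp add: homothety_inverse)
    then have "z \<in> region (fst (compose c (t', d')))"
      using t'(3) by (auto simp: compose_def region_homothety)
    moreover have "compose c (t', d') \<in> composition c" using t' by (auto simp: composition_def)
    ultimately show ?thesis unfolding support_def by blast
  qed
  then show ?thesis by blast
qed

text \<open>A common interval of two composed sides contains an interval common to a part of the first and a part
of the second, and the decorations of these sides of \<open>T\<close> match.\<close>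

lemma composition_matches: "sides_match (composition c)"
  unfolding sides_match_def
proof (clarify)
  fix t1 d1 t2 d2 s1 s2 p q
  assume x1: "(t1, d1) \<in> composition c" and x2: "(t2, d2) \<in> composition c"
    and ne: "p \<noteq> q" and seg: "closed_segment p q \<subseteq> side_segment t1 s1 \<inter> side_segment t2 s2"
  let ?h = "homothety c phi"
  obtain u1 e1 where u1: "(u1, e1) \<in> T" "kind u1 = Large" "(t1, d1) = compose c (u1, e1)"
    using x1 by (rule compositionE)
  obtain u2 e2 where u2: "(u2, e2) \<in> T" "kind u2 = Large" "(t2, d2) = compose c (u2, e2)"
    using x2 by (rule compositionE)
  obtain v1 f1 r1 v1' f1' r1' where v1: "(v1, f1) \<in> T" "(v1', f1') \<in> T"
    "side_segment (composed_tile u1) s1 = side_segment v1 r1 \<union> side_segment v1' r1'"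
    "composed_dec u1 e1 s1 = pred_label (f1 r1)" "composed_dec u1 e1 s1 = pred_label (f1' r1')"
    using composed_side_pieces[OF u1(1,2)] by metis
  obtain v2 f2 r2 v2' f2' r2' where v2: "(v2, f2) \<in> T" "(v2', f2') \<in> T"
    "side_segment (composed_tile u2) s2 = side_segment v2 r2 \<union> side_segment v2' r2'"
    "composed_dec u2 e2 s2 = pred_label (f2 r2)" "composed_dec u2 e2 s2 = pred_label (f2' r2')"
    using composed_side_pieces[OF u2(1,2)] by metis
  define p0 where "p0 = homothety c (1 / phi) p"
  define q0 where "q0 = homothety c (1 / phi) q"
  have pq: "p = ?h p0" "q = ?h q0" using phi_pos by (simp_all add: p0_def q0_def homothety_inverse)
  have ne0: "p0 \<noteq> q0" using ne pq by auto
  have "closed_segment p q = ?h ` closed_segment p0 q0"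
    unfolding pq segment_convex_hull homothety_affine using convex_hull_affinity[of "c - phi *\<^sub>R c" phi "{p0, q0}"] by simp
  moreover have "side_segment t1 s1 = ?h ` side_segment (composed_tile u1) s1"
    "side_segment t2 s2 = ?h ` side_segment (composed_tile u2) s2"
    using u1(3) u2(3) by (simp_all add: compose_def side_segment_homothety)
  moreover have "inj ?h" using phi_pos by (simp add: inj_homothety)
  ultimately have s: "closed_segment p0 q0 \<subseteq> side_segment v1 r1 \<union> side_segment v1' r1'"
    "closed_segment p0 q0 \<subseteq> side_segment v2 r2 \<union> side_segment v2' r2'"
    using seg unfolding v1(3)[symmetric] v2(3)[symmetric] by (simp_all add: inj_image_subset_iff)
  obtain p1 q1 where 1: "p1 \<noteq> q1" "closed_segment p1 q1 \<subseteq> closed_segment p0 q0"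
    "closed_segment p1 q1 \<subseteq> side_segment v1 r1 \<or> closed_segment p1 q1 \<subseteq> side_segment v1' r1'"
    using subsegment_in_union[OF ne0 s(1) convex_side_segment convex_side_segment] by blast
  obtain w1 g1 k1 where w1: "(w1, g1) \<in> T" "closed_segment p1 q1 \<subseteq> side_segment w1 k1" "composed_dec u1 e1 s1 = pred_label (g1 k1)"
    using 1(3) v1 by blast
  have s': "closed_segment p1 q1 \<subseteq> side_segment v2 r2 \<union> side_segment v2' r2'" using 1(2) s(2) by blast
  obtain p2 q2 where 2: "p2 \<noteq> q2" "closed_segment p2 q2 \<subseteq> closed_segment p1 q1"
    "closed_segment p2 q2 \<subseteq> side_segment v2 r2 \<or> closed_segment p2 q2 \<subseteq> side_segment v2' r2'"
    using subsegment_in_union[OF 1(1) s' convex_side_segment convex_side_segment] by blast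
  obtain w2 g2 k2 where w2: "(w2, g2) \<in> T" "closed_segment p2 q2 \<subseteq> side_segment w2 k2" "composed_dec u2 e2 s2 = pred_label (g2 k2)"
    using 2(3) v2 by blast
  have "closed_segment p2 q2 \<subseteq> side_segment w1 k1 \<inter> side_segment w2 k2" using 2(2) w1(2) w2(2) by blast
  then have "g1 k1 = g2 k2"
    using matching w1(1) w2(1) 2(1) unfolding sides_match_def by blast
  then show "d1 s1 = d2 s2" using w1(3) w2(3) u1(3) u2(3) by (simp add: compose_def)
qed

end

section \<open>Legality of the composed stars\<close>

text \<open>\<open>ds\<close> is exactly what a star centered at \<open>A\<close> shows of the decoration \<open>d\<close>.\<close>

definition reads :: "complex \<Rightarrow> tile \<Rightarrow> (side \<Rightarrow> decoration) \<Rightarrow> decs \<Rightarrow> bool" where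
  "reads A t d ds \<longleftrightarrow> (\<forall>s. (A \<in> side_segment t s \<longleftrightarrow> dec_at ds s \<noteq> None) \<and>
     (\<forall>x. dec_at ds s = Some x \<longrightarrow> d s = decoration_of t s x))"

lemma readsD: "reads A t d ds \<Longrightarrow> dec_at ds s = Some x \<Longrightarrow> d s = decoration_of t s x"
  "reads A t d ds \<Longrightarrow> A \<in> side_segment t s \<longleftrightarrow> dec_at ds s \<noteq> None"
  unfolding reads_def by blast+

lemma regularD:
  assumes "n \<in> {1..7}" "ax \<in> set (axes n)" "n \<noteq> 1" "j < length (star_code n (Some ax))" "g = star_code n (Some ax) ! j"
  shows "gkind g = Large \<Longrightarrow> gslot g \<noteq> SM \<and> (n = 6 \<and> j = 4 \<or> map_of (forced_pairing n) j \<noteq> None)"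
    "gkind g = Small \<Longrightarrow> gslot g \<noteq> SF \<and> gslot g \<noteq> SM"
proof -
  have "j \<in> set [0..<length (star_code n (Some ax))]" using assms(4) by simp
  then have "if gkind g = Large then gslot g \<noteq> SM \<and> (n = 6 \<and> j = 4 \<or> map_of (forced_pairing n) j \<noteq> None)
     else gslot g \<noteq> SF \<and> gslot g \<noteq> SM"
    using regular[OF assms(1,2)] assms(3,5) unfolding regular_def list_all_iff Let_def by (metis (no_types, lifting))
  then show "gkind g = Large \<Longrightarrow> gslot g \<noteq> SM \<and> (n = 6 \<and> j = 4 \<or> map_of (forced_pairing n) j \<noteq> None)"
    "gkind g = Small \<Longrightarrow> gslot g \<noteq> SF \<and> gslot g \<noteq> SM" by (simp_all split: if_splits)
qed

lemma reads_no_decs: "A \<notin> region t \<Longrightarrow> reads A t d no_decs"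
  using side_segment_subset_region by (auto simp: reads_def no_decs_def all_sides)

lemma entry_eqI:
  assumes "\<And>s. dec_at ds s = None \<Longrightarrow> A \<notin> side_segment u s"
    "\<And>s x. dec_at ds s = Some x \<Longrightarrow> A \<in> side_segment u s \<and> d s = decoration_of t s x"
  shows "(t, \<lambda>s. if A \<in> side_segment u s then Some (d s) else None) = entry t ds"
  unfolding entry_def
proof (rule arg_cong[where f = "Pair t"], rule ext)
  fix s
  show "(if A \<in> side_segment u s then Some (d s) else None) = map_option (decoration_of t s) (dec_at ds s)"
    using assms by (cases "dec_at ds s") auto
qed

lemma mate_decs:
  assumes "\<exists>h\<in>set G. same_place (mate_germ g) h"
  obtains h where "h \<in> set G" "same_place (mate_germ g) h" "mate_decs G g = gdecs h"
proof -
  have "\<exists>h\<in>set G. same_place (mate_germ g) h \<and> mate_decs G g = gdecs h"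
    using assms by (induction G) auto
  then show thesis using that by blast
qed

lemma merge_germ_decs [simp]: "gdecs (merge_germ g ds) = ds" "gdecs (shrink_germ g ds) = ds" "gdecs (merge_small_germ g ds) = ds"
  by (cases g; simp)+

lemma compose_starE:
  assumes "h \<in> set (compose_star P G)"
  obtains (large) j where "j < length G" "gkind (G ! j) = Large" "h = compose_germ G (P j) (G ! j)"
  | (small) g where "g \<in> set G" "gkind g = Small" "gslot g = SP" "h = merge_small_germ g (merge_decs no_decs (gdecs g))"
  using assms by (auto simp: compose_star_def)

lemma compose_starI:
  "j < length G \<Longrightarrow> gkind (G ! j) = Large \<Longrightarrow> compose_germ G (P j) (G ! j) \<in> set (compose_star P G)"
  "g \<in> set G \<Longrightarrow> gkind g = Small \<Longrightarrow> gslot g = SP \<Longrightarrow> merge_small_germ g (merge_decs no_decs (gdecs g)) \<in> set (compose_star P G)"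
  by (auto simp: compose_star_def)

context legal_tiling
begin

definition composed_entry :: "complex \<Rightarrow> complex \<Rightarrow> colored_tile \<Rightarrow> tile \<times> (side \<Rightarrow> decoration option)" where
  "composed_entry c A = (\<lambda>(t, d). (map_tile (homothety c phi) (composed_tile t),
     \<lambda>s. if A \<in> side_segment (composed_tile t) s then Some (composed_dec t d s) else None))"

lemma star_composition:
  "star_within (composition c) (homothety c phi A) =
    (homothety c phi A, composed_entry c A ` {(t, d) \<in> T. kind t = Large \<and> A \<in> region (composed_tile t)})"
proof -
  have inj: "inj (homothety c phi)" using phi_pos by (simp add: inj_homothety)
  have "{(t, \<lambda>s. if homothety c phi A \<in> side_segment t s then Some (d s) else None) | t d.
      (t, d) \<in> composition c \<and> homothety c phi A \<in> region t}
    = composed_entry c A ` {(t, d) \<in> T. kind t = Large \<and> A \<in> region (composed_tile t)}" (is "?L = ?R")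
  proof (intro equalityI subsetI)
    fix x assume "x \<in> ?L"
    then obtain t d where x: "x = (t, \<lambda>s. if homothety c phi A \<in> side_segment t s then Some (d s) else None)"
      and td: "(t, d) \<in> composition c" "homothety c phi A \<in> region t" by blast
    obtain u e where u: "(u, e) \<in> T" "kind u = Large" "(t, d) = compose c (u, e)"
      using td(1) by (rule compositionE)
    then have t: "t = map_tile (homothety c phi) (composed_tile u)" "d = composed_dec u e"
      by (simp_all add: compose_def)
    have "A \<in> region (composed_tile u)"
      using td(2) unfolding t(1) region_homothety inj_image_mem_iff[OF inj] .
    moreover have "x = composed_entry c A (u, e)"
      unfolding x t composed_entry_def side_segment_homothety inj_image_mem_iff[OF inj] by simp
    ultimately show "x \<in> ?R" using u by blast
  next
    fix x assume "x \<in> ?R"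
    then obtain u e where u: "(u, e) \<in> T" "kind u = Large" "A \<in> region (composed_tile u)" "x = composed_entry c A (u, e)"
      by auto
    have "compose c (u, e) \<in> composition c" using u by (auto simp: composition_def)
    then have 1: "(map_tile (homothety c phi) (composed_tile u), composed_dec u e) \<in> composition c"
      by (simp add: compose_def)
    have 2: "homothety c phi A \<in> region (map_tile (homothety c phi) (composed_tile u))"
      unfolding region_homothety inj_image_mem_iff[OF inj] by (rule u(3))
    have "x = (map_tile (homothety c phi) (composed_tile u), \<lambda>s. if homothety c phi A \<in>
        side_segment (map_tile (homothety c phi) (composed_tile u)) s then Some (composed_dec u e s) else None)"
      unfolding u(4) composed_entry_def side_segment_homothety inj_image_mem_iff[OF inj] by simp
    with 1 2 show "x \<in> ?L" by blast
  qed
  then show ?thesis by (simp add: star_within_def)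
qed

lemma composed_entry_shrink:
  assumes "\<not> paired t" "reads A t d ds"
  shows "composed_entry c A (t, d) = entry (map_tile (homothety c phi) (shrink t)) (pred_decs ds)"
proof -
  obtain h l a where ds: "ds = Decs h l a" by (cases ds)
  have sd: "side_dir (map_tile (homothety c phi) (shrink t)) s = side_dir t s" for s
    by (simp add: side_dir_homothety[OF phi_pos] side_dir_shrink)
  have at: "dec_at (pred_decs ds) s = map_option pred_dec (dec_at ds s)" for s
    by (cases s) (simp_all add: ds)
  have "composed_entry c A (t, d) = (map_tile (homothety c phi) (shrink t),
      \<lambda>s. if A \<in> side_segment t s then Some (pred_label (d s)) else None)"
  proof -
    have cd: "composed_dec t d = (\<lambda>s. pred_label (d s))" using assms(1) by (simp add: composed_dec_def fun_eq_iff)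
    show ?thesis
      using assms(1) unfolding composed_entry_def prod.case cd by (simp add: composed_tile_def side_segment_shrink)
  qed
  also have "\<dots> = entry (map_tile (homothety c phi) (shrink t)) (pred_decs ds)"
    using assms(2) pred_label_decoration_of[OF sd]
    by (intro entry_eqI) (auto simp: reads_def at simp del: pred_label.simps decoration_of.simps pred_dec.simps)
  finally show ?thesis .
qed

lemma composed_entry_merge:
  assumes t: "(t, d) \<in> T" "kind t = Large" "paired t" and L: "reads A t d dsL" and S: "reads A (mate t) (mate_dec t) dsS"
  shows "composed_entry c A (t, d) = entry (map_tile (homothety c phi) (merge t)) (merge_decs dsL dsS)"
proof -
  obtain h l a h' l' a' where ds: "dsL = Decs h l a" "dsS = Decs h' l' a'" by (cases dsL; cases dsS)
  let ?u = "map_tile (homothety c phi) (merge t)"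
  note sd = side_dir_homothety[OF phi_pos]
  have H: "side_dir ?u Hyp = side_dir t Long" "side_dir ?u Hyp = - side_dir (mate t) Short"
    "side_dir ?u Long = side_dir t Hyp" "side_dir ?u Short = - side_dir (mate t) Hyp"
    by (simp_all add: sd side_dir_merge side_dir_mate)
  have m: "mate_dec t Short = d Long" by (rule mate_decorations(3)[OF t(1,2) mate_dec[OF t(3)]])
  have eq: "composed_entry c A (t, d) = (?u, \<lambda>s. if A \<in> side_segment (merge t) s then Some (composed_dec t d s) else None)"
    using t(3) by (simp add: composed_entry_def composed_tile_def)
  have "A \<in> side_segment (merge t) s \<longleftrightarrow> dec_at (merge_decs dsL dsS) s \<noteq> None" for s
    using readsD(2)[OF L, of Hyp] readsD(2)[OF L, of Long] readsD(2)[OF S, of Hyp] readsD(2)[OF S, of Short]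
    by (cases s) (auto simp: ds side_segment_merge split: option.splits)
  moreover have "composed_dec t d s = decoration_of ?u s x" if x: "dec_at (merge_decs dsL dsS) s = Some x" for s x
  proof (cases s)
    case Hyp
    show ?thesis
    proof (cases l)
      case (Some y)
      then have "d Long = decoration_of t Long y" "x = pred_dec y" using readsD(1)[OF L, of Long y] x Hyp by (simp_all add: ds)
      then show ?thesis using t(3) Hyp pred_label_decoration_of[OF H(1)] by (simp add: composed_dec_def)
    next
      case None
      then obtain y where "a' = Some y" "x = pred_dec (flip_dec y)" using x Hyp by (auto simp: ds)
      moreover from this have "d Long = decoration_of (mate t) Short y" using readsD(1)[OF S, of Short y] m by (simp add: ds)
      ultimately show ?thesis using t(3) Hyp pred_label_decoration_of_flip[OF H(2)] by (simp add: composed_dec_def)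
    qed
  next
    case Long
    then obtain y where "h = Some y" "x = pred_dec y" using x by (auto simp: ds)
    moreover from this have "d Hyp = decoration_of t Hyp y" using readsD(1)[OF L, of Hyp y] by (simp add: ds)
    ultimately show ?thesis using t(3) Long pred_label_decoration_of[OF H(3)] by (simp add: composed_dec_def)
  next
    case Short
    then obtain y where "h' = Some y" "x = pred_dec (flip_dec y)" using x by (auto simp: ds)
    moreover from this have "mate_dec t Hyp = decoration_of (mate t) Hyp y" using readsD(1)[OF S, of Hyp y] by (simp add: ds)
    ultimately show ?thesis using t(3) Short pred_label_decoration_of_flip[OF H(4)] by (simp add: composed_dec_def)
  qed
  ultimately show ?thesis unfolding eq by (intro entry_eqI) auto
qed

lemma star_reads:
  assumes star: "star_is T A w b n ax" and g: "g \<in> set (star_code n (Some ax))"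
  obtains d where "(placed A w b g, d) \<in> T" "A \<in> region (placed A w b g)" "reads A (placed A w b g) d (gdecs g)"
  using star_is_germ[OF star g] unfolding reads_def by metis

text \<open>If the mate of a paired tile contains the center, then it is an entry of the star and is found by
\<open>mate_decs\<close>; otherwise no side of it can be read.\<close>

lemma compose_germ_entry:
  assumes star: "star_is T A w b n ax" and n: "n \<noteq> 1" and j: "j < length (star_code n (Some ax))"
    and k: "gkind (star_code n (Some ax) ! j) = Large"
    and t: "t = placed A w b (star_code n (Some ax) ! j)" "(t, d) \<in> T"
  defines "h \<equiv> compose_germ (star_code n (Some ax)) (paired t) (star_code n (Some ax) ! j)"
  shows "composed_entry c A (t, d) = entry (placed (homothety c phi A) w b h) (gdecs h)"
proof -
  let ?G = "star_code n (Some ax)"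
  let ?g = "?G ! j"
  have g: "?g \<in> set ?G" using j by simp
  have kt: "kind t = Large" using t k by simp
  obtain d' where d': "(t, d') \<in> T" "reads A t d' (gdecs ?g)" using star_reads[OF star g] t(1) by metis
  have rd: "reads A t d (gdecs ?g)" using d' decoration_unique[OF t(2) d'(1)] by simp
  have w: "norm w = 1" "w \<noteq> 0" using star_is_range[OF star] by auto
  have sm: "gslot ?g \<noteq> SM"
    using regularD(1)[OF _ _ n j refl k] star_is_range[OF star] by blast
  show ?thesis
  proof (cases "paired t")
    case False
    have "map_tile (homothety c phi) (shrink t) = placed (homothety c phi A) w b h" for ds
      unfolding t(1) h_def compose_germ_def using False t(1) shrink_placed[OF k] by simp
    then show ?thesis
      unfolding composed_entry_shrink[OF False rd] using False by (simp add: h_def compose_germ_def)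
  next
    case True
    define dsS where "dsS = (if gslot ?g = SR then mate_decs ?G ?g else if gslot ?g = SP then mate_decs ?G ?g else no_decs)"
    have hd: "h = merge_germ ?g (merge_decs (gdecs ?g) dsS)"
      using True by (simp add: h_def compose_germ_def dsS_def)
    have "reads A (mate t) (mate_dec t) dsS"
    proof (cases "gslot ?g \<in> {SR, SP}")
      case False
      have "A = spot t (gslot ?g)" using spot_placed t(1) by metis
      then have "A \<notin> region (mate t)" using spot_not_in_mate[OF tiles[OF t(2)] False] by simp
      then show ?thesis using False by (auto simp: dsS_def reads_no_decs)
    next
      case slot: True
      have mt: "mate t = placed A w b (mate_germ ?g)" unfolding t(1) by (rule mate_placed[OF k slot])
      have "A \<in> region (mate t)" unfolding mt using spot_in_region spot_placed by metis
      from star_is_tile[OF star mate_dec[OF True] this]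
      obtain h' where h': "h' \<in> set ?G" "mate t = placed A w b h'" by metis
      have "same_place (mate_germ ?g) h'"
        unfolding same_place
        using map_germ_tile_inj[OF w(1) w(1) h'(2)[unfolded mt, unfolded placed_def] refl] w(2) direction_inj
        by (auto simp: eq_commute[of b])
      then obtain g' where g': "g' \<in> set ?G" "same_place (mate_germ ?g) g'" "mate_decs ?G ?g = gdecs g'"
        using mate_decs[of ?G ?g] h'(1) by metis
      have "mate t = placed A w b g'" using mt placed_cong[of "mate_germ ?g" g'] g'(2) unfolding same_place by simp
      then obtain d'' where "(mate t, d'') \<in> T" "reads A (mate t) d'' (gdecs g')" using star_reads[OF star g'(1)] by metis
      then have "reads A (mate t) (mate_dec t) (gdecs g')"
        using decoration_unique mate_dec[OF True] by metis
      then show ?thesis using slot g'(3) by (auto simp: dsS_def)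
    qed
    from composed_entry_merge[OF t(2) kt True rd this, of c]
    show ?thesis unfolding hd using merge_placed[OF k sm] t(1) by simp
  qed
qed

lemma compose_small_entry:
  assumes star: "star_is T A w b n ax" and g: "g \<in> set (star_code n (Some ax))" "gkind g = Small" "gslot g = SP"
    and t: "(t, d) \<in> T" "kind t = Large" "mate t = placed A w b g"
  defines "h \<equiv> merge_small_germ g (merge_decs no_decs (gdecs g))"
  shows "composed_entry c A (t, d) = entry (placed (homothety c phi A) w b h) (gdecs h)" "paired t" "A \<in> region (mate t)"
proof -
  obtain d' where d': "(mate t, d') \<in> T" "A \<in> region (mate t)" "reads A (mate t) d' (gdecs g)"
    using star_reads[OF star g(1)] t(3) by metis
  show p: "paired t" using d' by (auto simp: paired_def)
  show "A \<in> region (mate t)" by (rule d')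
  have rS: "reads A (mate t) (mate_dec t) (gdecs g)" using d' decoration_unique[OF d'(1) mate_dec[OF p]] by simp
  have "A = vlarger (mate t)" using t(3) g(3) spot_placed by (metis spot.simps(2))
  then have "A \<notin> region t" using mate_spot_not_in_region[OF tiles[OF t(1)]] by simp
  then have rL: "reads A t d no_decs" by (rule reads_no_decs)
  from composed_entry_merge[OF t(1,2) p rL rS, of c]
  show "composed_entry c A (t, d) = entry (placed (homothety c phi A) w b h) (gdecs h)"
    unfolding h_def using merge_small_placed[OF g(2,3) t(3)] by simp
qed

text \<open>The star of the composition consists of the composed tiles one of whose parts contains the center. If
the large part does not contain it, then the center is the larger acute angle of the small part: the
other vertices of the small part belong to the large part, and points inside the sides of small tiles
are no centers.\<close>

lemma composed_star:
  assumes star: "star_is T A w b n ax" and n: "n \<noteq> 1"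
    and P: "\<And>j. j < length (star_code n (Some ax)) \<Longrightarrow> gkind (star_code n (Some ax) ! j) = Large \<Longrightarrow>
      P j = paired (placed A w b (star_code n (Some ax) ! j))"
  shows "composed_entry c A ` {(t, d) \<in> T. kind t = Large \<and> A \<in> region (composed_tile t)}
    = (\<lambda>h. entry (placed (homothety c phi A) w b h) (gdecs h)) ` set (compose_star P (star_code n (Some ax)))"
    (is "?L = ?R")
proof (intro equalityI subsetI)
  let ?G = "star_code n (Some ax)"
  fix x assume "x \<in> ?L"
  then obtain t d where t: "(t, d) \<in> T" "kind t = Large" "A \<in> region (composed_tile t)" "x = composed_entry c A (t, d)"
    by auto
  show "x \<in> ?R"
  proof (cases "A \<in> region t")
    case True
    obtain g where g: "g \<in> set ?G" "t = placed A w b g" using star_is_tile[OF star t(1) True] by metis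
    then obtain j where j: "j < length ?G" "g = ?G ! j" by (auto simp: in_set_conv_nth)
    have k: "gkind (?G ! j) = Large" using g j t(2) by simp
    have tj: "t = placed A w b (?G ! j)" using g j by simp
    have "P j = paired t" using P[OF j(1) k] tj by simp
    then have "compose_germ ?G (paired t) (?G ! j) \<in> set (compose_star P ?G)" using compose_starI(1)[OF j(1) k, of P] by simp
    then show ?thesis unfolding t(4) compose_germ_entry[OF star n j(1) k tj t(1), of c] by (rule imageI)
  next
    case False
    then have p: "paired t" "A \<in> region (mate t)" using t(3) by (auto simp: region_composed split: if_splits)
    obtain g where g: "g \<in> set ?G" "mate t = placed A w b g"
      using star_is_tile[OF star mate_dec[OF p(1)] p(2)] by metis
    have k: "gkind g = Small" using g(2) by (metis kind_placed mate_simps(1))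
    have A: "A = spot (mate t) (gslot g)" using g(2) spot_placed by metis
    obtain j where j: "j < length ?G" "g = ?G ! j" using g(1) by (auto simp: in_set_conv_nth)
    have "gslot g \<noteq> SF" "gslot g \<noteq> SM"
      using regularD(2)[OF _ _ n j k] star_is_range[OF star] by blast+
    moreover have "gslot g \<noteq> SR" using A False spot_in_region[of t SR] by auto
    moreover have "gslot g \<noteq> SQ" using A False spot_in_region[of t SP] by auto
    ultimately have s: "gslot g = SP" by (cases "gslot g") auto
    show ?thesis
      unfolding t(4) compose_small_entry(1)[OF star g(1) k s t(1,2) g(2), of c] by (rule imageI) (rule compose_starI(2)[OF g(1) k s])
  qed
next
  let ?G = "star_code n (Some ax)"
  fix x assume "x \<in> ?R"
  then obtain h where h: "h \<in> set (compose_star P ?G)" "x = entry (placed (homothety c phi A) w b h) (gdecs h)" by auto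
  from h(1) show "x \<in> ?L"
  proof (cases rule: compose_starE)
    case (large j)
    let ?t = "placed A w b (?G ! j)"
    obtain d where d: "(?t, d) \<in> T" "A \<in> region ?t" using star_reads[OF star nth_mem[OF large(1)]] by metis
    have "composed_entry c A (?t, d) = x"
      using compose_germ_entry[OF star n large(1,2) refl d(1), of c] P[OF large(1,2)] large(3) h(2) by simp
    moreover have "A \<in> region (composed_tile ?t)" using d(2) by (simp add: region_composed)
    ultimately show ?thesis using d(1) large(2) by (force simp: image_iff)
  next
    case (small g)
    obtain d where d: "(placed A w b g, d) \<in> T" using star_reads[OF star small(1)] by metis
    obtain t e where t: "(t, e) \<in> T" "kind t = Large" "placed A w b g = mate t"
      using small_tile_is_mate[OF d] small(2) by auto
    note c = compose_small_entry[OF star small(1,2,3) t(1,2) t(3)[symmetric]]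
    have "composed_entry c A (t, e) = x" using c(1) small(4) h(2) by simp
    moreover have "A \<in> region (composed_tile t)" using c(2,3) by (simp add: region_composed)
    ultimately show ?thesis using t(1,2) by (force simp: image_iff)
  qed
qed

text \<open>The composed tiles at the point cover the scaled copy of what the tiles of \<open>T\<close> cover there.\<close>

lemma complete_composed:
  assumes "complete_star (star_within T A)"
  shows "complete_star (star_within (composition c) (homothety c phi A))"
proof -
  let ?h = "homothety c phi"
  let ?U = "\<Union>x\<in>snd (star_within T A). region (fst x)"
  let ?V = "\<Union>x\<in>snd (star_within (composition c) (?h A)). region (fst x)"
  have A: "A \<in> interior ?U" using assms by (simp add: complete_star_def star_within_def)
  have "?h ` ?U \<subseteq> ?V"
  proof
    fix y assume "y \<in> ?h ` ?U"
    then obtain z t d where z: "y = ?h z" "z \<in> region t" "(t, d) \<in> T" "A \<in> region t"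
      by (auto simp: star_within_def)
    have "\<exists>u e. (u, e) \<in> T \<and> kind u = Large \<and> region t \<subseteq> region (composed_tile u)"
    proof (cases "kind t")
      case Large
      then show ?thesis using z(3) by (auto simp: region_composed)
    next
      case Small
      then obtain u e where "(u, e) \<in> T" "kind u = Large" "t = mate u" using small_tile_is_mate z(3) by metis
      then show ?thesis using z(3) by (auto simp: region_composed paired_def)
    qed
    then obtain u e where u: "(u, e) \<in> T" "kind u = Large" "region t \<subseteq> region (composed_tile u)" by blast
    then have "composed_entry c A (u, e) \<in> snd (star_within (composition c) (?h A))"
      unfolding star_composition using z(4) by auto
    moreover have "y \<in> region (fst (composed_entry c A (u, e)))"
      using z(1,2) u(3) by (auto simp: composed_entry_def region_homothety)
    ultimately show "y \<in> ?V" by blast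
  qed
  moreover have "open (?h ` interior ?U)"
    unfolding homothety_affine using phi_pos by (intro open_affinity) auto
  moreover have "?h ` interior ?U \<subseteq> ?h ` ?U" by (intro image_mono interior_subset)
  ultimately have "?h ` interior ?U \<subseteq> interior ?V" by (meson interior_maximal subset_trans)
  then show ?thesis using A by (auto simp: complete_star_def star_within_def)
qed

lemma composed_star_legal:
  assumes star: "star_is T A w b n ax" and n: "n \<noteq> 1" and complete: "complete_star (star_within T A)"
  shows "legal_star (star_within (composition c) (homothety c phi A))"
proof -
  let ?G = "star_code n (Some ax)"
  have r: "n \<in> {2..7}" "ax \<in> set (axes n)" "norm w = 1" using star_is_range[OF star] n by auto
  define v where "v = paired (placed A w b (?G ! 4))"
  have P: "pairing n v j = paired (placed A w b (?G ! j))" if j: "j < length ?G" "gkind (?G ! j) = Large" for j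
  proof (cases "map_of (forced_pairing n) j")
    case (Some p)
    then show ?thesis using forced_pairing[OF star map_of_SomeD[OF Some]] by (simp add: pairing_def)
  next
    case None
    then have "n = 6 \<and> j = 4"
      using regularD(1)[OF _ r(2) n j(1) refl j(2)] None star_is_range[OF star] by blast
    then show ?thesis using None by (simp add: pairing_def v_def)
  qed
  from composes[OF r(1,2), of v] obtain d ax' where ax': "ax' \<in> set (axes (target n v))"
    and eq: "set (compose_star (pairing n v) ?G) = set (map (turn d True) (star_code (target n v) (Some ax')))"
    unfolding composes_def list_ex_iff by auto
  have m: "target n v \<in> {1..7}" using r(1) by (auto simp: target_def)
  let ?w = "w * cj b (direction d)"
  have nw: "norm ?w = 1" using r(3) by (simp add: norm_mult)
  have pl: "placed B w b (turn d True h) = placed B ?w b h" for B h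
    unfolding placed_def germ_tile_turn map_tile_map_tile motion_motion by simp
  have "(\<lambda>h. entry (placed (homothety c phi A) w b h) (gdecs h)) ` set (compose_star (pairing n v) ?G)
    = (\<lambda>h. entry (placed (homothety c phi A) ?w b h) (gdecs h)) ` set (star_code (target n v) (Some ax'))"
    unfolding eq set_map image_image pl turn_simps ..
  then have W: "star_within (composition c) (homothety c phi A) = (homothety c phi A,
      (\<lambda>h. entry (placed (homothety c phi A) ?w b h) (gdecs h)) ` set (star_code (target n v) (Some ax')))"
    unfolding star_composition using composed_star[OF star n P, of c] by simp
  show ?thesis
    using legal_starI[OF _ nw m ax' refl] complete_composed[OF complete, of c] unfolding W by blast
qed

text \<open>In \<open>C\<^sub>1\<close> the tiles with a vertex at the center have their right angle there and are mates, so the center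
becomes the foot of an altitude.\<close>

lemma vertex_star_not_first:
  assumes t: "(t, d) \<in> T" "kind t = Large" and A: "A \<in> vertices (composed_tile t)" and star: "star_is T A w b n ax"
  shows "n \<noteq> 1"
proof
  assume n: "n = 1"
  have reg: "gslot g = SR \<or> gkind g = Large \<and> gslot g = SM" if "g \<in> set (star_code n (Some ax))" for g
    using regular[of n ax] star_is_range[OF star] that n by (auto simp: regular_def list_all_iff Let_def in_set_conv_nth)
  have key: "s = SR" if u: "(u, e) \<in> T" "A = spot u s" "s \<noteq> SM" for u e s
  proof -
    have "A \<in> region u" using spot_in_region u(2) by simp
    from star_is_tile[OF star u(1) this] obtain g where g: "g \<in> set (star_code n (Some ax))" "u = placed A w b g" by metis
    have "spot u (gslot g) = spot u s" using g(2) spot_placed u(2) by metis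
    then have "gslot g = s" using spot_inj[OF tiles[OF u(1)]] by blast
    then show ?thesis using reg[OF g(1)] u(3) by auto
  qed
  show False
  proof (cases "paired t")
    case True
    note m = mate_dec[OF True]
    have "A \<in> {vlarger t, vlarger (mate t), vsmaller t}"
      using A True by (auto simp: composed_tile_def vertices_def)
    then show False
      using key[OF t(1), of SP] key[OF t(1), of SQ] key[OF m, of SP] by auto
  next
    case False
    then have "A \<in> {vright t, vlarger t, vsmaller t}"
      using A by (auto simp: composed_tile_def vertices_def)
    then have "A = vright t" using key[OF t(1), of SP] key[OF t(1), of SQ] by auto
    then have "paired t" using paired_iff(2)[OF _ t, of w b n ax] star n by simp
    with False show False by simp
  qed
qed

lemma L_tiling_composition: "L_tiling (composition c)"
  unfolding L_tiling_def
proof (intro conjI ballI)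
  show "colored_tiling (composition c)" by (rule composition_tiling)
  show "support (composition c) = UNIV" by (rule composition_covers)
  show "sides_match (composition c)" by (rule composition_matches)
  fix x A' assume x: "x \<in> composition c" and A': "A' \<in> vertices (fst x)"
  obtain t d where t: "(t, d) \<in> T" "kind t = Large" "x = compose c (t, d)" using x by (rule compositionE)
  then obtain A where A: "A \<in> vertices (composed_tile t)" "A' = homothety c phi A"
    using A' by (auto simp: compose_def vertices_map)
  have "\<exists>y\<in>T. A \<in> vertices (fst y)"
  proof (cases "paired t")
    case True
    then have "A \<in> vertices t \<or> A \<in> vertices (mate t)" using A(1) by (auto simp: composed_tile_def vertices_def)
    then show ?thesis using t(1) mate_dec[OF True] by force
  next
    case False
    then have "A \<in> vertices t" using A(1) by (auto simp: composed_tile_def vertices_def)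
    then show ?thesis using t(1) by force
  qed
  then have legal: "legal_star (star_within T A)" using legal_at_vertices by blast
  then obtain w b n ax where star: "star_is T A w b n ax" by (rule legal_starE)
  have "complete_star (star_within T A)" using legal by (simp add: legal_star_def)
  then show "legal_star (star_within (composition c) A')"
    unfolding A(2) using composed_star_legal[OF star vertex_star_not_first[OF t(1,2) A(1) star]] by blast
qed

end

theorem theorem3:
  fixes c :: complex and T :: "colored_tile set"
  assumes "L_tiling T"
  shows "\<exists>T'. is_composition c T' T \<and> L_tiling T'"
proof -
  interpret legal_tiling T by unfold_locales (rule assms)
  show ?thesis
    using composition_tiling decomposition_composition L_tiling_composition
    unfolding is_composition_def by blast
qed

end
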